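(* The family of elements $g=\{g_i\}_{i\in\mathbb{Z}}$ of $A=\mathbb{S}^{nc}(V)$ is a normal family, of degree $2$ if $V$ is simple and of degree $1$ if $V$ is non-simple.
   Context: $K_0,K_1$ are fields of characteristic $\neq 2$ and $V$ is a $K_0$-$K_1$-bimodule of rank two: $\dim_{K_0}V=\dim V_{K_1}=2$. For $i\in\mathbb{Z}$ put $K_i=K_0$ if $i$ is even, $K_i=K_1$ if $i$ is odd. For fields $L,M$ and an $L$-$M$-bimodule $W$, the right dual $W^*=\operatorname{Hom}_M(W_M,M)$ and left dual ${}^*W=\operatorname{Hom}_L({}_LW,L)$ are $M$-$L$-bimodules via $(a\psi b)(v)=a\psi(bv)$, respectively $(a\phi b)(v)=b\phi(va)$. Put $V^{0*}=V$, $V^{i*}=(V^{(i-1)*})^*$ for $i>0$, $V^{i*}={}^*(V^{(i+1)*})$ for $i<0$; $V^{i*}$ is a $K_i$-$K_{i+1}$-bimodule of rank two, and $V^{(i+1)*}$ is canonically the right dual of $V^{i*}$ for every $i$. A $\mathbb{Z}$-indexed algebra $D$ consists of abelian groups $D_{ij}$ ($i,j\in\mathbb{Z}$) with associative biadditive multiplications $D_{ij}\times D_{jl}\to D_{il}$ and units $e_i\in D_{ii}$. A normal family of elements of degree $\delta$ in $D$ is a family $g=\{g_i\}$ with $g_i\in D_{i,i+\delta}$ for $i\in\mathbb{Z}$ such that $g_iD_{i+\delta,j+\delta}=D_{ij}g_j$ for all $i,j\in\mathbb{Z}$. Let $T$ be the tensor $\mathbb{Z}$-indexed algebra: $T_{ij}=0$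 for $i>j$, $T_{ii}=K_i$, $T_{ij}=V^{i*}\otimes_{K_{i+1}}\cdots\otimes_{K_{j-1}}V^{(j-1)*}$ for $i<j$. Let $Q_i\subset V^{i*}\otimes V^{(i+1)*}\cong\operatorname{End}_{K_{i+1}}(V^{i*})$ be the image of $K_i$ acting by left multiplication; it is generated by $\sum_s x_s\otimes x_s^*$ for any right basis $\{x_s\}$ of $V^{i*}$ with dual basis $\{x_s^*\}$. The non-commutative symmetric algebra is $A=\mathbb{S}^{nc}(V)=T/R$, $R$ the ideal generated by all $Q_i$. Definition of $g$. (a) $V$ simple: there are a field $F$ and embeddings $\iota_j:K_j\to F$ with $[F:\iota_j(K_j)]=2$ ($j=0,1$) such that $V\cong{}_0F_1$, i.e. $F$ with left action via $\iota_0$ and right action via $\iota_1$; ${}_1F_0$ is $F$ with left action via $\iota_1$ and right action via $\iota_0$. With $\sigma_j$ the generator of $\operatorname{Gal}(F/\iota_j(K_j))$ and $\operatorname{tr}_j(a)=\iota_j^{-1}(\frac12(a+\sigma_j(a)))$, the maps $a\mapsto[b\mapsto\operatorname{tr}_1(ba)]$ and $a\mapsto[b\mapsto\operatorname{tr}_0(ba)]$ identify ${}_0F_1^*={}_1F_0$ and ${}_1F_0^*={}_0F_1$, so $V^{i*}={}_0F_1$ for $i$ even, ${}_1F_0$ for $i$ odd. Choose $w_j\in F$ with $w_j^2\in\iota_j(K_j)$ and $w_j\notin\iota_0(K_0)\cup\iota_1(K_1)$. Then $g_i\in A_{i,i+2}$ is the image of $w_1\otimes1+1\otimes w_1\in F\otimes_{K_1}F$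 for $i$ even and of $w_0\otimes1+1\otimes w_0\in F\otimes_{K_0}F$ for $i$ odd. (b) $V$ non-simple: one identifies $K_0=K_1=K$ and $V=K^2$ with usual left action and right action $v\cdot a=v\,\phi(a)$ (row vectors), with $\phi(a)=\begin{pmatrix}\sigma(a)&0\\0&\tau(a)\end{pmatrix}$, $\sigma,\tau\in\operatorname{Aut}K$, or $\phi(a)=\begin{pmatrix}\sigma(a)&\eta(a)\\0&\sigma(a)\end{pmatrix}$, $\sigma\in\operatorname{Aut}K$, $\eta$ a $(\sigma,\sigma)$-derivation. Put $x_0=(1,0)$, $y_0=(0,1)$ and let $\{x_{i+1},y_{i+1}\}\subset V^{(i+1)*}$ be the basis dual to $\{x_i,y_i\}\subset V^{i*}$ for all $i\in\mathbb{Z}$. Then $g_i\in A_{i,i+1}$ is $y_i$ for $i$ even and $x_i$ for $i$ odd. *)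

theory Defs
  imports
    "HOL-Algebra.Algebra"
    "HOL-Algebra.Free_Abelian_Groups"
    "HOL-Algebra.Weak_Morphisms"
    "Jordan_Normal_Form.Missing_VectorSpace"
begin

section \<open>Bimodules over fields\<close>

record ('a, 'v) bimod = "('a, 'v) module" +
  rsmult :: "'v \<Rightarrow> 'a \<Rightarrow> 'v"

text \<open>The rings acting on a bimodule are commutative, so that a right module is a module for the
  swapped action. Both rings have elements of the same type \<open>'a\<close>, which allows a
  family \<open>K\<^sub>i\<close> with \<open>K\<^sub>0\<close> and \<open>K\<^sub>1\<close> unrelated; their operations live in the ring records.\<close>

definition right_module :: "('a, 'v) bimod \<Rightarrow> ('a, 'v) bimod" where
  "right_module M = M\<lparr>smult := (\<lambda>a v. rsmult M v a)\<rparr>"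

definition bimodule :: "'a ring \<Rightarrow> 'a ring \<Rightarrow> ('a, 'v) bimod \<Rightarrow> bool" where
  "bimodule K L M \<longleftrightarrow> module K M \<and> module L (right_module M) \<and>
     (\<forall>a\<in>carrier K. \<forall>b\<in>carrier L. \<forall>v\<in>carrier M.
        rsmult M (a \<odot>\<^bsub>M\<^esub> v) b = a \<odot>\<^bsub>M\<^esub> rsmult M v b)"

definition rank_two_bimodule :: "'a ring \<Rightarrow> 'a ring \<Rightarrow> ('a, 'v) bimod \<Rightarrow> bool" where
  "rank_two_bimodule K L M \<longleftrightarrow> field K \<and> field L \<and> bimodule K L M \<and>
     vectorspace.fin_dim K M \<and> vectorspace.dim K M = 2 \<and>
     vectorspace.fin_dim L (right_module M) \<and> vectorspace.dim L (right_module M) = 2"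

definition simple_bimodule :: "'a ring \<Rightarrow> 'a ring \<Rightarrow> ('a, 'v) bimod \<Rightarrow> bool" where
  "simple_bimodule K L M \<longleftrightarrow> bimodule K L M \<and> carrier M \<noteq> {\<zero>\<^bsub>M\<^esub>} \<and>
     (\<forall>N. Module.submodule N K M \<and> Module.submodule N L (right_module M) \<longrightarrow> N = {\<zero>\<^bsub>M\<^esub>} \<or> N = carrier M)"

definition bimod_iso ::
    "'a ring \<Rightarrow> 'a ring \<Rightarrow> ('a, 'v) bimod \<Rightarrow> ('a, 'w) bimod \<Rightarrow> ('v \<Rightarrow> 'w) set" where
  "bimod_iso K L M N = {f. bij_betw f (carrier M) (carrier N) \<and>
     (\<forall>u\<in>carrier M. \<forall>v\<in>carrier M. f (u \<oplus>\<^bsub>M\<^esub> v) = f u \<oplus>\<^bsub>N\<^esub> f v) \<and>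
     (\<forall>a\<in>carrier K. \<forall>v\<in>carrier M. f (a \<odot>\<^bsub>M\<^esub> v) = a \<odot>\<^bsub>N\<^esub> f v) \<and>
     (\<forall>b\<in>carrier L. \<forall>v\<in>carrier M. f (rsmult M v b) = rsmult N (f v) b)}"


section \<open>Duals\<close>

text \<open>For a \<open>K\<close>-\<open>L\<close>-bimodule \<open>W\<close>, the right dual \<open>Hom\<^sub>L(W, L)\<close> and the left dual
  \<open>Hom\<^sub>K(W, K)\<close>, both \<open>L\<close>-\<open>K\<close>-bimodules. Functionals are extensional on \<open>carrier W\<close>.
  The fields \<open>mult\<close> and \<open>one\<close> that the module record inherits from rings carry no meaning.\<close>

definition right_dual :: "'a ring \<Rightarrow> 'a ring \<Rightarrow> ('a, 'v) bimod \<Rightarrow> ('a, 'v \<Rightarrow> 'a) bimod" where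
  "right_dual K L W =
    \<lparr>carrier = {\<psi> \<in> carrier W \<rightarrow>\<^sub>E carrier L.
        (\<forall>u\<in>carrier W. \<forall>v\<in>carrier W. \<psi> (u \<oplus>\<^bsub>W\<^esub> v) = \<psi> u \<oplus>\<^bsub>L\<^esub> \<psi> v) \<and>
        (\<forall>v\<in>carrier W. \<forall>a\<in>carrier L. \<psi> (rsmult W v a) = \<psi> v \<otimes>\<^bsub>L\<^esub> a)},
     monoid.mult = undefined, one = undefined,
     ring.zero = (\<lambda>v\<in>carrier W. \<zero>\<^bsub>L\<^esub>),
     ring.add = (\<lambda>\<psi> \<chi>. \<lambda>v\<in>carrier W. \<psi> v \<oplus>\<^bsub>L\<^esub> \<chi> v),
     smult = (\<lambda>a \<psi>. \<lambda>v\<in>carrier W. a \<otimes>\<^bsub>L\<^esub> \<psi> v),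
     rsmult = (\<lambda>\<psi> b. \<lambda>v\<in>carrier W. \<psi> (b \<odot>\<^bsub>W\<^esub> v))\<rparr>"

definition left_dual :: "'a ring \<Rightarrow> 'a ring \<Rightarrow> ('a, 'v) bimod \<Rightarrow> ('a, 'v \<Rightarrow> 'a) bimod" where
  "left_dual K L W =
    \<lparr>carrier = {\<phi> \<in> carrier W \<rightarrow>\<^sub>E carrier K.
        (\<forall>u\<in>carrier W. \<forall>v\<in>carrier W. \<phi> (u \<oplus>\<^bsub>W\<^esub> v) = \<phi> u \<oplus>\<^bsub>K\<^esub> \<phi> v) \<and>
        (\<forall>v\<in>carrier W. \<forall>a\<in>carrier K. \<phi> (a \<odot>\<^bsub>W\<^esub> v) = a \<otimes>\<^bsub>K\<^esub> \<phi> v)},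
     monoid.mult = undefined, one = undefined,
     ring.zero = (\<lambda>v\<in>carrier W. \<zero>\<^bsub>K\<^esub>),
     ring.add = (\<lambda>\<phi> \<chi>. \<lambda>v\<in>carrier W. \<phi> v \<oplus>\<^bsub>K\<^esub> \<chi> v),
     smult = (\<lambda>a \<phi>. \<lambda>v\<in>carrier W. \<phi> (rsmult W v a)),
     rsmult = (\<lambda>\<phi> b. \<lambda>v\<in>carrier W. b \<otimes>\<^bsub>K\<^esub> \<phi> v)\<rparr>"

definition alt :: "'b \<Rightarrow> 'b \<Rightarrow> int \<Rightarrow> 'b" where
  "alt x\<^sub>0 x\<^sub>1 i = (if even i then x\<^sub>0 else x\<^sub>1)"

text \<open>Each passage to a dual changes the HOL type of the elements, so the sequence of iterated duals
  cannot be a function into one type literally. \<open>W i\<close> is therefore a copy of \<open>V\<^sup>i\<^sup>*\<close> on the type of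
  \<open>V\<close>, together with the pairings \<open>ev i v \<psi> = \<psi>(v)\<close> for \<open>v\<close> in \<open>V\<^sup>i\<^sup>*\<close>
  and \<open>\<psi>\<close> in \<open>V\<^sup>(\<^sup>i\<^sup>+\<^sup>1\<^sup>)\<^sup>*\<close>. For \<open>i \<ge> 0\<close> the pairing exhibits \<open>W (i+1)\<close> as the right dual of
  \<open>W i\<close>; for \<open>i < 0\<close> it exhibits \<open>W i\<close> as the left dual of \<open>W (i+1)\<close>. This determines
  \<open>(W, ev)\<close> up to unique isomorphism. Such a copy always exists when \<open>V\<close> has rank two, because
  then all iterated duals have the cardinality of \<open>V\<close>.\<close>

definition iterated_duals ::
    "'a ring \<Rightarrow> 'a ring \<Rightarrow> ('a, 'v) bimod \<Rightarrow> (int \<Rightarrow> ('a, 'v) bimod) \<Rightarrow>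
     (int \<Rightarrow> 'v \<Rightarrow> 'v \<Rightarrow> 'a) \<Rightarrow> bool" where
  "iterated_duals K\<^sub>0 K\<^sub>1 V W ev \<longleftrightarrow>
    (let K = alt K\<^sub>0 K\<^sub>1 in
     W 0 = V \<and>
     (\<forall>i. bimodule (K i) (K (i + 1)) (W i)) \<and>
     (\<forall>i\<ge>0. (\<lambda>\<psi>. \<lambda>v\<in>carrier (W i). ev i v \<psi>) \<in>
        bimod_iso (K (i + 1)) (K i) (W (i + 1)) (right_dual (K i) (K (i + 1)) (W i))) \<and>
     (\<forall>i<0. (\<lambda>v. \<lambda>\<psi>\<in>carrier (W (i + 1)). ev i v \<psi>) \<in>
        bimod_iso (K i) (K (i + 1)) (W i) (left_dual (K (i + 1)) (K i) (W (i + 1)))))"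


section \<open>Indexed algebras\<close>

text \<open>The abelian groups \<open>D\<^sub>i\<^sub>j\<close> are written multiplicatively, as in HOL-Algebra's
  theory of groups; \<open>mul i j l\<close> is the multiplication from \<open>D\<^sub>i\<^sub>j\<close> and \<open>D\<^sub>j\<^sub>l\<close> to \<open>D\<^sub>i\<^sub>l\<close>.\<close>

record 'd indexed_alg =
  piece :: "int \<Rightarrow> int \<Rightarrow> 'd monoid"
  mul :: "int \<Rightarrow> int \<Rightarrow> int \<Rightarrow> 'd \<Rightarrow> 'd \<Rightarrow> 'd"
  unity :: "int \<Rightarrow> 'd"

definition normal_family :: "'d indexed_alg \<Rightarrow> int \<Rightarrow> (int \<Rightarrow> 'd) \<Rightarrow> bool" where
  "normal_family D \<delta> g \<longleftrightarrow>
     (\<forall>i. g i \<in> carrier (piece D i (i + \<delta>))) \<and>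
     (\<forall>i j. (\<lambda>d. mul D i (i + \<delta>) (j + \<delta>) (g i) d) ` carrier (piece D (i + \<delta>) (j + \<delta>)) =
            (\<lambda>d. mul D i j (j + \<delta>) d (g j)) ` carrier (piece D i j))"

definition indexed_ideal :: "'d indexed_alg \<Rightarrow> (int \<Rightarrow> int \<Rightarrow> 'd set) \<Rightarrow> bool" where
  "indexed_ideal D I \<longleftrightarrow>
     (\<forall>i j. subgroup (I i j) (piece D i j)) \<and>
     (\<forall>i j l. \<forall>a\<in>carrier (piece D i j). \<forall>x\<in>I j l. mul D i j l a x \<in> I i l) \<and>
     (\<forall>i j l. \<forall>x\<in>I i j. \<forall>a\<in>carrier (piece D j l). mul D i j l x a \<in> I i l)"

definition generated_ideal ::
    "'d indexed_alg \<Rightarrow> (int \<Rightarrow> int \<Rightarrow> 'd set) \<Rightarrow> int \<Rightarrow> int \<Rightarrow> 'd set" where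
  "generated_ideal D S i j = \<Inter> {I i j | I. indexed_ideal D I \<and> (\<forall>k l. S k l \<subseteq> I k l)}"

definition quotient_alg ::
    "'d indexed_alg \<Rightarrow> (int \<Rightarrow> int \<Rightarrow> 'd set) \<Rightarrow> 'd set indexed_alg" where
  "quotient_alg D I =
    \<lparr>piece = (\<lambda>i j. piece D i j Mod I i j),
     mul = (\<lambda>i j l P P'. \<Union>x\<in>P. \<Union>y\<in>P'. I i l #>\<^bsub>piece D i l\<^esub> mul D i j l x y),
     unity = (\<lambda>i. I i i #>\<^bsub>piece D i i\<^esub> unity D i)\<rparr>"


section \<open>The tensor algebra\<close>

text \<open>For \<open>i < j\<close> the multiple tensor product of \<open>W i, \<dots>, W (j - 1)\<close> over
  \<open>K (i + 1), \<dots>, K (j - 1)\<close> is the free abelian group on words \<open>[v\<^sub>i, \<dots>, v\<^sub>j\<^sub>-\<^sub>1]\<close> modulo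
  additivity in each place and the balancing relations. There are no words if \<open>i > j\<close>.\<close>

definition tensor_words :: "(int \<Rightarrow> ('a, 'v) bimod) \<Rightarrow> int \<Rightarrow> int \<Rightarrow> 'v list set" where
  "tensor_words W i j = {ws. j = i + int (length ws) \<and>
     (\<forall>k<length ws. ws ! k \<in> carrier (W (i + int k)))}"

definition tensor_relators ::
    "(int \<Rightarrow> 'a ring) \<Rightarrow> (int \<Rightarrow> ('a, 'v) bimod) \<Rightarrow> int \<Rightarrow> int \<Rightarrow> ('v list \<Rightarrow>\<^sub>0 int) set" where
  "tensor_relators K W i j =
     {frag_of (us @ [v \<oplus>\<^bsub>W (i + int (length us))\<^esub> v'] @ ws)
        - frag_of (us @ [v] @ ws) - frag_of (us @ [v'] @ ws) | us v v' ws.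
        us @ [v] @ ws \<in> tensor_words W i j \<and> us @ [v'] @ ws \<in> tensor_words W i j} \<union>
     {frag_of (us @ [rsmult (W (i + int (length us))) v a, v'] @ ws)
        - frag_of (us @ [v, a \<odot>\<^bsub>W (i + int (length us) + 1)\<^esub> v'] @ ws) | us v a v' ws.
        us @ [v, v'] @ ws \<in> tensor_words W i j \<and> a \<in> carrier (K (i + int (length us) + 1))}"

definition tensor_null ::
    "(int \<Rightarrow> 'a ring) \<Rightarrow> (int \<Rightarrow> ('a, 'v) bimod) \<Rightarrow> int \<Rightarrow> int \<Rightarrow> ('v list \<Rightarrow>\<^sub>0 int) set" where
  "tensor_null K W i j =
     generate (free_Abelian_group (tensor_words W i j)) (tensor_relators K W i j)"

definition tensor_class ::
    "(int \<Rightarrow> 'a ring) \<Rightarrow> (int \<Rightarrow> ('a, 'v) bimod) \<Rightarrow> int \<Rightarrow> int \<Rightarrow>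
     ('v list \<Rightarrow>\<^sub>0 int) \<Rightarrow> ('v list \<Rightarrow>\<^sub>0 int) set" where
  "tensor_class K W i j c =
     tensor_null K W i j #>\<^bsub>free_Abelian_group (tensor_words W i j)\<^esub> c"

text \<open>Components of \<open>T\<close>: \<open>Inl a\<close> is a scalar in \<open>T\<^sub>i\<^sub>i = K\<^sub>i\<close>, and \<open>Inr P\<close> an element of
  the multiple tensor product (\<open>i < j\<close>) or of the zero group (\<open>i > j\<close>).\<close>

type_synonym ('a, 'v) tens = "'a + ('v list \<Rightarrow>\<^sub>0 int) set"

definition tensor_piece ::
    "(int \<Rightarrow> 'a ring) \<Rightarrow> (int \<Rightarrow> ('a, 'v) bimod) \<Rightarrow> int \<Rightarrow> int \<Rightarrow> ('a, 'v) tens monoid" where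
  "tensor_piece K W i j =
     (if i = j then image_group Inl (add_monoid (K i))
      else image_group Inr (free_Abelian_group (tensor_words W i j) Mod tensor_null K W i j))"

definition tensor_prod ::
    "(int \<Rightarrow> 'a ring) \<Rightarrow> (int \<Rightarrow> ('a, 'v) bimod) \<Rightarrow> int \<Rightarrow> int \<Rightarrow> int \<Rightarrow>
     ('a, 'v) tens \<Rightarrow> ('a, 'v) tens \<Rightarrow> ('a, 'v) tens" where
  "tensor_prod K W i j l s t =
     (if i \<le> j \<and> j \<le> l then
       (case (s, t) of
         (Inl a, Inl b) \<Rightarrow> Inl (a \<otimes>\<^bsub>K i\<^esub> b)
       | (Inl a, Inr P') \<Rightarrow> Inr (\<Union>y\<in>P'. tensor_class K W i l
           (frag_extend (\<lambda>ws. frag_of ((a \<odot>\<^bsub>W i\<^esub> hd ws) # tl ws)) y))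
       | (Inr P, Inl b) \<Rightarrow> Inr (\<Union>x\<in>P. tensor_class K W i l
           (frag_extend (\<lambda>us. frag_of (butlast us @ [rsmult (W (l - 1)) (last us) b])) x))
       | (Inr P, Inr P') \<Rightarrow> Inr (\<Union>x\<in>P. \<Union>y\<in>P'. tensor_class K W i l
           (frag_extend (\<lambda>us. frag_extend (\<lambda>ws. frag_of (us @ ws)) y) x)))
      else \<one>\<^bsub>tensor_piece K W i l\<^esub>)"

definition tensor_alg ::
    "(int \<Rightarrow> 'a ring) \<Rightarrow> (int \<Rightarrow> ('a, 'v) bimod) \<Rightarrow> ('a, 'v) tens indexed_alg" where
  "tensor_alg K W =
    \<lparr>piece = tensor_piece K W, mul = tensor_prod K W, unity = (\<lambda>i. Inl \<one>\<^bsub>K i\<^esub>)\<rparr>"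


section \<open>The non-commutative symmetric algebra\<close>

text \<open>The canonical map from \<open>V\<^sup>i\<^sup>* \<otimes> V\<^sup>(\<^sup>i\<^sup>+\<^sup>1\<^sup>)\<^sup>*\<close> to the endomorphisms of \<open>V\<^sup>i\<^sup>*\<close>
  sends \<open>v \<otimes> \<psi>\<close> to \<open>u \<mapsto> v \<psi>(u)\<close>; here on a formal sum \<open>c\<close> of words \<open>[v, \<psi>]\<close>.\<close>

definition tensor_endo ::
    "(int \<Rightarrow> ('a, 'v) bimod) \<Rightarrow> (int \<Rightarrow> 'v \<Rightarrow> 'v \<Rightarrow> 'a) \<Rightarrow> int \<Rightarrow>
     ('v list \<Rightarrow>\<^sub>0 int) \<Rightarrow> 'v \<Rightarrow> 'v" where
  "tensor_endo W ev i c u =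
     (\<Oplus>\<^bsub>W i\<^esub>ws\<in>Poly_Mapping.keys c.
        add_pow (W i) (Poly_Mapping.lookup c ws) (rsmult (W i) (ws ! 0) (ev i u (ws ! 1))))"

text \<open>\<open>Q\<^sub>i\<close> consists of the tensors whose endomorphism is left multiplication by some \<open>a \<in> K\<^sub>i\<close>.\<close>

definition euler_tensors ::
    "(int \<Rightarrow> 'a ring) \<Rightarrow> (int \<Rightarrow> ('a, 'v) bimod) \<Rightarrow> (int \<Rightarrow> 'v \<Rightarrow> 'v \<Rightarrow> 'a) \<Rightarrow>
     int \<Rightarrow> ('a, 'v) tens set" where
  "euler_tensors K W ev i =
     {Inr (tensor_class K W i (i + 2) c) | c.
        c \<in> carrier (free_Abelian_group (tensor_words W i (i + 2))) \<and>
        (\<exists>a\<in>carrier (K i). \<forall>u\<in>carrier (W i). tensor_endo W ev i c u = a \<odot>\<^bsub>W i\<^esub> u)}"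

definition sym_relations ::
    "(int \<Rightarrow> 'a ring) \<Rightarrow> (int \<Rightarrow> ('a, 'v) bimod) \<Rightarrow> (int \<Rightarrow> 'v \<Rightarrow> 'v \<Rightarrow> 'a) \<Rightarrow>
     int \<Rightarrow> int \<Rightarrow> ('a, 'v) tens set" where
  "sym_relations K W ev = generated_ideal (tensor_alg K W)
     (\<lambda>i j. if j = i + 2 then euler_tensors K W ev i else {})"

definition nc_sym_alg ::
    "(int \<Rightarrow> 'a ring) \<Rightarrow> (int \<Rightarrow> ('a, 'v) bimod) \<Rightarrow> (int \<Rightarrow> 'v \<Rightarrow> 'v \<Rightarrow> 'a) \<Rightarrow>
     ('a, 'v) tens set indexed_alg" where
  "nc_sym_alg K W ev = quotient_alg (tensor_alg K W) (sym_relations K W ev)"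

text \<open>The image in the quotient of the tensor represented by a formal sum of words of length
  \<open>j - i > 0\<close>.\<close>

definition sym_class ::
    "(int \<Rightarrow> 'a ring) \<Rightarrow> (int \<Rightarrow> ('a, 'v) bimod) \<Rightarrow> (int \<Rightarrow> 'v \<Rightarrow> 'v \<Rightarrow> 'a) \<Rightarrow>
     int \<Rightarrow> int \<Rightarrow> ('v list \<Rightarrow>\<^sub>0 int) \<Rightarrow> ('a, 'v) tens set" where
  "sym_class K W ev i j c =
     sym_relations K W ev i j #>\<^bsub>tensor_piece K W i j\<^esub> Inr (tensor_class K W i j c)"


section \<open>The family for a simple bimodule\<close>

text \<open>The field \<open>F\<close> with left action through \<open>\<iota>\<close> and right action through \<open>\<kappa>\<close>.\<close>

definition field_bimod :: "'f ring \<Rightarrow> ('a \<Rightarrow> 'f) \<Rightarrow> ('a \<Rightarrow> 'f) \<Rightarrow> ('a, 'f) bimod" where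
  "field_bimod F \<iota> \<kappa> =
    \<lparr>carrier = carrier F, monoid.mult = monoid.mult F, one = \<one>\<^bsub>F\<^esub>,
     ring.zero = \<zero>\<^bsub>F\<^esub>, ring.add = ring.add F,
     smult = (\<lambda>a x. \<iota> a \<otimes>\<^bsub>F\<^esub> x), rsmult = (\<lambda>x b. x \<otimes>\<^bsub>F\<^esub> \<kappa> b)\<rparr>"

definition galois_group :: "'f ring \<Rightarrow> 'f set \<Rightarrow> ('f \<Rightarrow> 'f) set" where
  "galois_group F k = {\<sigma> \<in> ring_iso F F \<inter> extensional (carrier F). \<forall>x\<in>k. \<sigma> x = x}"

text \<open>An embedding \<open>\<iota> : K \<rightarrow> F\<close> of degree two, with \<open>\<sigma>\<close> the generator of the Galois group,
  which has order two as the characteristic is not two.\<close>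

definition quadratic_embedding :: "'a ring \<Rightarrow> 'f ring \<Rightarrow> ('a \<Rightarrow> 'f) \<Rightarrow> ('f \<Rightarrow> 'f) \<Rightarrow> bool" where
  "quadratic_embedding K F \<iota> \<sigma> \<longleftrightarrow> \<iota> \<in> ring_hom K F \<and>
     ring.dimension F 2 (\<iota> ` carrier K) (carrier F) \<and>
     \<sigma> \<noteq> restrict id (carrier F) \<and>
     galois_group F (\<iota> ` carrier K) = {restrict id (carrier F), \<sigma>}"

definition half_trace :: "'a ring \<Rightarrow> 'f ring \<Rightarrow> ('a \<Rightarrow> 'f) \<Rightarrow> ('f \<Rightarrow> 'f) \<Rightarrow> 'f \<Rightarrow> 'a" where
  "half_trace K F \<iota> \<sigma> x =
     inv_into (carrier K) \<iota> (inv\<^bsub>F\<^esub> (\<one>\<^bsub>F\<^esub> \<oplus>\<^bsub>F\<^esub> \<one>\<^bsub>F\<^esub>) \<otimes>\<^bsub>F\<^esub> (x \<oplus>\<^bsub>F\<^esub> \<sigma> x))"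

text \<open>\<open>f i\<close> identifies \<open>V\<^sup>i\<^sup>*\<close> with \<open>F\<close> (acted on through \<open>\<iota>\<^sub>i\<close> and \<open>\<iota>\<^sub>i\<^sub>+\<^sub>1\<close>) in such
  a way that the pairings become \<open>(b, a) \<mapsto> tr\<^sub>i\<^sub>+\<^sub>1(ba)\<close>. Given \<open>f 0\<close>, the other \<open>f i\<close> exist and
  are uniquely determined by this.\<close>

definition simple_presentation ::
    "'a ring \<Rightarrow> 'a ring \<Rightarrow> (int \<Rightarrow> ('a, 'v) bimod) \<Rightarrow> (int \<Rightarrow> 'v \<Rightarrow> 'v \<Rightarrow> 'a) \<Rightarrow>
     'f ring \<Rightarrow> ('a \<Rightarrow> 'f) \<Rightarrow> ('a \<Rightarrow> 'f) \<Rightarrow> ('f \<Rightarrow> 'f) \<Rightarrow> ('f \<Rightarrow> 'f) \<Rightarrow>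
     (int \<Rightarrow> 'v \<Rightarrow> 'f) \<Rightarrow> bool" where
  "simple_presentation K\<^sub>0 K\<^sub>1 W ev F \<iota>\<^sub>0 \<iota>\<^sub>1 \<sigma>\<^sub>0 \<sigma>\<^sub>1 f \<longleftrightarrow>
    (let K = alt K\<^sub>0 K\<^sub>1; \<iota> = alt \<iota>\<^sub>0 \<iota>\<^sub>1; \<sigma> = alt \<sigma>\<^sub>0 \<sigma>\<^sub>1 in
     field F \<and> quadratic_embedding K\<^sub>0 F \<iota>\<^sub>0 \<sigma>\<^sub>0 \<and> quadratic_embedding K\<^sub>1 F \<iota>\<^sub>1 \<sigma>\<^sub>1 \<and>
     (\<forall>i. f i \<in> bimod_iso (K i) (K (i + 1)) (W i) (field_bimod F (\<iota> i) (\<iota> (i + 1)))) \<and>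
     (\<forall>i. \<forall>v\<in>carrier (W i). \<forall>\<psi>\<in>carrier (W (i + 1)).
        ev i v \<psi> = half_trace (K (i + 1)) F (\<iota> (i + 1)) (\<sigma> (i + 1)) (f i v \<otimes>\<^bsub>F\<^esub> f (i + 1) \<psi>)))"

definition admissible_root ::
    "'a ring \<Rightarrow> 'a ring \<Rightarrow> 'f ring \<Rightarrow> ('a \<Rightarrow> 'f) \<Rightarrow> ('a \<Rightarrow> 'f) \<Rightarrow> int \<Rightarrow> 'f \<Rightarrow> bool" where
  "admissible_root K\<^sub>0 K\<^sub>1 F \<iota>\<^sub>0 \<iota>\<^sub>1 j w \<longleftrightarrow> w \<in> carrier F \<and>
     w \<otimes>\<^bsub>F\<^esub> w \<in> alt \<iota>\<^sub>0 \<iota>\<^sub>1 j ` carrier (alt K\<^sub>0 K\<^sub>1 j) \<and>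
     w \<notin> \<iota>\<^sub>0 ` carrier K\<^sub>0 \<union> \<iota>\<^sub>1 ` carrier K\<^sub>1"

definition simple_family ::
    "'a ring \<Rightarrow> 'a ring \<Rightarrow> (int \<Rightarrow> ('a, 'v) bimod) \<Rightarrow> (int \<Rightarrow> 'v \<Rightarrow> 'v \<Rightarrow> 'a) \<Rightarrow>
     'f ring \<Rightarrow> (int \<Rightarrow> 'v \<Rightarrow> 'f) \<Rightarrow> 'f \<Rightarrow> 'f \<Rightarrow> int \<Rightarrow> ('a, 'v) tens set" where
  "simple_family K\<^sub>0 K\<^sub>1 W ev F f w\<^sub>0 w\<^sub>1 i =
    (let w = alt w\<^sub>1 w\<^sub>0 i;
         p = inv_into (carrier (W i)) (f i);
         q = inv_into (carrier (W (i + 1))) (f (i + 1))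
     in sym_class (alt K\<^sub>0 K\<^sub>1) W ev i (i + 2)
          (frag_of [p w, q \<one>\<^bsub>F\<^esub>] + frag_of [p \<one>\<^bsub>F\<^esub>, q w]))"


section \<open>The family for a non-simple bimodule\<close>

text \<open>The matrix with rows \<open>(p, q)\<close> and \<open>(r, s)\<close> is written \<open>(p, q, r, s)\<close>; it
  acts on row vectors from the right.\<close>

definition row_times_matrix :: "'k ring \<Rightarrow> 'k \<times> 'k \<Rightarrow> 'k \<times> 'k \<times> 'k \<times> 'k \<Rightarrow> 'k \<times> 'k" where
  "row_times_matrix K = (\<lambda>(u, v) (p, q, r, s).
     (u \<otimes>\<^bsub>K\<^esub> p \<oplus>\<^bsub>K\<^esub> v \<otimes>\<^bsub>K\<^esub> r, u \<otimes>\<^bsub>K\<^esub> q \<oplus>\<^bsub>K\<^esub> v \<otimes>\<^bsub>K\<^esub> s))"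

text \<open>\<open>K\<^sup>2\<close> with the usual left action and the right action through \<open>\<phi>\<close>, where the two fields
  act after the identifications \<open>\<theta>\<^sub>0\<close> and \<open>\<theta>\<^sub>1\<close> with \<open>K\<close>.\<close>

definition matrix_bimod ::
    "'k ring \<Rightarrow> ('a \<Rightarrow> 'k) \<Rightarrow> ('a \<Rightarrow> 'k) \<Rightarrow> ('k \<Rightarrow> 'k \<times> 'k \<times> 'k \<times> 'k) \<Rightarrow> ('a, 'k \<times> 'k) bimod" where
  "matrix_bimod K \<theta>\<^sub>0 \<theta>\<^sub>1 \<phi> =
    \<lparr>carrier = carrier K \<times> carrier K, monoid.mult = undefined, one = undefined,
     ring.zero = (\<zero>\<^bsub>K\<^esub>, \<zero>\<^bsub>K\<^esub>),
     ring.add = (\<lambda>(u, v) (u', v'). (u \<oplus>\<^bsub>K\<^esub> u', v \<oplus>\<^bsub>K\<^esub> v')),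
     smult = (\<lambda>a (u, v). (\<theta>\<^sub>0 a \<otimes>\<^bsub>K\<^esub> u, \<theta>\<^sub>0 a \<otimes>\<^bsub>K\<^esub> v)),
     rsmult = (\<lambda>x b. row_times_matrix K x (\<phi> (\<theta>\<^sub>1 b)))\<rparr>"

definition twisted_derivation :: "'k ring \<Rightarrow> ('k \<Rightarrow> 'k) \<Rightarrow> ('k \<Rightarrow> 'k) \<Rightarrow> bool" where
  "twisted_derivation K \<sigma> \<eta> \<longleftrightarrow> \<eta> \<in> carrier K \<rightarrow> carrier K \<and>
     (\<forall>a\<in>carrier K. \<forall>b\<in>carrier K. \<eta> (a \<oplus>\<^bsub>K\<^esub> b) = \<eta> a \<oplus>\<^bsub>K\<^esub> \<eta> b \<and>
        \<eta> (a \<otimes>\<^bsub>K\<^esub> b) = \<sigma> a \<otimes>\<^bsub>K\<^esub> \<eta> b \<oplus>\<^bsub>K\<^esub> \<eta> a \<otimes>\<^bsub>K\<^esub> \<sigma> b)"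

definition nonsimple_form :: "'k ring \<Rightarrow> ('k \<Rightarrow> 'k \<times> 'k \<times> 'k \<times> 'k) \<Rightarrow> bool" where
  "nonsimple_form K \<phi> \<longleftrightarrow>
     (\<exists>\<sigma>\<in>ring_iso K K. \<exists>\<tau>\<in>ring_iso K K.
        \<forall>a\<in>carrier K. \<phi> a = (\<sigma> a, \<zero>\<^bsub>K\<^esub>, \<zero>\<^bsub>K\<^esub>, \<tau> a)) \<or>
     (\<exists>\<sigma>\<in>ring_iso K K. \<exists>\<eta>. twisted_derivation K \<sigma> \<eta> \<and>
        (\<forall>a\<in>carrier K. \<phi> a = (\<sigma> a, \<eta> a, \<zero>\<^bsub>K\<^esub>, \<sigma> a)))"

definition is_right_basis :: "'a ring \<Rightarrow> ('a, 'v) bimod \<Rightarrow> 'v \<Rightarrow> 'v \<Rightarrow> bool" where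
  "is_right_basis L M x y \<longleftrightarrow> x \<noteq> y \<and> vectorspace.basis L (right_module M) {x, y}"

definition nonsimple_presentation ::
    "'a ring \<Rightarrow> 'a ring \<Rightarrow> (int \<Rightarrow> ('a, 'v) bimod) \<Rightarrow> (int \<Rightarrow> 'v \<Rightarrow> 'v \<Rightarrow> 'a) \<Rightarrow>
     'k ring \<Rightarrow> ('a \<Rightarrow> 'k) \<Rightarrow> ('a \<Rightarrow> 'k) \<Rightarrow> ('k \<Rightarrow> 'k \<times> 'k \<times> 'k \<times> 'k) \<Rightarrow>
     ('v \<Rightarrow> 'k \<times> 'k) \<Rightarrow> (int \<Rightarrow> 'v) \<Rightarrow> (int \<Rightarrow> 'v) \<Rightarrow> bool" where
  "nonsimple_presentation K\<^sub>0 K\<^sub>1 W ev K \<theta>\<^sub>0 \<theta>\<^sub>1 \<phi> h x y \<longleftrightarrow>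
     field K \<and> \<theta>\<^sub>0 \<in> ring_iso K\<^sub>0 K \<and> \<theta>\<^sub>1 \<in> ring_iso K\<^sub>1 K \<and> nonsimple_form K \<phi> \<and>
     h \<in> bimod_iso K\<^sub>0 K\<^sub>1 (W 0) (matrix_bimod K \<theta>\<^sub>0 \<theta>\<^sub>1 \<phi>) \<and>
     h (x 0) = (\<one>\<^bsub>K\<^esub>, \<zero>\<^bsub>K\<^esub>) \<and> h (y 0) = (\<zero>\<^bsub>K\<^esub>, \<one>\<^bsub>K\<^esub>) \<and>
     (\<forall>i. is_right_basis (alt K\<^sub>0 K\<^sub>1 (i + 1)) (W i) (x i) (y i)) \<and>
     (\<forall>i. let L = alt K\<^sub>0 K\<^sub>1 (i + 1) in
        ev i (x i) (x (i + 1)) = \<one>\<^bsub>L\<^esub> \<and> ev i (y i) (x (i + 1)) = \<zero>\<^bsub>L\<^esub> \<and>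
        ev i (x i) (y (i + 1)) = \<zero>\<^bsub>L\<^esub> \<and> ev i (y i) (y (i + 1)) = \<one>\<^bsub>L\<^esub>)"

definition nonsimple_family ::
    "'a ring \<Rightarrow> 'a ring \<Rightarrow> (int \<Rightarrow> ('a, 'v) bimod) \<Rightarrow> (int \<Rightarrow> 'v \<Rightarrow> 'v \<Rightarrow> 'a) \<Rightarrow>
     (int \<Rightarrow> 'v) \<Rightarrow> (int \<Rightarrow> 'v) \<Rightarrow> int \<Rightarrow> ('a, 'v) tens set" where
  "nonsimple_family K\<^sub>0 K\<^sub>1 W ev x y i =
     sym_class (alt K\<^sub>0 K\<^sub>1) W ev i (i + 1) (frag_of [if even i then y i else x i])"

end

theory Submission
  imports Defs
begin

text \<open>As \<open>A\<close> is generated by its components of degree \<open>0\<close> and \<open>1\<close>, it suffices to prove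
  \<open>g\<^sub>i K\<^sub>i\<^sub>+\<^sub>\<delta> = K\<^sub>i g\<^sub>i\<close> and \<open>g\<^sub>i V\<^sup>(\<^sup>i\<^sup>+\<^sup>\<delta>\<^sup>)\<^sup>* = V\<^sup>i\<^sup>* g\<^sub>i\<^sub>+\<^sub>1\<close>.

  Simple case. Put \<open>g\<^sub>i = \<alpha> \<otimes> 1 + 1 \<otimes> \<alpha>\<close> and \<open>g\<^sub>i\<^sub>+\<^sub>1 = \<beta> \<otimes> 1 + 1 \<otimes> \<beta>\<close>; the relations are generated by
  \<open>q\<^sub>i = 1 \<otimes> 1 + \<alpha> \<otimes> \<alpha>\<^sup>-\<^sup>1 = \<alpha>\<^sup>-\<^sup>1 g\<^sub>i\<close> and \<open>q\<^sub>i\<^sub>+\<^sub>1 = \<beta>\<^sup>-\<^sup>1 g\<^sub>i\<^sub>+\<^sub>1\<close>, and \<open>g\<^sub>i\<close> commutes with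
  all of \<open>F\<close>. Since \<open>\<beta> \<notin> K\<^sub>i\<close>, one can write \<open>\<alpha> = a + b\<beta>\<close> with \<open>a, b \<in> K\<^sub>i\<close>. With \<open>\<alpha>' = a - b\<beta>\<close> one has
  \<open>\<alpha> \<otimes> 1 - 1 \<otimes> \<alpha>' = b g\<^sub>i\<^sub>+\<^sub>1\<close>, so \<open>g\<^sub>i u - q\<^sub>i \<alpha>' u = (1 \<otimes> 1 + \<alpha> \<otimes> \<alpha>\<^sup>-\<^sup>1) b g\<^sub>i\<^sub>+\<^sub>1 u\<close> lies in
  \<open>F \<otimes> F g\<^sub>i\<^sub>+\<^sub>1\<close>. As \<open>\<beta>\<^sup>-\<^sup>1 \<notin> K\<^sub>i\<^sub>+\<^sub>1\<close>, that space is \<open>F g\<^sub>i\<^sub>+\<^sub>1 + F q\<^sub>i\<^sub>+\<^sub>1\<close>. The other inclusion is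
  the mirror image.

  Non-simple case. The element \<open>g\<^sub>i\<close> spans a sub-bimodule of \<open>V\<^sup>i\<^sup>*\<close>; this passes to both
  duals, since \<open>g\<^sub>i\<^sub>+\<^sub>1\<close> spans the annihilator of \<open>g\<^sub>i\<close>. In degree two the relation
  \<open>x\<^sub>i x\<^sub>i\<^sub>+\<^sub>1 + y\<^sub>i y\<^sub>i\<^sub>+\<^sub>1 = 0\<close> does the rest.\<close>

section \<open>Bimodules and formal sums of words\<close>

lemma right_module_simps [simp]:
  "carrier (right_module M) = carrier M" "ring.add (right_module M) = ring.add M"
  "ring.zero (right_module M) = ring.zero M" "a \<odot>\<^bsub>right_module M\<^esub> v = rsmult M v a"
  by (simp_all add: right_module_def)

context
  fixes K L :: "'a ring" and M :: "('a, 'v) bimod"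
  assumes bim: "bimodule K L M"
begin

lemma bimodule_left: "module K M" and bimodule_right: "module L (right_module M)"
  using bim by (auto simp: bimodule_def)

lemma bimodule_cring: "cring K" "cring L"
  using bimodule_left bimodule_right by (auto simp: module_def)

lemma bimodule_abelian_group: "abelian_group M"
  using bimodule_left by (auto simp: module_def)

lemma bimodule_lsmult:
  shows "a \<in> carrier K \<Longrightarrow> v \<in> carrier M \<Longrightarrow> a \<odot>\<^bsub>M\<^esub> v \<in> carrier M"
    "a \<in> carrier K \<Longrightarrow> u \<in> carrier M \<Longrightarrow> v \<in> carrier M \<Longrightarrow>
      a \<odot>\<^bsub>M\<^esub> (u \<oplus>\<^bsub>M\<^esub> v) = a \<odot>\<^bsub>M\<^esub> u \<oplus>\<^bsub>M\<^esub> a \<odot>\<^bsub>M\<^esub> v"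
    "a \<in> carrier K \<Longrightarrow> b \<in> carrier K \<Longrightarrow> v \<in> carrier M \<Longrightarrow>
      (a \<oplus>\<^bsub>K\<^esub> b) \<odot>\<^bsub>M\<^esub> v = a \<odot>\<^bsub>M\<^esub> v \<oplus>\<^bsub>M\<^esub> b \<odot>\<^bsub>M\<^esub> v"
    "a \<in> carrier K \<Longrightarrow> b \<in> carrier K \<Longrightarrow> v \<in> carrier M \<Longrightarrow>
      (a \<otimes>\<^bsub>K\<^esub> b) \<odot>\<^bsub>M\<^esub> v = a \<odot>\<^bsub>M\<^esub> (b \<odot>\<^bsub>M\<^esub> v)"
    "v \<in> carrier M \<Longrightarrow> \<one>\<^bsub>K\<^esub> \<odot>\<^bsub>M\<^esub> v = v"
  using module.smult_closed[OF bimodule_left] module.smult_r_distr[OF bimodule_left]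
    module.smult_l_distr[OF bimodule_left] module.smult_assoc1[OF bimodule_left]
    module.smult_one[OF bimodule_left] by auto

lemma bimodule_rsmult:
  shows "a \<in> carrier L \<Longrightarrow> v \<in> carrier M \<Longrightarrow> rsmult M v a \<in> carrier M"
    "a \<in> carrier L \<Longrightarrow> u \<in> carrier M \<Longrightarrow> v \<in> carrier M \<Longrightarrow>
      rsmult M (u \<oplus>\<^bsub>M\<^esub> v) a = rsmult M u a \<oplus>\<^bsub>M\<^esub> rsmult M v a"
    "a \<in> carrier L \<Longrightarrow> b \<in> carrier L \<Longrightarrow> v \<in> carrier M \<Longrightarrow>
      rsmult M v (a \<oplus>\<^bsub>L\<^esub> b) = rsmult M v a \<oplus>\<^bsub>M\<^esub> rsmult M v b"
    "a \<in> carrier L \<Longrightarrow> b \<in> carrier L \<Longrightarrow> v \<in> carrier M \<Longrightarrow>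
      rsmult M v (a \<otimes>\<^bsub>L\<^esub> b) = rsmult M (rsmult M v b) a"
    "v \<in> carrier M \<Longrightarrow> rsmult M v \<one>\<^bsub>L\<^esub> = v"
  using module.smult_closed[OF bimodule_right] module.smult_r_distr[OF bimodule_right]
    module.smult_l_distr[OF bimodule_right] module.smult_assoc1[OF bimodule_right]
    module.smult_one[OF bimodule_right] by auto

lemma bimodule_compat:
  assumes "a \<in> carrier K" "b \<in> carrier L" "v \<in> carrier M"
  shows "rsmult M (a \<odot>\<^bsub>M\<^esub> v) b = a \<odot>\<^bsub>M\<^esub> rsmult M v b"
  using bim assms by (auto simp: bimodule_def)

end

text \<open>Concatenation extended biadditively to formal sums. This is the expression by which
  \<open>tensor_prod\<close> multiplies two representatives; \<open>frag_lsmult\<close> and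
  \<open>frag_rsmult\<close> are its expressions for a scalar factor.\<close>

definition frag_append :: "('v list \<Rightarrow>\<^sub>0 int) \<Rightarrow> ('v list \<Rightarrow>\<^sub>0 int) \<Rightarrow> 'v list \<Rightarrow>\<^sub>0 int"
    (infixr \<open>\<frown>\<close> 70) where
  "x \<frown> y = frag_extend (\<lambda>us. frag_extend (\<lambda>ws. frag_of (us @ ws)) y) x"

definition frag_lsmult :: "('a, 'v) bimod \<Rightarrow> 'a \<Rightarrow> ('v list \<Rightarrow>\<^sub>0 int) \<Rightarrow> 'v list \<Rightarrow>\<^sub>0 int" where
  "frag_lsmult M a = frag_extend (\<lambda>ws. frag_of ((a \<odot>\<^bsub>M\<^esub> hd ws) # tl ws))"

definition frag_rsmult :: "('a, 'v) bimod \<Rightarrow> 'a \<Rightarrow> ('v list \<Rightarrow>\<^sub>0 int) \<Rightarrow> 'v list \<Rightarrow>\<^sub>0 int" where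
  "frag_rsmult M b = frag_extend (\<lambda>us. frag_of (butlast us @ [rsmult M (last us) b]))"

lemma frag_append_of [simp]: "frag_of us \<frown> frag_of ws = frag_of (us @ ws)"
  by (simp add: frag_append_def)

lemma frag_append_zero [simp]: "0 \<frown> y = 0" "x \<frown> 0 = 0"
  by (auto simp: frag_append_def intro: frag_extend_eq_0)

lemma frag_append_left: "(x + x') \<frown> y = x \<frown> y + x' \<frown> y" "(x - x') \<frown> y = x \<frown> y - x' \<frown> y"
  by (simp_all add: frag_append_def frag_extend_add frag_extend_diff)

text \<open>Linearity in the left factor is built into \<open>frag_extend\<close>. In the right
  factor it concerns the inner extension, so it is checked on words \<open>x\<close> and spread by
  induction.\<close>

lemma frag_append_right: "x \<frown> (y - y') = x \<frown> y - x \<frown> y'" "x \<frown> (y + y') = x \<frown> y + x \<frown> y'"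
proof -
  show diff: "x \<frown> (y - y') = x \<frown> y - x \<frown> y'" for y y'
    using subset_UNIV[of "Poly_Mapping.keys x"]
    by (induction x rule: frag_induction) (simp_all add: frag_append_left, simp add: frag_append_def frag_extend_diff)
  \<comment> \<open>Additivity is the difference rule read for \<open>(y + y') - y'\<close>.\<close>
  from diff[of "y + y'" y'] show "x \<frown> (y + y') = x \<frown> y + x \<frown> y'"
    by (simp add: diff_eq_eq)
qed

lemma frag_append_assoc: "(x \<frown> y) \<frown> z = x \<frown> y \<frown> z"
proof -
  have *: "(frag_of us \<frown> frag_of ws) \<frown> z = frag_of us \<frown> frag_of ws \<frown> z" for us ws :: "'a list"
    using subset_UNIV[of "Poly_Mapping.keys z"]
    by (induction z rule: frag_induction) (simp_all add: frag_append_right del: frag_append_of, simp)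
  have **: "(frag_of us \<frown> y) \<frown> z = frag_of us \<frown> y \<frown> z" for us :: "'a list"
    using subset_UNIV[of "Poly_Mapping.keys y"]
    by (induction y rule: frag_induction) (simp_all only: * frag_append_right frag_append_left frag_append_zero)
  show ?thesis
    using subset_UNIV[of "Poly_Mapping.keys x"]
    by (induction x rule: frag_induction) (simp_all only: ** frag_append_right frag_append_left frag_append_zero)
qed

lemma frag_lsmult_simps [simp]:
  "frag_lsmult M a 0 = 0" "frag_lsmult M a (x + y) = frag_lsmult M a x + frag_lsmult M a y"
  "frag_lsmult M a (x - y) = frag_lsmult M a x - frag_lsmult M a y"
  "frag_lsmult M a (frag_of (v # ws)) = frag_of ((a \<odot>\<^bsub>M\<^esub> v) # ws)"
  by (simp_all add: frag_lsmult_def frag_extend_add frag_extend_diff)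

lemma frag_rsmult_simps [simp]:
  "frag_rsmult M a 0 = 0" "frag_rsmult M a (x + y) = frag_rsmult M a x + frag_rsmult M a y"
  "frag_rsmult M a (x - y) = frag_rsmult M a x - frag_rsmult M a y"
  "frag_rsmult M a (frag_of (us @ [v])) = frag_of (us @ [rsmult M v a])"
  by (simp_all add: frag_rsmult_def frag_extend_add frag_extend_diff)

lemma frag_rsmult_short [simp]:
  "frag_rsmult M a (frag_of [v]) = frag_of [rsmult M v a]"
  "frag_rsmult M a (frag_of [u, v]) = frag_of [u, rsmult M v a]"
  using frag_rsmult_simps(4)[of M a "[]" v] frag_rsmult_simps(4)[of M a "[u]" v] by auto

section \<open>Tensor words and relators\<close>

text \<open>The tensor algebra uses only that the right ring of each bimodule is the left ring of
  the next. Duality enters later, through the relations.\<close>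

locale bimodule_sequence =
  fixes K :: "int \<Rightarrow> 'a ring" and W :: "int \<Rightarrow> ('a, 'v) bimod"
  assumes bimodule: "bimodule (K i) (K (i + 1)) (W i)"
begin

lemmas lsm = bimodule_lsmult[OF bimodule]
lemmas rsm = bimodule_rsmult[OF bimodule]
lemmas compat = bimodule_compat[OF bimodule]
lemmas cring_K = bimodule_cring(1)[OF bimodule]
lemmas abelian_W = bimodule_abelian_group[OF bimodule]

lemma add_closed_W: "u \<in> carrier (W i) \<Longrightarrow> v \<in> carrier (W i) \<Longrightarrow> u \<oplus>\<^bsub>W i\<^esub> v \<in> carrier (W i)"
  using abelian_W[of i] by (simp add: abelian_group_def abelian_monoid.a_closed)

abbreviation "words \<equiv> tensor_words W"
abbreviation "null \<equiv> tensor_null K W"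
abbreviation "frags i j \<equiv> {c :: 'v list \<Rightarrow>\<^sub>0 int. Poly_Mapping.keys c \<subseteq> words i j}"

lemma words_append:
  assumes "us \<in> words i j" "ws \<in> words j l"
  shows "us @ ws \<in> words i l"
  using assms
  by (auto simp: tensor_words_def nth_append algebra_simps) (metis add.commute add_diff_inverse_nat add_less_cancel_left diff_add_cancel of_nat_add of_nat_diff not_less)

lemma words_Cons: "v # ws \<in> words i j \<longleftrightarrow> v \<in> carrier (W i) \<and> ws \<in> words (i + 1) j"
  by (auto simp: tensor_words_def less_Suc_eq_0_disj nth_Cons' algebra_simps split: if_splits)

lemma words_Nil: "[] \<in> words i j \<longleftrightarrow> i = j"
  by (auto simp: tensor_words_def)

lemma words_append_iff:
  "us @ ws \<in> words i j \<longleftrightarrow> us \<in> words i (i + int (length us)) \<and> ws \<in> words (i + int (length us)) j"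
  by (induction us arbitrary: i) (auto simp: words_Cons words_Nil algebra_simps)

lemma words_snoc: "ws @ [w] \<in> words i j \<longleftrightarrow> ws \<in> words i (j - 1) \<and> w \<in> carrier (W (j - 1))"
  by (auto simp: tensor_words_def nth_append less_Suc_eq split: if_splits)

lemma words_length: "us \<in> words i j \<Longrightarrow> int (length us) = j - i"
  by (simp add: tensor_words_def)

lemma frag_append_closed: "x \<in> frags i j \<Longrightarrow> y \<in> frags j l \<Longrightarrow> x \<frown> y \<in> frags i l"
  unfolding frag_append_def
  using words_append
  by (force dest!: subsetD[OF keys_frag_extend])

lemma frag_lsmult_closed:
  assumes "i < j" "a \<in> carrier (K i)" "x \<in> frags i j"
  shows "frag_lsmult (W i) a x \<in> frags i j"
proof -
  have "(a \<odot>\<^bsub>W i\<^esub> hd ws) # tl ws \<in> words i j" if "ws \<in> words i j" for ws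
    using that assms by (cases ws) (auto simp: words_Nil words_Cons intro: lsm(1))
  then show ?thesis using assms unfolding frag_lsmult_def
    by (force dest!: subsetD[OF keys_frag_extend])
qed

lemma frag_rsmult_closed:
  assumes "i < j" "b \<in> carrier (K j)" "x \<in> frags i j"
  shows "frag_rsmult (W (j - 1)) b x \<in> frags i j"
proof -
  have "butlast us @ [rsmult (W (j - 1)) (last us) b] \<in> words i j" if "us \<in> words i j" for us
    using that assms rsm(1)[of b "j - 1"]
    by (cases us rule: rev_cases) (auto simp: words_Nil words_Cons words_append_iff)
  then show ?thesis using assms unfolding frag_rsmult_def
    by (force dest!: subsetD[OF keys_frag_extend])
qed

lemma frags_closed [simp]:
  "0 \<in> frags i j" "x \<in> frags i j \<Longrightarrow> y \<in> frags i j \<Longrightarrow> x + y \<in> frags i j"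
  "x \<in> frags i j \<Longrightarrow> y \<in> frags i j \<Longrightarrow> x - y \<in> frags i j"
  "x \<in> frags i j \<Longrightarrow> - x \<in> frags i j"
  "frag_of ws \<in> frags i j \<longleftrightarrow> ws \<in> words i j"
  using keys_add[of x y] keys_diff[of x y] by auto

lemma frags_induct [consumes 1, case_names zero one diff]:
  assumes "x \<in> frags i j" "P 0" "\<And>ws. ws \<in> words i j \<Longrightarrow> P (frag_of ws)"
    and "\<And>x y. x \<in> frags i j \<Longrightarrow> y \<in> frags i j \<Longrightarrow> P x \<Longrightarrow> P y \<Longrightarrow> P (x - y)"
  shows "P x"
  using free_Abelian_group_induct[of x "words i j" P] assms by auto

lemma relators_frags: "tensor_relators K W i j \<subseteq> frags i j"
proof
  fix r assume "r \<in> tensor_relators K W i j"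
  then show "r \<in> frags i j"
    unfolding tensor_relators_def
  proof (elim UnE CollectE exE conjE)
    fix us v v' ws
    assume "r = frag_of (us @ [v \<oplus>\<^bsub>W (i + int (length us))\<^esub> v'] @ ws)
        - frag_of (us @ [v] @ ws) - frag_of (us @ [v'] @ ws)"
      "us @ [v] @ ws \<in> words i j" "us @ [v'] @ ws \<in> words i j"
    then show ?thesis
      by (auto simp only: frags_closed words_append_iff append_Cons append_Nil words_Cons add_closed_W)
  next
    fix us v a v' ws
    assume "r = frag_of (us @ [rsmult (W (i + int (length us))) v a, v'] @ ws)
        - frag_of (us @ [v, a \<odot>\<^bsub>W (i + int (length us) + 1)\<^esub> v'] @ ws)"
      "us @ [v, v'] @ ws \<in> words i j" "a \<in> carrier (K (i + int (length us) + 1))"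
    then show ?thesis
      by (auto simp only: frags_closed words_append_iff append_Cons append_Nil words_Cons lsm(1) rsm(1))
  qed
qed

lemma carrier_free [simp]: "carrier (free_Abelian_group (words i j)) = frags i j"
  by (simp add: free_Abelian_group_def)

section \<open>Sums that vanish in the tensor product, and their stability under the
  operations\<close>

lemma null_subgroup: "subgroup (null i j) (free_Abelian_group (words i j))"
  unfolding tensor_null_def
  by (rule group.generate_is_subgroup) (use relators_frags in auto)

lemma null_frags: "null i j \<subseteq> frags i j"
  using subgroup.subset[OF null_subgroup] by simp

lemma null_zero [simp]: "0 \<in> null i j"
  using subgroup.one_closed[OF null_subgroup, of i j] by simp

lemma null_add: "x \<in> null i j \<Longrightarrow> y \<in> null i j \<Longrightarrow> x + y \<in> null i j"
  using subgroup.m_closed[OF null_subgroup, of x i j y] by simp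

lemma null_minus: "x \<in> null i j \<Longrightarrow> - x \<in> null i j"
  using subgroup.m_inv_closed[OF null_subgroup, of x i j] null_frags[of i j] by auto

lemma null_diff: "x \<in> null i j \<Longrightarrow> y \<in> null i j \<Longrightarrow> x - y \<in> null i j"
  using null_add[OF _ null_minus] by fastforce

lemma null_relator: "r \<in> tensor_relators K W i j \<Longrightarrow> r \<in> null i j"
  by (simp add: tensor_null_def generate.incl)

text \<open>A subgroup is reached from zero and its generators by differences alone, so the cases of
  inverses and of products in \<open>generate\<close> merge into one.\<close>

lemma null_induct [consumes 1, case_names zero relator diff]:
  assumes "x \<in> null i j" "P 0" "\<And>r. r \<in> tensor_relators K W i j \<Longrightarrow> P r"
    and "\<And>x y. P x \<Longrightarrow> P y \<Longrightarrow> P (x - y)"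
  shows "P x"
  using assms(1) unfolding tensor_null_def
proof (induction rule: generate.induct)
  case (inv h)
  then have "inv\<^bsub>free_Abelian_group (words i j)\<^esub> h = 0 - h"
    using relators_frags[of i j] by auto
  then show ?case using assms inv by metis
next
  case (eng h1 h2)
  then have "P (h1 - (0 - h2))" using assms by metis
  then show ?case by simp
qed (use assms in auto)

text \<open>The relators are defined through the length of the prefix \<open>us\<close>. Here and in
  the next lemma the position \<open>m\<close> of the changed letter takes its place, which keeps
  the indices of the adjoining words visible; \<open>relators_cases\<close> is the converse.\<close>

lemma null_additive:
  assumes "us \<in> words i m" "v \<in> carrier (W m)" "v' \<in> carrier (W m)" "ws \<in> words (m + 1) j"
  shows "frag_of (us @ [v \<oplus>\<^bsub>W m\<^esub> v'] @ ws) - frag_of (us @ [v] @ ws) - frag_of (us @ [v'] @ ws)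
    \<in> null i j"
proof (rule null_relator)
  have "i + int (length us) = m" using words_length[OF assms(1)] by simp
  with assms have "us @ [v] @ ws \<in> words i j \<and> us @ [v'] @ ws \<in> words i j"
    by (auto simp: words_append_iff words_Cons)
  then show "frag_of (us @ [v \<oplus>\<^bsub>W m\<^esub> v'] @ ws) - frag_of (us @ [v] @ ws) - frag_of (us @ [v'] @ ws)
    \<in> tensor_relators K W i j"
    unfolding tensor_relators_def using \<open>i + int (length us) = m\<close> by blast
qed

lemma null_balanced:
  assumes "us \<in> words i m" "v \<in> carrier (W m)" "v' \<in> carrier (W (m + 1))" "ws \<in> words (m + 2) j"
    "a \<in> carrier (K (m + 1))"
  shows "frag_of (us @ [rsmult (W m) v a, v'] @ ws) - frag_of (us @ [v, a \<odot>\<^bsub>W (m + 1)\<^esub> v'] @ ws)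
    \<in> null i j"
proof (rule null_relator)
  have "i + int (length us) = m" using words_length[OF assms(1)] by simp
  with assms have "us @ [v, v'] @ ws \<in> words i j"
    by (auto simp: words_append_iff words_Cons algebra_simps)
  then show "frag_of (us @ [rsmult (W m) v a, v'] @ ws) - frag_of (us @ [v, a \<odot>\<^bsub>W (m + 1)\<^esub> v'] @ ws)
    \<in> tensor_relators K W i j"
    unfolding tensor_relators_def using \<open>i + int (length us) = m\<close> assms(5) by blast
qed

lemma relators_cases:
  assumes "r \<in> tensor_relators K W i j"
  obtains (additive) us m v v' ws where
      "r = frag_of (us @ [v \<oplus>\<^bsub>W m\<^esub> v'] @ ws) - frag_of (us @ [v] @ ws) - frag_of (us @ [v'] @ ws)"
      "us \<in> words i m" "v \<in> carrier (W m)" "v' \<in> carrier (W m)" "ws \<in> words (m + 1) j"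
    | (balanced) us m v v' a ws where
      "r = frag_of (us @ [rsmult (W m) v a, v'] @ ws) - frag_of (us @ [v, a \<odot>\<^bsub>W (m + 1)\<^esub> v'] @ ws)"
      "us \<in> words i m" "v \<in> carrier (W m)" "v' \<in> carrier (W (m + 1))" "ws \<in> words (m + 2) j"
      "a \<in> carrier (K (m + 1))"
  using assms unfolding tensor_relators_def
proof (elim UnE CollectE exE conjE, goal_cases)
  case (1 us v v' ws)
  then show ?thesis
    by (intro additive[of us "i + int (length us)" v v' ws]) (auto simp: words_append_iff words_Cons)
next
  case (2 us v a v' ws)
  then show ?thesis
    by (intro balanced[of us "i + int (length us)" v a v' ws]) (auto simp: words_append_iff words_Cons algebra_simps)
qed

text \<open>By linearity on both sides one may take a relator followed by a single word. The word
  joins the tail \<open>ws\<close>, and the result is again a relator.\<close>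

lemma null_append_left:
  assumes "x \<in> null i j" "y \<in> frags j l"
  shows "x \<frown> y \<in> null i l"
  using assms(2)
proof (induction y rule: frags_induct)
  case (one zs)
  show ?case using assms(1)
  proof (induction x rule: null_induct)
    case (relator r)
    then show ?case
    proof (cases rule: relators_cases)
      case (additive us m v v' ws)
      then show ?thesis
        using null_additive[OF additive(2-4) words_append[OF additive(5) one]] by (simp add: frag_append_left)
    next
      case (balanced us m v v' a ws)
      then show ?thesis
        using null_balanced[OF balanced(2-4) words_append[OF balanced(5) one] balanced(6)] by (simp add: frag_append_left)
    qed
  qed (simp_all add: frag_append_left null_diff)
qed (simp_all add: frag_append_right null_diff)

lemma null_append_right:
  assumes "x \<in> frags i j" "y \<in> null j l"
  shows "x \<frown> y \<in> null i l"
  using assms(1)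
proof (induction x rule: frags_induct)
  case (one zs)
  show ?case using assms(2)
  proof (induction y rule: null_induct)
    case (relator r)
    then show ?case
    proof (cases rule: relators_cases)
      case (additive us m v v' ws)
      then show ?thesis
        using null_additive[OF words_append[OF one additive(2)] additive(3-5)] by (simp add: frag_append_right)
    next
      case (balanced us m v v' a ws)
      then show ?thesis
        using null_balanced[OF words_append[OF one balanced(2)] balanced(3-6)] by (simp add: frag_append_right)
    qed
  qed (simp_all add: frag_append_right null_diff)
qed (simp_all add: frag_append_left null_diff)

text \<open>The scalar changes the first letter only, so the question is whether this letter takes
  part in the relator, that is, whether \<open>us\<close> is empty. If it does, additivity of the
  action settles an additive relator, and compatibility of the left and right actions a balancing
  one.\<close>

lemma null_lsmult:
  assumes "i < j" "c \<in> carrier (K i)" "x \<in> null i j"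
  shows "frag_lsmult (W i) c x \<in> null i j"
  using assms(3)
proof (induction x rule: null_induct)
  case (relator r)
  then show ?case
  proof (cases rule: relators_cases)
    case (additive us m v v' ws)
    show ?thesis
    proof (cases us)
      case Nil
      then have "i = m" using additive by (simp add: words_Nil)
      then show ?thesis using Nil additive lsm assms(2) null_additive[of "[]" i m "c \<odot>\<^bsub>W i\<^esub> v" "c \<odot>\<^bsub>W i\<^esub> v'" ws j]
        by (simp add: words_Nil)
    next
      case (Cons u us')
      then show ?thesis using additive lsm assms(2) null_additive[of "(c \<odot>\<^bsub>W i\<^esub> u) # us'" i m v v' ws j]
        by (simp add: words_Cons)
    qed
  next
    case (balanced us m v v' a ws)
    show ?thesis
    proof (cases us)
      case Nil
      then have "i = m" using balanced by (simp add: words_Nil)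
      then show ?thesis using Nil balanced lsm assms(2) compat[of c i a v] null_balanced[of "[]" i m "c \<odot>\<^bsub>W i\<^esub> v" v' ws j a]
        by (simp add: words_Nil)
    next
      case (Cons u us')
      then show ?thesis using balanced lsm assms(2) null_balanced[of "(c \<odot>\<^bsub>W i\<^esub> u) # us'" i m v v' ws j a]
        by (simp add: words_Cons)
    qed
  qed
qed (simp_all add: null_diff)

lemma frag_rsmult_append: "ws \<noteq> [] \<Longrightarrow>
  frag_rsmult M b (frag_of (us @ ws)) = frag_of (us @ butlast ws @ [rsmult M (last ws) b])"
  by (simp add: frag_rsmult_def butlast_append)

lemma null_rsmult:
  assumes "i < j" "c \<in> carrier (K j)" "x \<in> null i j"
  shows "frag_rsmult (W (j - 1)) c x \<in> null i j"
  using assms(3)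
proof (induction x rule: null_induct)
  case (relator r)
  let ?r = "\<lambda>v. rsmult (W (j - 1)) v c"
  have r: "?r v \<in> carrier (W (j - 1))" if "v \<in> carrier (W (j - 1))" for v
    using rsm(1)[of c "j - 1"] that assms(2) by simp
  from relator show ?case
  proof (cases rule: relators_cases)
    case (additive us m v v' ws)
    show ?thesis
    proof (cases ws rule: rev_cases)
      case Nil
      then have "m = j - 1" using additive by (simp add: words_Nil)
      then show ?thesis using Nil additive r rsm(2)[of c "j - 1" v v'] assms(2)
          null_additive[of us i m "?r v" "?r v'" "[]" j]
        by (simp add: words_Nil)
    next
      case (snoc ws' w)
      have w: "w \<in> carrier (W (j - 1))" "ws' @ [?r w] \<in> words (m + 1) j"
        using additive(5) snoc r by (auto simp: words_snoc)
      then show ?thesis using additive snoc null_additive[of us i m v v' "ws' @ [?r w]" j]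
        by (simp add: frag_rsmult_append)
    qed
  next
    case (balanced us m v v' a ws)
    show ?thesis
    proof (cases ws rule: rev_cases)
      case Nil
      then have "m + 2 = j" using balanced by (simp add: words_Nil)
      then have j: "j - 1 = m + 1" by simp
      \<comment> \<open>When the last letter \<open>v'\<close> is the one that receives
        \<open>a\<close> from the left, the two scalars sit on opposite sides of it and
        commute.\<close>
      have "rsmult (W (m + 1)) (a \<odot>\<^bsub>W (m + 1)\<^esub> v') c = a \<odot>\<^bsub>W (m + 1)\<^esub> rsmult (W (m + 1)) v' c"
        using compat[of a "m + 1" c v'] balanced assms(2) \<open>m + 2 = j\<close>[symmetric] by (simp add: add.commute)
      then show ?thesis using Nil balanced r
          null_balanced[of us i m v "?r v'" "[]" j a] \<open>m + 2 = j\<close>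
        by (simp add: words_Nil j frag_rsmult_append)
    next
      case (snoc ws' w)
      have w: "w \<in> carrier (W (j - 1))" "ws' @ [?r w] \<in> words (m + 2) j"
        using balanced(5) snoc r by (auto simp: words_snoc)
      then show ?thesis using balanced snoc null_balanced[of us i m v v' "ws' @ [?r w]" j a]
        by (simp add: frag_rsmult_append)
    qed
  qed
qed (simp_all add: null_diff)

text \<open>On formal sums the action is additive in the scalar only up to an additivity relator in
  the first letter. Independence of the representative in products with a class of scalars rests on
  this.\<close>

lemma frag_lsmult_scalar_add:
  assumes "i < j" "a \<in> carrier (K i)" "b \<in> carrier (K i)" "x \<in> frags i j"
  shows "frag_lsmult (W i) (a \<oplus>\<^bsub>K i\<^esub> b) x - frag_lsmult (W i) a x - frag_lsmult (W i) b x \<in> null i j"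
  using assms(4)
proof (induction x rule: frags_induct)
  case (one ws)
  then obtain v ws' where "ws = v # ws'" using \<open>i < j\<close> by (cases ws) (auto simp: words_Nil)
  then show ?case
    using one lsm assms null_additive[of "[]" i i "a \<odot>\<^bsub>W i\<^esub> v" "b \<odot>\<^bsub>W i\<^esub> v" ws' j] by (simp add: words_Cons words_Nil)
next
  case (diff x y)
  then show ?case using null_diff[OF diff(3,4)] by (simp add: algebra_simps)
qed simp

lemma frag_rsmult_scalar_add:
  assumes "i < j" "a \<in> carrier (K j)" "b \<in> carrier (K j)" "x \<in> frags i j"
  shows "frag_rsmult (W (j-1)) (a \<oplus>\<^bsub>K j\<^esub> b) x - frag_rsmult (W (j-1)) a x - frag_rsmult (W (j-1)) b x \<in> null i j"
  using assms(4)
proof (induction x rule: frags_induct)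
  case (one ws)
  then obtain v ws' where ws: "ws = ws' @ [v]" using \<open>i < j\<close> by (cases ws rule: rev_cases) (auto simp: words_Nil)
  then have v: "v \<in> carrier (W (j - 1))" "ws' \<in> words i (j - 1)"
    using one by (auto simp: words_append_iff words_Cons words_Nil)
  then show ?case
    using ws rsm(1)[of a "j-1"] rsm(1)[of b "j-1"] rsm(3)[of a "j-1" b v] assms
      null_additive[of "ws'" i "j-1" "rsmult (W (j-1)) v a" "rsmult (W (j-1)) v b" "[]" j] by (simp add: words_Cons words_Nil)
next
  case (diff x y)
  then show ?case using null_diff[OF diff(3,4)] by (simp add: algebra_simps)
qed simp

end

section \<open>The tensor algebra and its quotient\<close>

text \<open>Products of classes are defined as unions over all pairs of representatives. Such a
  union is one class as soon as all pairs give the same class; well-definedness is used in this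
  form.\<close>

lemma UN_UN_constant:
  assumes "a \<in> A" "b \<in> B" "\<And>x y. x \<in> A \<Longrightarrow> y \<in> B \<Longrightarrow> f x y = C"
  shows "(\<Union>x\<in>A. \<Union>y\<in>B. f x y) = C"
  using assms by auto

context bimodule_sequence begin

lemma tensor_class_eq: "tensor_class K W i j c = {d. d - c \<in> null i j}"
proof (intro equalityI subsetI)
  fix d assume "d \<in> {d. d - c \<in> null i j}"
  then show "d \<in> tensor_class K W i j c"
    by (auto simp: tensor_class_def r_coset_def intro!: bexI[of _ "d - c"])
qed (auto simp: tensor_class_def r_coset_def)

lemma tensor_class_self: "c \<in> tensor_class K W i j c"
  by (simp add: tensor_class_eq)

lemma tensor_class_eq_iff: "tensor_class K W i j c = tensor_class K W i j d \<longleftrightarrow> c - d \<in> null i j"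
proof
  assume "tensor_class K W i j c = tensor_class K W i j d"
  then show "c - d \<in> null i j" using tensor_class_self[of c i j] by (simp add: tensor_class_eq)
next
  assume *: "c - d \<in> null i j"
  have "e - c \<in> null i j \<longleftrightarrow> e - d \<in> null i j" for e
    using null_add[OF _ *, of "e - c"] null_diff[OF _ *, of "e - d"] by auto
  then show "tensor_class K W i j c = tensor_class K W i j d" by (simp add: tensor_class_eq)
qed

lemma tensor_class_frags: "c \<in> frags i j \<Longrightarrow> x \<in> tensor_class K W i j c \<Longrightarrow> x \<in> frags i j"
  using null_frags[of i j] frags_closed(2)[of "x - c" i j c] by (auto simp: tensor_class_eq)

abbreviation tens :: "int \<Rightarrow> int \<Rightarrow> ('v list \<Rightarrow>\<^sub>0 int) \<Rightarrow> ('a, 'v) tens" where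
  "tens i j c \<equiv> Inr (tensor_class K W i j c)"

lemma null_normal: "null i j \<lhd> free_Abelian_group (words i j)"
  using comm_group.subgroup_imp_normal[OF abelian_free_Abelian_group null_subgroup] .

section \<open>The components of T as groups, and their products\<close>

lemma carrier_tensor_piece:
  "carrier (tensor_piece K W i i) = Inl ` carrier (K i)"
  "i \<noteq> j \<Longrightarrow> carrier (tensor_piece K W i j) = tens i j ` frags i j"
  by (auto simp: tensor_piece_def image_group_carrier FactGroup_def RCOSETS_def tensor_class_def)

lemma one_tensor_piece:
  "\<one>\<^bsub>tensor_piece K W i i\<^esub> = Inl \<zero>\<^bsub>K i\<^esub>"
  "i \<noteq> j \<Longrightarrow> \<one>\<^bsub>tensor_piece K W i j\<^esub> = tens i j 0"
  by (auto simp: tensor_piece_def image_group_one tensor_class_eq)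

lemma mult_tensor_piece_scalar:
  assumes "a \<in> carrier (K i)" "b \<in> carrier (K i)"
  shows "Inl a \<otimes>\<^bsub>tensor_piece K W i i\<^esub> Inl b = Inl (a \<oplus>\<^bsub>K i\<^esub> b)"
  using assms by (simp add: tensor_piece_def image_group_def inv_into_f_f)

lemma mult_tensor_piece:
  assumes "i \<noteq> j" "c \<in> frags i j" "d \<in> frags i j"
  shows "tens i j c \<otimes>\<^bsub>tensor_piece K W i j\<^esub> tens i j d = tens i j (c + d)"
proof -
  let ?Q = "free_Abelian_group (words i j) Mod null i j"
  have car: "tensor_class K W i j e \<in> carrier ?Q" if "e \<in> frags i j" for e
    using that by (auto simp: FactGroup_def RCOSETS_def tensor_class_def)
  have "tens i j c \<otimes>\<^bsub>tensor_piece K W i j\<^esub> tens i j d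
    = Inr (tensor_class K W i j c \<otimes>\<^bsub>?Q\<^esub> tensor_class K W i j d)"
    using assms car by (simp add: tensor_piece_def image_group_def inv_into_f_f)
  also have "tensor_class K W i j c \<otimes>\<^bsub>?Q\<^esub> tensor_class K W i j d = tensor_class K W i j (c + d)"
    using normal.rcos_sum[OF null_normal, of c i j d] assms by (simp add: FactGroup_def tensor_class_def)
  finally show ?thesis .
qed

lemma group_tensor_piece: "group (tensor_piece K W i j)"
proof (cases "i = j")
  case True
  have "group (add_monoid (K i))"
    by (rule abelian_group.a_group) (use cring_K[of i] in \<open>simp add: cring_def ring_def\<close>)
  then show ?thesis using True by (simp add: tensor_piece_def group.inj_imp_image_group_is_group)
next
  case False
  then show ?thesis
    using normal.factorgroup_is_group[OF null_normal, of i j]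
    by (simp add: tensor_piece_def group.inj_imp_image_group_is_group)
qed

lemma inv_tensor_piece:
  assumes "i \<noteq> j" "c \<in> frags i j"
  shows "inv\<^bsub>tensor_piece K W i j\<^esub> tens i j c = tens i j (- c)"
proof (rule group.inv_equality[OF group_tensor_piece])
  show "tens i j (- c) \<otimes>\<^bsub>tensor_piece K W i j\<^esub> tens i j c = \<one>\<^bsub>tensor_piece K W i j\<^esub>"
    using mult_tensor_piece[OF assms(1) frags_closed(4)[OF assms(2)] assms(2)] assms(1)
    by (simp add: one_tensor_piece)
qed (use assms in \<open>auto simp: carrier_tensor_piece\<close>)

lemma tensor_prod_scalar:
  "tensor_prod K W i i i (Inl a) (Inl b) = Inl (a \<otimes>\<^bsub>K i\<^esub> b)"
  by (simp add: tensor_prod_def)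

lemma tensor_prod_tens:
  assumes "i < j" "j < l" "c \<in> frags i j" "d \<in> frags j l"
  shows "tensor_prod K W i j l (tens i j c) (tens j l d) = tens i l (c \<frown> d)"
proof -
  have "tensor_class K W i l (x \<frown> y) = tensor_class K W i l (c \<frown> d)"
    if x: "x \<in> tensor_class K W i j c" and y: "y \<in> tensor_class K W j l d" for x y
  proof -
    \<comment> \<open>Changing one factor at a time leaves two products, each with a null
      factor.\<close>
    have "x \<frown> y - c \<frown> d = (x - c) \<frown> y + c \<frown> (y - d)"
      by (simp add: frag_append_left frag_append_right)
    moreover have "(x - c) \<frown> y \<in> null i l"
      using x null_append_left[OF _ tensor_class_frags[OF assms(4) y]] by (simp add: tensor_class_eq)
    moreover have "c \<frown> (y - d) \<in> null i l"
      using y null_append_right[OF assms(3)] by (simp add: tensor_class_eq)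
    ultimately show ?thesis by (simp add: tensor_class_eq_iff null_add)
  qed
  then have "(\<Union>x\<in>tensor_class K W i j c. \<Union>y\<in>tensor_class K W j l d. tensor_class K W i l (x \<frown> y))
    = tensor_class K W i l (c \<frown> d)"
    by (intro UN_UN_constant[OF tensor_class_self tensor_class_self])
  then show ?thesis using assms by (simp add: tensor_prod_def frag_append_def)
qed

lemma tensor_prod_Inl_tens:
  assumes "i < l" "a \<in> carrier (K i)" "d \<in> frags i l"
  shows "tensor_prod K W i i l (Inl a) (tens i l d) = tens i l (frag_lsmult (W i) a d)"
proof -
  have "tensor_class K W i l (frag_lsmult (W i) a y) = tensor_class K W i l (frag_lsmult (W i) a d)"
    if "y \<in> tensor_class K W i l d" for y
    using that null_lsmult[OF assms(1,2), of "y - d"] by (simp add: tensor_class_eq_iff) (simp add: tensor_class_eq)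
  then have "(\<Union>y\<in>tensor_class K W i l d. tensor_class K W i l (frag_lsmult (W i) a y))
    = tensor_class K W i l (frag_lsmult (W i) a d)"
    using tensor_class_self by blast
  then show ?thesis using assms by (simp add: tensor_prod_def frag_lsmult_def)
qed

lemma tensor_prod_tens_Inl:
  assumes "i < l" "b \<in> carrier (K l)" "d \<in> frags i l"
  shows "tensor_prod K W i l l (tens i l d) (Inl b) = tens i l (frag_rsmult (W (l - 1)) b d)"
proof -
  let ?r = "frag_rsmult (W (l - 1)) b"
  have "tensor_class K W i l (?r y) = tensor_class K W i l (?r d)"
    if "y \<in> tensor_class K W i l d" for y
    using that null_rsmult[OF assms(1,2), of "y - d"] by (simp add: tensor_class_eq_iff) (simp add: tensor_class_eq)
  then have "(\<Union>y\<in>tensor_class K W i l d. tensor_class K W i l (?r y))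
    = tensor_class K W i l (?r d)"
    using tensor_class_self by blast
  then show ?thesis using assms by (simp add: tensor_prod_def frag_rsmult_def)
qed

lemma tensor_prod_closed:
  assumes "s \<in> carrier (tensor_piece K W i j)" "t \<in> carrier (tensor_piece K W j l)"
  shows "tensor_prod K W i j l s t \<in> carrier (tensor_piece K W i l)"
proof (cases "i \<le> j \<and> j \<le> l")
  case False
  then show ?thesis
    using monoid.one_closed[OF group.is_monoid[OF group_tensor_piece], of i l]
    unfolding tensor_prod_def by (simp only: if_False)
next
  case True
  consider "i = j" "j = l" | "i = j" "j < l" | "i < j" "j = l" | "i < j" "j < l" using True by linarith
  then show ?thesis
  proof cases
    case 1
    then show ?thesis using assms cring.cring_simprules(5)[OF cring_K]
      by (auto simp: carrier_tensor_piece tensor_prod_scalar)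
  next
    case 2
    then obtain a d where "a \<in> carrier (K i)" "d \<in> frags i l" "s = Inl a" "t = tens i l d"
      using assms by (auto simp: carrier_tensor_piece)
    then show ?thesis using 2 frag_lsmult_closed by (auto simp: tensor_prod_Inl_tens carrier_tensor_piece)
  next
    case 3
    then obtain a d where "a \<in> carrier (K l)" "d \<in> frags i l" "t = Inl a" "s = tens i l d"
      using assms by (auto simp: carrier_tensor_piece)
    then show ?thesis using 3 frag_rsmult_closed by (auto simp: tensor_prod_tens_Inl carrier_tensor_piece)
  next
    case 4
    then obtain c d where "c \<in> frags i j" "d \<in> frags j l" "s = tens i j c" "t = tens j l d"
      using assms by (auto simp: carrier_tensor_piece)
    then show ?thesis using 4 frag_append_closed[of c i j d l] by (auto simp: tensor_prod_tens carrier_tensor_piece)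
  qed
qed

lemma tensor_alg_simps [simp]:
  "piece (tensor_alg K W) = tensor_piece K W" "mul (tensor_alg K W) = tensor_prod K W"
  by (simp_all add: tensor_alg_def)

lemma carrier_indexed_ideal: "indexed_ideal (tensor_alg K W) (\<lambda>i j. carrier (tensor_piece K W i j))"
  using tensor_prod_closed group.subgroup_self[OF group_tensor_piece] by (auto simp: indexed_ideal_def)

end

section \<open>Ideals generated by homogeneous elements\<close>

lemma generated_ideal_iff:
  "x \<in> generated_ideal D S i j \<longleftrightarrow>
    (\<forall>I. indexed_ideal D I \<longrightarrow> (\<forall>k l. S k l \<subseteq> I k l) \<longrightarrow> x \<in> I i j)"
  by (auto simp: generated_ideal_def)

lemma generated_ideal_incl: "S k l \<subseteq> generated_ideal D S k l"
  by (auto simp: generated_ideal_def)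

text \<open>An intersection of ideals is an ideal provided that there is one to intersect;
  \<open>whole\<close>, together with \<open>S\<close> lying in the carriers, makes the whole
  algebra such an ideal.\<close>

lemma indexed_ideal_generated:
  assumes "\<And>i j. group (piece D i j)"
    and whole: "indexed_ideal D (\<lambda>i j. carrier (piece D i j))"
    and "\<And>k l. S k l \<subseteq> carrier (piece D k l)"
  shows "indexed_ideal D (generated_ideal D S)"
  unfolding indexed_ideal_def
proof (intro conjI allI ballI)
  fix i j l a x
  show "subgroup (generated_ideal D S i j) (piece D i j)"
    unfolding generated_ideal_def
  proof (rule group.subgroups_Inter[OF assms(1)])
    show "{I i j |I. indexed_ideal D I \<and> (\<forall>k l. S k l \<subseteq> I k l)} \<noteq> {}"
      using whole assms(3) by blast
  qed (auto simp: indexed_ideal_def)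
  show "mul D i j l a x \<in> generated_ideal D S i l"
    if "a \<in> carrier (piece D i j)" "x \<in> generated_ideal D S j l"
    using that unfolding generated_ideal_iff by (simp add: indexed_ideal_def)
  show "mul D i j l x a \<in> generated_ideal D S i l"
    if "x \<in> generated_ideal D S i j" "a \<in> carrier (piece D j l)"
    using that unfolding generated_ideal_iff by (simp add: indexed_ideal_def)
qed

locale sym_algebra = bimodule_sequence K W
  for K :: "int \<Rightarrow> 'a ring" and W :: "int \<Rightarrow> ('a, 'v) bimod" +
  fixes ev :: "int \<Rightarrow> 'v \<Rightarrow> 'v \<Rightarrow> 'a"
begin

abbreviation "R \<equiv> sym_relations K W ev"

lemma ideal_R: "indexed_ideal (tensor_alg K W) R"
  unfolding sym_relations_def
  by (rule indexed_ideal_generated)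
    (auto simp: group_tensor_piece carrier_indexed_ideal euler_tensors_def carrier_tensor_piece)

lemma euler_R: "euler_tensors K W ev i \<subseteq> R i (i + 2)"
  unfolding sym_relations_def
  using generated_ideal_incl[of "\<lambda>i j. if j = i + 2 then euler_tensors K W ev i else {}" i "i + 2"] by auto

lemma subgroup_R: "subgroup (R i j) (tensor_piece K W i j)"
  using ideal_R by (auto simp: indexed_ideal_def)

lemma R_left: "a \<in> carrier (tensor_piece K W i j) \<Longrightarrow> x \<in> R j l \<Longrightarrow> tensor_prod K W i j l a x \<in> R i l"
  and R_right: "x \<in> R i j \<Longrightarrow> a \<in> carrier (tensor_piece K W j l) \<Longrightarrow> tensor_prod K W i j l x a \<in> R i l"
  using ideal_R by (auto simp: indexed_ideal_def)

text \<open>The formal sums that represent zero in \<open>A\<close>, for distinct \<open>i\<close>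
  and \<open>j\<close>. Equality of classes in \<open>A\<close> becomes membership of a difference
  of representatives, and cosets of cosets are avoided.\<close>

definition rel_frags :: "int \<Rightarrow> int \<Rightarrow> ('v list \<Rightarrow>\<^sub>0 int) set" where
  "rel_frags i j = {c \<in> frags i j. tens i j c \<in> R i j}"

lemma rel_frags_null:
  assumes "i \<noteq> j" "x \<in> null i j"
  shows "x \<in> rel_frags i j"
proof -
  have "tens i j x = \<one>\<^bsub>tensor_piece K W i j\<^esub>"
    using assms by (simp add: one_tensor_piece tensor_class_eq_iff)
  then show ?thesis
    using subgroup.one_closed[OF subgroup_R, of i j] assms null_frags by (auto simp: rel_frags_def)
qed

lemma rel_frags_closed:
  assumes "i \<noteq> j" "x \<in> rel_frags i j"
  shows "- x \<in> rel_frags i j" "y \<in> rel_frags i j \<Longrightarrow> x + y \<in> rel_frags i j"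
    "y \<in> rel_frags i j \<Longrightarrow> x - y \<in> rel_frags i j"
proof -
  have uminus: "- x \<in> rel_frags i j" if "x \<in> rel_frags i j" for x
    using that subgroup.m_inv_closed[OF subgroup_R, of "tens i j x" i j] inv_tensor_piece[OF assms(1), of x]
      frags_closed(4)[of x i j]
    by (simp add: rel_frags_def)
  have plus: "x + y \<in> rel_frags i j" if "x \<in> rel_frags i j" "y \<in> rel_frags i j" for x y
    using that subgroup.m_closed[OF subgroup_R, of "tens i j x" i j "tens i j y"]
      mult_tensor_piece[OF assms(1), of x y] frags_closed(2)[of x i j y]
    by (simp add: rel_frags_def)
  show "- x \<in> rel_frags i j" using uminus assms by simp
  show "x + y \<in> rel_frags i j" if "y \<in> rel_frags i j" using plus assms that by simp
  show "x - y \<in> rel_frags i j" if "y \<in> rel_frags i j" using plus[OF assms(2) uminus[OF that]] by simp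
qed

lemma rel_frags_append_left:
  assumes "i < j" "j < l" "x \<in> rel_frags i j" "y \<in> frags j l"
  shows "x \<frown> y \<in> rel_frags i l"
  using R_right[of "tens i j x" i j "tens j l y" l] frag_append_closed[of x i j y l] assms
  by (simp add: rel_frags_def tensor_prod_tens carrier_tensor_piece)

lemma rel_frags_append_right:
  assumes "i < j" "j < l" "x \<in> frags i j" "y \<in> rel_frags j l"
  shows "x \<frown> y \<in> rel_frags i l"
  using R_left[of "tens i j x" i j "tens j l y" l] frag_append_closed[of x i j y l] assms
  by (simp add: rel_frags_def tensor_prod_tens carrier_tensor_piece)

lemma rel_frags_lsmult:
  assumes "i < j" "a \<in> carrier (K i)" "x \<in> rel_frags i j"
  shows "frag_lsmult (W i) a x \<in> rel_frags i j"
  using R_left[of "Inl a" i i "tens i j x" j] frag_lsmult_closed[of i j a x] assms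
  by (simp add: rel_frags_def tensor_prod_Inl_tens carrier_tensor_piece)

lemma rel_frags_rsmult:
  assumes "i < j" "b \<in> carrier (K j)" "x \<in> rel_frags i j"
  shows "frag_rsmult (W (j - 1)) b x \<in> rel_frags i j"
  using R_right[of "tens i j x" i j "Inl b" j] frag_rsmult_closed[of i j b x] assms
  by (simp add: rel_frags_def tensor_prod_tens_Inl carrier_tensor_piece)

text \<open>The part \<open>R i i\<close> in degree zero is never computed. That \<open>R\<close> is
  an ideal already makes its scalars act into the relations, which is what independence of the
  representative of a scalar class requires.\<close>

lemma rel_frags_scalar_left:
  assumes "i < j" "a \<in> carrier (K i)" "Inl a \<in> R i i" "x \<in> frags i j"
  shows "frag_lsmult (W i) a x \<in> rel_frags i j"
  using R_right[of "Inl a" i i "tens i j x" j] frag_lsmult_closed[of i j a x] assms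
  by (simp add: rel_frags_def tensor_prod_Inl_tens carrier_tensor_piece)

lemma rel_frags_scalar_right:
  assumes "i < j" "b \<in> carrier (K j)" "Inl b \<in> R j j" "x \<in> frags i j"
  shows "frag_rsmult (W (j - 1)) b x \<in> rel_frags i j"
  using R_left[of "tens i j x" i j "Inl b" j] frag_rsmult_closed[of i j b x] assms
  by (simp add: rel_frags_def tensor_prod_tens_Inl carrier_tensor_piece)

lemma R_carrier: "x \<in> R i j \<Longrightarrow> x \<in> carrier (tensor_piece K W i j)"
  using subgroup.subset[OF subgroup_R] by blast

lemma sym_class_eq:
  assumes "i \<noteq> j" "c \<in> frags i j"
  shows "sym_class K W ev i j c = {tens i j d | d. d \<in> frags i j \<and> d - c \<in> rel_frags i j}"
proof (intro equalityI subsetI)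
  fix s assume "s \<in> sym_class K W ev i j c"
  then obtain r where r: "r \<in> R i j" "s = r \<otimes>\<^bsub>tensor_piece K W i j\<^esub> tens i j c"
    by (auto simp: sym_class_def r_coset_def)
  then obtain e where "e \<in> frags i j" "r = tens i j e"
    using R_carrier[OF r(1)] assms by (auto simp: carrier_tensor_piece)
  then show "s \<in> {tens i j d | d. d \<in> frags i j \<and> d - c \<in> rel_frags i j}"
    using r assms mult_tensor_piece[OF assms(1), of e c] frags_closed(2)[of e i j c]
    by (auto simp: rel_frags_def intro!: exI[of _ "e + c"])
next
  fix s assume "s \<in> {tens i j d | d. d \<in> frags i j \<and> d - c \<in> rel_frags i j}"
  then obtain d where d: "s = tens i j d" "d \<in> frags i j" "d - c \<in> rel_frags i j" by blast
  then have "s = tens i j (d - c) \<otimes>\<^bsub>tensor_piece K W i j\<^esub> tens i j c" "tens i j (d - c) \<in> R i j"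
    using assms mult_tensor_piece[OF assms(1), of "d - c" c] by (auto simp: rel_frags_def)
  then show "s \<in> sym_class K W ev i j c"
    by (auto simp: sym_class_def r_coset_def)
qed

lemma sym_class_cong:
  assumes "i \<noteq> j" "c \<in> frags i j" "d \<in> frags i j" "c - d \<in> rel_frags i j"
  shows "sym_class K W ev i j c = sym_class K W ev i j d"
proof -
  have "e - c \<in> rel_frags i j \<longleftrightarrow> e - d \<in> rel_frags i j" for e
    using rel_frags_closed(2)[OF assms(1) _ assms(4), of "e - c"]
      rel_frags_closed(3)[OF assms(1) _ assms(4), of "e - d"] by auto
  then show ?thesis using assms by (simp add: sym_class_eq)
qed

text \<open>An element of the degree zero piece of \<open>A\<close>, which by construction of the
  quotient is a coset of \<open>R i i\<close> and not a bare scalar.\<close>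

definition scalar_class :: "int \<Rightarrow> 'a \<Rightarrow> ('a, 'v) tens set" where
  "scalar_class i a = R i i #>\<^bsub>tensor_piece K W i i\<^esub> Inl a"

lemma scalar_class_memE:
  assumes "s \<in> scalar_class i a" "a \<in> carrier (K i)"
  obtains z where "z \<in> carrier (K i)" "Inl z \<in> R i i" "s = Inl (z \<oplus>\<^bsub>K i\<^esub> a)"
proof -
  from assms obtain r where r: "r \<in> R i i" "s = r \<otimes>\<^bsub>tensor_piece K W i i\<^esub> Inl a"
    by (auto simp: scalar_class_def r_coset_def)
  then obtain z where "z \<in> carrier (K i)" "r = Inl z"
    using R_carrier[OF r(1)] by (auto simp: carrier_tensor_piece)
  then show ?thesis using that r assms mult_tensor_piece_scalar by metis
qed

lemma scalar_class_self:
  assumes "a \<in> carrier (K i)"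
  shows "Inl a \<in> scalar_class i a"
  using group.rcos_self[OF group_tensor_piece _ subgroup_R, of "Inl a" i i] assms
  by (simp add: scalar_class_def carrier_tensor_piece)

lemma tens_in_sym_class: "i \<noteq> j \<Longrightarrow> c \<in> frags i j \<Longrightarrow> tens i j c \<in> sym_class K W ev i j c"
  using rel_frags_null[OF _ null_zero] by (auto simp: sym_class_eq)

section \<open>Components and products of A in terms of representatives\<close>

lemma carrier_sym:
  "carrier (piece (nc_sym_alg K W ev) i i) = scalar_class i ` carrier (K i)"
  "i \<noteq> j \<Longrightarrow> carrier (piece (nc_sym_alg K W ev) i j) = sym_class K W ev i j ` frags i j"
  by (auto simp: nc_sym_alg_def quotient_alg_def FactGroup_def RCOSETS_def carrier_tensor_piece
      scalar_class_def sym_class_def)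

lemma mul_sym_def: "mul (nc_sym_alg K W ev) i j l P P' =
    (\<Union>s\<in>P. \<Union>t\<in>P'. R i l #>\<^bsub>tensor_piece K W i l\<^esub> tensor_prod K W i j l s t)"
  by (simp add: nc_sym_alg_def quotient_alg_def)

lemma mul_sym_class:
  assumes "i < j" "j < l" "c \<in> frags i j" "d \<in> frags j l"
  shows "mul (nc_sym_alg K W ev) i j l (sym_class K W ev i j c) (sym_class K W ev j l d)
    = sym_class K W ev i l (c \<frown> d)"
proof -
  have "R i l #>\<^bsub>tensor_piece K W i l\<^esub> tensor_prod K W i j l s t = sym_class K W ev i l (c \<frown> d)"
    if s: "s \<in> sym_class K W ev i j c" and t: "t \<in> sym_class K W ev j l d" for s t
  proof -
    obtain x where x: "s = tens i j x" "x \<in> frags i j" "x - c \<in> rel_frags i j"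
      using s assms by (auto simp: sym_class_eq)
    obtain y where y: "t = tens j l y" "y \<in> frags j l" "y - d \<in> rel_frags j l"
      using t assms by (auto simp: sym_class_eq)
    have "x \<frown> y - c \<frown> d = (x - c) \<frown> y + c \<frown> (y - d)"
      by (simp add: frag_append_left frag_append_right)
    then have "x \<frown> y - c \<frown> d \<in> rel_frags i l"
      using rel_frags_append_left[OF assms(1,2) x(3) y(2)] rel_frags_append_right[OF assms(1,2,3) y(3)]
        rel_frags_closed(2)[of i l] assms(1,2) by auto
    then have "sym_class K W ev i l (x \<frown> y) = sym_class K W ev i l (c \<frown> d)"
      using assms frag_append_closed[OF x(2) y(2)] frag_append_closed[OF assms(3,4)] by (intro sym_class_cong) auto
    then show ?thesis using assms x y by (simp add: tensor_prod_tens sym_class_def)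
  qed
  then show ?thesis
    using tens_in_sym_class[OF _ assms(3)] tens_in_sym_class[OF _ assms(4)] assms(1,2)
    unfolding mul_sym_def by (intro UN_UN_constant) auto
qed

lemma mul_scalar_sym_class:
  assumes "i < l" "a \<in> carrier (K i)" "d \<in> frags i l"
  shows "mul (nc_sym_alg K W ev) i i l (scalar_class i a) (sym_class K W ev i l d)
    = sym_class K W ev i l (frag_lsmult (W i) a d)"
proof -
  have "R i l #>\<^bsub>tensor_piece K W i l\<^esub> tensor_prod K W i i l s t = sym_class K W ev i l (frag_lsmult (W i) a d)"
    if s: "s \<in> scalar_class i a" and t: "t \<in> sym_class K W ev i l d" for s t
  proof -
    let ?l = "frag_lsmult (W i)"
    obtain z where z: "z \<in> carrier (K i)" "Inl z \<in> R i i" "s = Inl (z \<oplus>\<^bsub>K i\<^esub> a)"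
      using scalar_class_memE[OF s assms(2)] .
    obtain y where y: "t = tens i l y" "y \<in> frags i l" "y - d \<in> rel_frags i l"
      using t assms by (auto simp: sym_class_eq)
    have za: "z \<oplus>\<^bsub>K i\<^esub> a \<in> carrier (K i)"
      using z assms cring.cring_simprules(1)[OF cring_K] by auto
    \<comment> \<open>Three errors: the failure of additivity in the scalar, the action of
      \<open>z\<close> from \<open>R i i\<close>, and the change from \<open>y\<close> to
      \<open>d\<close>.\<close>
    have "?l (z \<oplus>\<^bsub>K i\<^esub> a) y - ?l a d = (?l (z \<oplus>\<^bsub>K i\<^esub> a) y - ?l z y - ?l a y) + (?l z y + ?l a (y - d))"
      by simp
    then have "?l (z \<oplus>\<^bsub>K i\<^esub> a) y - ?l a d \<in> rel_frags i l"
      using rel_frags_null[OF _ frag_lsmult_scalar_add[OF assms(1) z(1) assms(2) y(2)]]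
        rel_frags_scalar_left[OF assms(1) z(1,2) y(2)] rel_frags_lsmult[OF assms(1,2) y(3)]
        rel_frags_closed(2)[of i l] assms(1) by (metis less_irrefl)
    then have "sym_class K W ev i l (?l (z \<oplus>\<^bsub>K i\<^esub> a) y) = sym_class K W ev i l (?l a d)"
      using assms frag_lsmult_closed[OF assms(1) za y(2)] frag_lsmult_closed[OF assms] by (intro sym_class_cong) auto
    then show ?thesis using tensor_prod_Inl_tens[OF assms(1) za y(2)] y z by (simp add: sym_class_def)
  qed
  then show ?thesis
    using scalar_class_self[OF assms(2)] tens_in_sym_class[OF _ assms(3)] assms(1)
    unfolding mul_sym_def by (intro UN_UN_constant) auto
qed

lemma mul_sym_class_scalar:
  assumes "i < l" "a \<in> carrier (K l)" "d \<in> frags i l"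
  shows "mul (nc_sym_alg K W ev) i l l (sym_class K W ev i l d) (scalar_class l a)
    = sym_class K W ev i l (frag_rsmult (W (l - 1)) a d)"
proof -
  have "R i l #>\<^bsub>tensor_piece K W i l\<^esub> tensor_prod K W i l l t s = sym_class K W ev i l (frag_rsmult (W (l - 1)) a d)"
    if s: "s \<in> scalar_class l a" and t: "t \<in> sym_class K W ev i l d" for s t
  proof -
    let ?l = "frag_rsmult (W (l - 1))"
    obtain z where z: "z \<in> carrier (K l)" "Inl z \<in> R l l" "s = Inl (z \<oplus>\<^bsub>K l\<^esub> a)"
      using scalar_class_memE[OF s assms(2)] .
    obtain y where y: "t = tens i l y" "y \<in> frags i l" "y - d \<in> rel_frags i l"
      using t assms by (auto simp: sym_class_eq)
    have za: "z \<oplus>\<^bsub>K l\<^esub> a \<in> carrier (K l)"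
      using z assms cring.cring_simprules(1)[OF cring_K] by auto
    have "?l (z \<oplus>\<^bsub>K l\<^esub> a) y - ?l a d = (?l (z \<oplus>\<^bsub>K l\<^esub> a) y - ?l z y - ?l a y) + (?l z y + ?l a (y - d))"
      by simp
    then have "?l (z \<oplus>\<^bsub>K l\<^esub> a) y - ?l a d \<in> rel_frags i l"
      using rel_frags_null[OF _ frag_rsmult_scalar_add[OF assms(1) z(1) assms(2) y(2)]]
        rel_frags_scalar_right[OF assms(1) z(1,2) y(2)] rel_frags_rsmult[OF assms(1,2) y(3)]
        rel_frags_closed(2)[of i l] assms(1) by (metis less_irrefl)
    then have "sym_class K W ev i l (?l (z \<oplus>\<^bsub>K l\<^esub> a) y) = sym_class K W ev i l (?l a d)"
      using assms frag_rsmult_closed[OF assms(1) za y(2)] frag_rsmult_closed[OF assms] by (intro sym_class_cong) auto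
    then show ?thesis using tensor_prod_tens_Inl[OF assms(1) za y(2)] y z by (simp add: sym_class_def)
  qed
  then show ?thesis
    using scalar_class_self[OF assms(2)] tens_in_sym_class[OF _ assms(3)] assms(1)
    unfolding mul_sym_def by (intro UN_UN_constant) auto
qed

lemma mul_sym_outside:
  assumes "\<not> (i \<le> j \<and> j \<le> l)" "P \<noteq> {}" "P' \<noteq> {}"
  shows "mul (nc_sym_alg K W ev) i j l P P' = R i l #>\<^bsub>tensor_piece K W i l\<^esub> \<one>\<^bsub>tensor_piece K W i l\<^esub>"
  using assms by (auto simp: mul_sym_def tensor_prod_def)

end

section \<open>Normality on generators\<close>

context sym_algebra begin

text \<open>Congruences between \<open>f x\<close> and \<open>g c\<close> can be subtracted, so a
  solution \<open>c\<close> for every word gives one for every formal sum.\<close>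

lemma frags_lift_relation:
  assumes "i < l" and x: "x \<in> frags i' j'"
    and f: "f 0 = 0" "\<And>x y. f (x - y) = f x - f y"
    and g: "g 0 = 0" "\<And>x y. g (x - y) = g x - g y"
    and words: "\<And>ws. ws \<in> words i' j' \<Longrightarrow> \<exists>c\<in>frags m n. f (frag_of ws) - g c \<in> rel_frags i l"
  shows "\<exists>c\<in>frags m n. f x - g c \<in> rel_frags i l"
  using x
proof (induction x rule: frags_induct)
  case zero
  then show ?case using f g rel_frags_null[OF _ null_zero, of i l] assms(1) by (intro bexI[of _ 0]) auto
next
  case (diff x y)
  then obtain c d where cd: "c \<in> frags m n" "f x - g c \<in> rel_frags i l" "d \<in> frags m n" "f y - g d \<in> rel_frags i l"
    by blast
  have "f (x - y) - g (c - d) = (f x - g c) - (f y - g d)" using f g by simp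
  then have "f (x - y) - g (c - d) \<in> rel_frags i l"
    using rel_frags_closed(3)[OF _ cd(2,4)] assms(1) by simp
  then show ?case using frags_closed(3)[OF cd(1,3)] by blast
qed (rule words)

context
  fixes \<delta> :: int and \<gamma> :: "int \<Rightarrow> 'v list \<Rightarrow>\<^sub>0 int"
  assumes \<delta>: "0 < \<delta>" and \<gamma>: "\<And>i. \<gamma> i \<in> frags i (i + \<delta>)"
begin

text \<open>\<open>\<gamma> i\<close> passes through a word from left to right: the first letter
  \<open>v\<close> is traded for some \<open>u\<close> in front, which leaves
  \<open>\<gamma> (i + 1)\<close> before the rest of the word.\<close>

lemma commute_right:
  assumes deg1: "\<forall>i. \<forall>v\<in>carrier (W (i + \<delta>)).
      \<exists>u\<in>carrier (W i). \<gamma> i \<frown> frag_of [v] - frag_of [u] \<frown> \<gamma> (i + 1) \<in> rel_frags i (i + 1 + \<delta>)"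
    and "i < j" "x \<in> frags (i + \<delta>) (j + \<delta>)"
  shows "\<exists>c\<in>frags i j. \<gamma> i \<frown> x - c \<frown> \<gamma> j \<in> rel_frags i (j + \<delta>)"
proof -
  have words: "\<exists>c\<in>frags i j. \<gamma> i \<frown> frag_of ws - c \<frown> \<gamma> j \<in> rel_frags i (j + \<delta>)"
    if "i < j" "ws \<in> words (i + \<delta>) (j + \<delta>)" for ws i
    using that
  proof (induction ws arbitrary: i)
    case Nil
    then show ?case by (simp add: words_Nil)
  next
    case (Cons v ws)
    have ix: "i + \<delta> + 1 = i + 1 + \<delta>" by simp
    have v: "v \<in> carrier (W (i + \<delta>))" and ws: "ws \<in> words (i + 1 + \<delta>) (j + \<delta>)"
      using Cons.prems by (auto simp: words_Cons ix)
    obtain u where u: "u \<in> carrier (W i)"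
      "\<gamma> i \<frown> frag_of [v] - frag_of [u] \<frown> \<gamma> (i + 1) \<in> rel_frags i (i + 1 + \<delta>)"
      using deg1[rule_format, OF v] by blast
    have u': "frag_of [u] \<in> frags i (i + 1)" using u by (simp add: words_Cons words_Nil)
    show ?case
    proof (cases "ws = []")
      case True
      then have "j = i + 1" using ws by (simp add: words_Nil)
      then show ?thesis using u u' True by (intro bexI[of _ "frag_of [u]"]) auto
    next
      case False
      then have "i + 1 < j" using words_length[OF ws] by (cases ws) auto
      then obtain c where c: "c \<in> frags (i + 1) j"
        "\<gamma> (i + 1) \<frown> frag_of ws - c \<frown> \<gamma> j \<in> rel_frags (i + 1) (j + \<delta>)"
        using Cons.IH[OF _ ws] by blast
      have split: "frag_of (v # ws) = frag_of [v] \<frown> frag_of ws" by simp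
      \<comment> \<open>The error is the relation for the first letter times the tail, plus the new
        letter times the relation for the tail.\<close>
      have "\<gamma> i \<frown> frag_of (v # ws) - (frag_of [u] \<frown> c) \<frown> \<gamma> j
        = (\<gamma> i \<frown> frag_of [v] - frag_of [u] \<frown> \<gamma> (i + 1)) \<frown> frag_of ws
          + frag_of [u] \<frown> (\<gamma> (i + 1) \<frown> frag_of ws - c \<frown> \<gamma> j)"
        unfolding split by (simp only: frag_append_left frag_append_right frag_append_assoc) simp
      moreover have "(\<gamma> i \<frown> frag_of [v] - frag_of [u] \<frown> \<gamma> (i + 1)) \<frown> frag_of ws \<in> rel_frags i (j + \<delta>)"
        using \<open>i + 1 < j\<close> \<delta> ws by (intro rel_frags_append_left[OF _ _ u(2)]) auto
      moreover have "frag_of [u] \<frown> (\<gamma> (i + 1) \<frown> frag_of ws - c \<frown> \<gamma> j) \<in> rel_frags i (j + \<delta>)"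
        using \<open>i + 1 < j\<close> \<delta> by (intro rel_frags_append_right[OF _ _ u' c(2)]) auto
      ultimately have "\<gamma> i \<frown> frag_of (v # ws) - (frag_of [u] \<frown> c) \<frown> \<gamma> j \<in> rel_frags i (j + \<delta>)"
        using rel_frags_closed(2)[of i "j + \<delta>"] \<open>i + 1 < j\<close> \<delta> by auto
      then show ?thesis using frag_append_closed[OF u' c(1)] by blast
    qed
  qed
  show ?thesis
    by (rule frags_lift_relation[OF _ assms(3), where f = "\<lambda>x. \<gamma> i \<frown> x" and g = "\<lambda>c. c \<frown> \<gamma> j"])
      (use words assms(2) \<delta> in \<open>auto simp: frag_append_left frag_append_right\<close>)
qed

text \<open>The opposite direction starts at the last letter, so the induction extends words at the
  end and lets the right index \<open>j\<close> vary.\<close>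

lemma commute_left:
  assumes deg1: "\<forall>i. \<forall>u\<in>carrier (W i).
      \<exists>v\<in>carrier (W (i + \<delta>)). \<gamma> i \<frown> frag_of [v] - frag_of [u] \<frown> \<gamma> (i + 1) \<in> rel_frags i (i + 1 + \<delta>)"
    and "i < j" "x \<in> frags i j"
  shows "\<exists>c\<in>frags (i + \<delta>) (j + \<delta>). x \<frown> \<gamma> j - \<gamma> i \<frown> c \<in> rel_frags i (j + \<delta>)"
proof -
  have words: "\<exists>c\<in>frags (i + \<delta>) (j + \<delta>). frag_of ws \<frown> \<gamma> j - \<gamma> i \<frown> c \<in> rel_frags i (j + \<delta>)"
    if "i < j" "ws \<in> words i j" for ws j
    using that
  proof (induction ws arbitrary: j rule: rev_induct)
    case Nil
    then show ?case by (simp add: words_Nil)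
  next
    case (snoc u ws)
    have u: "u \<in> carrier (W (j - 1))" and ws: "ws \<in> words i (j - 1)"
      using snoc.prems by (auto simp: words_snoc)
    obtain v where v: "v \<in> carrier (W (j - 1 + \<delta>))"
      "\<gamma> (j - 1) \<frown> frag_of [v] - frag_of [u] \<frown> \<gamma> j \<in> rel_frags (j - 1) (j + \<delta>)"
      using deg1[rule_format, OF u] by auto
    have v': "frag_of [v] \<in> frags (j - 1 + \<delta>) (j + \<delta>)" using v by (simp add: words_Cons words_Nil)
    have neg: "frag_of [u] \<frown> \<gamma> j - \<gamma> (j - 1) \<frown> frag_of [v] \<in> rel_frags (j - 1) (j + \<delta>)"
      using rel_frags_closed(1)[OF _ v(2)] \<delta> by simp
    show ?case
    proof (cases "ws = []")
      case True
      then have "i = j - 1" using ws by (simp add: words_Nil)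
      then show ?thesis using v' neg True by (intro bexI[of _ "frag_of [v]"]) auto
    next
      case False
      then have "i < j - 1" using words_length[OF ws] by (cases ws) auto
      then obtain c where c: "c \<in> frags (i + \<delta>) (j - 1 + \<delta>)"
        "frag_of ws \<frown> \<gamma> (j - 1) - \<gamma> i \<frown> c \<in> rel_frags i (j - 1 + \<delta>)"
        using snoc.IH[OF _ ws] by blast
      have split: "frag_of (ws @ [u]) = frag_of ws \<frown> frag_of [u]" by simp
      have "frag_of (ws @ [u]) \<frown> \<gamma> j - \<gamma> i \<frown> c \<frown> frag_of [v]
        = frag_of ws \<frown> (frag_of [u] \<frown> \<gamma> j - \<gamma> (j - 1) \<frown> frag_of [v])
          + (frag_of ws \<frown> \<gamma> (j - 1) - \<gamma> i \<frown> c) \<frown> frag_of [v]"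
        unfolding split by (simp only: frag_append_left frag_append_right frag_append_assoc) simp
      moreover have "frag_of ws \<frown> (frag_of [u] \<frown> \<gamma> j - \<gamma> (j - 1) \<frown> frag_of [v]) \<in> rel_frags i (j + \<delta>)"
        using \<open>i < j - 1\<close> \<delta> ws by (intro rel_frags_append_right[OF _ _ _ neg]) auto
      moreover have "(frag_of ws \<frown> \<gamma> (j - 1) - \<gamma> i \<frown> c) \<frown> frag_of [v] \<in> rel_frags i (j + \<delta>)"
        using \<open>i < j - 1\<close> \<delta> v' by (intro rel_frags_append_left[OF _ _ c(2)]) auto
      ultimately have "frag_of (ws @ [u]) \<frown> \<gamma> j - \<gamma> i \<frown> c \<frown> frag_of [v] \<in> rel_frags i (j + \<delta>)"
        using rel_frags_closed(2)[of i "j + \<delta>"] \<open>i < j - 1\<close> \<delta> by auto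
      then show ?thesis using frag_append_closed[OF c(1) v'] by blast
    qed
  qed
  show ?thesis
    by (rule frags_lift_relation[OF _ assms(3), where f = "\<lambda>x. x \<frown> \<gamma> j" and g = "\<lambda>c. \<gamma> i \<frown> c"])
      (use words assms(2) \<delta> in \<open>auto simp: frag_append_left frag_append_right\<close>)
qed

text \<open>Both sets in the definition of a normal family are images of maps on representatives, so
  their equality is solvability of a congruence in either direction. For \<open>i < j\<close> this
  is \<open>commute_right\<close> and \<open>commute_left\<close>, for \<open>i = j\<close> the two
  scalar hypotheses.\<close>

theorem normal_familyI:
  assumes scalar_right: "\<And>i a. a \<in> carrier (K (i + \<delta>)) \<Longrightarrow> \<exists>b\<in>carrier (K i).
      frag_rsmult (W (i + \<delta> - 1)) a (\<gamma> i) - frag_lsmult (W i) b (\<gamma> i) \<in> rel_frags i (i + \<delta>)"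
    and scalar_left: "\<And>i b. b \<in> carrier (K i) \<Longrightarrow> \<exists>a\<in>carrier (K (i + \<delta>)).
      frag_rsmult (W (i + \<delta> - 1)) a (\<gamma> i) - frag_lsmult (W i) b (\<gamma> i) \<in> rel_frags i (i + \<delta>)"
    and vector_right: "\<And>i v. v \<in> carrier (W (i + \<delta>)) \<Longrightarrow>
      \<exists>u\<in>carrier (W i). \<gamma> i \<frown> frag_of [v] - frag_of [u] \<frown> \<gamma> (i + 1) \<in> rel_frags i (i + 1 + \<delta>)"
    and vector_left: "\<And>i u. u \<in> carrier (W i) \<Longrightarrow>
      \<exists>v\<in>carrier (W (i + \<delta>)). \<gamma> i \<frown> frag_of [v] - frag_of [u] \<frown> \<gamma> (i + 1) \<in> rel_frags i (i + 1 + \<delta>)"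
  shows "normal_family (nc_sym_alg K W ev) \<delta> (\<lambda>i. sym_class K W ev i (i + \<delta>) (\<gamma> i))"
proof -
  let ?A = "nc_sym_alg K W ev" and ?g = "\<lambda>i. sym_class K W ev i (i + \<delta>) (\<gamma> i)"
  let ?L = "\<lambda>i j. (\<lambda>d. mul ?A i (i + \<delta>) (j + \<delta>) (?g i) d) ` carrier (piece ?A (i + \<delta>) (j + \<delta>))"
  let ?R = "\<lambda>i j. (\<lambda>d. mul ?A i j (j + \<delta>) d (?g j)) ` carrier (piece ?A i j)"
  have g: "?g i \<in> carrier (piece ?A i (i + \<delta>))" for i
    using \<gamma> \<delta> by (simp add: carrier_sym)
  have less: "?L i j = ?R i j" if ij: "i < j" for i j
  proof -
    have L: "?L i j = (\<lambda>x. sym_class K W ev i (j + \<delta>) (\<gamma> i \<frown> x)) ` frags (i + \<delta>) (j + \<delta>)"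
      using \<delta> that by (simp add: carrier_sym image_image mul_sym_class[OF _ _ \<gamma>] cong: image_cong_simp)
    have R: "?R i j = (\<lambda>x. sym_class K W ev i (j + \<delta>) (x \<frown> \<gamma> j)) ` frags i j"
      using \<delta> that by (simp add: carrier_sym image_image mul_sym_class[OF _ _ _ \<gamma>] cong: image_cong_simp)
    have eq: "sym_class K W ev i (j + \<delta>) (\<gamma> i \<frown> x) = sym_class K W ev i (j + \<delta>) (c \<frown> \<gamma> j)"
      if "x \<in> frags (i + \<delta>) (j + \<delta>)" "c \<in> frags i j" "\<gamma> i \<frown> x - c \<frown> \<gamma> j \<in> rel_frags i (j + \<delta>)" for x c
      using that frag_append_closed[OF \<gamma> that(1)] frag_append_closed[OF that(2) \<gamma>] \<open>i < j\<close> \<delta>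
      by (intro sym_class_cong) auto
    show ?thesis unfolding L R
    proof (intro equalityI subsetI; elim imageE)
      fix s x assume x: "s = sym_class K W ev i (j + \<delta>) (\<gamma> i \<frown> x)" "x \<in> frags (i + \<delta>) (j + \<delta>)"
      obtain c where "c \<in> frags i j" "\<gamma> i \<frown> x - c \<frown> \<gamma> j \<in> rel_frags i (j + \<delta>)"
        using commute_right[OF _ ij x(2)] vector_right by blast
      then show "s \<in> (\<lambda>x. sym_class K W ev i (j + \<delta>) (x \<frown> \<gamma> j)) ` frags i j"
        using eq[OF x(2)] x(1) by blast
    next
      fix s x assume x: "s = sym_class K W ev i (j + \<delta>) (x \<frown> \<gamma> j)" "x \<in> frags i j"
      obtain c where c: "c \<in> frags (i + \<delta>) (j + \<delta>)" "x \<frown> \<gamma> j - \<gamma> i \<frown> c \<in> rel_frags i (j + \<delta>)"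
        using commute_left[OF _ ij x(2)] vector_left by blast
      have "\<gamma> i \<frown> c - x \<frown> \<gamma> j \<in> rel_frags i (j + \<delta>)"
        using rel_frags_closed(1)[OF _ c(2)] that \<delta> by simp
      then show "s \<in> (\<lambda>x. sym_class K W ev i (j + \<delta>) (\<gamma> i \<frown> x)) ` frags (i + \<delta>) (j + \<delta>)"
        using eq[OF c(1) x(2)] x(1) c(1) by blast
    qed
  qed
  have equal: "?L i i = ?R i i" for i
  proof -
    have L: "?L i i = (\<lambda>a. sym_class K W ev i (i + \<delta>) (frag_rsmult (W (i + \<delta> - 1)) a (\<gamma> i))) ` carrier (K (i + \<delta>))"
      using \<delta> by (simp add: carrier_sym image_image mul_sym_class_scalar[OF _ _ \<gamma>] cong: image_cong_simp)
    have R: "?R i i = (\<lambda>b. sym_class K W ev i (i + \<delta>) (frag_lsmult (W i) b (\<gamma> i))) ` carrier (K i)"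
      using \<delta> by (simp add: carrier_sym image_image mul_scalar_sym_class[OF _ _ \<gamma>] cong: image_cong_simp)
    have eq: "sym_class K W ev i (i + \<delta>) (frag_rsmult (W (i + \<delta> - 1)) a (\<gamma> i))
        = sym_class K W ev i (i + \<delta>) (frag_lsmult (W i) b (\<gamma> i))"
      if "a \<in> carrier (K (i + \<delta>))" "b \<in> carrier (K i)"
        "frag_rsmult (W (i + \<delta> - 1)) a (\<gamma> i) - frag_lsmult (W i) b (\<gamma> i) \<in> rel_frags i (i + \<delta>)" for a b
      using that frag_rsmult_closed[OF _ that(1) \<gamma>] frag_lsmult_closed[OF _ that(2) \<gamma>] \<delta>
      by (intro sym_class_cong) auto
    show ?thesis unfolding L R
      using scalar_right[of _ i] scalar_left[of _ i] eq by (auto simp: image_iff; metis)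
  qed
  \<comment> \<open>For \<open>j < i\<close> the variable factor comes from a zero piece, although
    the target piece may be nonzero. \<open>mul_sym_outside\<close> gives the zero class, and both
    images consist of exactly this class because pieces and classes are nonempty.\<close>
  have greater: "?L i j = ?R i j" if "j < i" for i j
  proof -
    have nonempty: "carrier (piece ?A k l) \<noteq> {}" for k l
    proof (cases "k = l")
      case True
      then show ?thesis using cring.cring_simprules(2)[OF cring_K[of l]] by (auto simp: carrier_sym)
    next
      case False
      then show ?thesis using frags_closed(1)[of k l] by (auto simp: carrier_sym)
    qed
    have nonempty': "s \<noteq> {}" if s: "s \<in> carrier (piece ?A k l)" for s k l
    proof (cases "k = l")
      case True
      then obtain a where "a \<in> carrier (K k)" "s = scalar_class k a" using s by (auto simp: carrier_sym)
      then show ?thesis using scalar_class_self by blast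
    next
      case False
      then obtain c where c: "c \<in> frags k l" "s = sym_class K W ev k l c"
        using s by (auto simp: carrier_sym)
      then show ?thesis using tens_in_sym_class[OF False c(1)] by blast
    qed
    let ?z = "R i (j + \<delta>) #>\<^bsub>tensor_piece K W i (j + \<delta>)\<^esub> \<one>\<^bsub>tensor_piece K W i (j + \<delta>)\<^esub>"
    have "?L i j = {?z}" "?R i j = {?z}"
      using that nonempty[unfolded ex_in_conv[symmetric]] nonempty'[OF g] nonempty' by (auto simp: mul_sym_outside image_iff)
    then show ?thesis by simp
  qed
  have "?L i j = ?R i j" for i j
    using less[of i j] equal[of i] greater[of j i] by (cases i j rule: linorder_cases) auto
  then show ?thesis unfolding normal_family_def using g by blast
qed

end
end

section \<open>Quadratic embeddings\<close>

text \<open>An element outside the image of \<open>K\<close> is independent of one, and two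
  independent elements span in dimension two.\<close>

lemma quadratic_embedding_decompose:
  assumes F: "field F" and K: "field K" and q: "quadratic_embedding K F \<iota> \<sigma>"
    and w: "w \<in> carrier F" "w \<notin> \<iota> ` carrier K" and u: "u \<in> carrier F"
  shows "\<exists>c\<in>\<iota> ` carrier K. \<exists>d\<in>\<iota> ` carrier K. u = c \<oplus>\<^bsub>F\<^esub> d \<otimes>\<^bsub>F\<^esub> w"
proof -
  interpret F: field F by fact
  interpret K: field K by fact
  let ?L = "\<iota> ` carrier K"
  have hom: "\<iota> \<in> ring_hom K F" and dim: "F.dimension 2 ?L (carrier F)"
    using q by (auto simp: quadratic_embedding_def)
  interpret h: ring_hom_ring K F \<iota>
    using hom by unfold_locales
  have L: "subfield ?L F"
    using h.img_is_subfield(2)[OF K.carrier_is_subfield] F.one_not_zero by blast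
  have one: "\<one>\<^bsub>F\<^esub> \<in> ?L" and sub: "?L \<subseteq> carrier F" and zero: "\<zero>\<^bsub>F\<^esub> \<in> ?L"
    using subfieldE(3)[OF L] imageI[of "\<one>\<^bsub>K\<^esub>" "carrier K" \<iota>] imageI[of "\<zero>\<^bsub>K\<^esub>" "carrier K" \<iota>] by auto
  have span1: "x \<in> F.Span ?L [\<one>\<^bsub>F\<^esub>] \<longleftrightarrow> x \<in> ?L" if "x \<in> carrier F" for x
    using sub by (auto simp: F.line_extension_mem_iff) 
  have "\<one>\<^bsub>F\<^esub> \<notin> F.Span ?L []" by simp
  then have "F.independent ?L [\<one>\<^bsub>F\<^esub>]" by (intro F.li_Cons) auto
  then have "F.independent ?L [w, \<one>\<^bsub>F\<^esub>]"
    using w span1[OF w(1)] by (intro F.li_Cons) auto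
  then have "F.Span ?L [w, \<one>\<^bsub>F\<^esub>] = carrier F"
    using F.independent_length_eq_dimension[OF L dim, of "[w, \<one>\<^bsub>F\<^esub>]"] w by auto
  then have "u \<in> F.line_extension ?L w (F.Span ?L [\<one>\<^bsub>F\<^esub>])"
    using u by simp
  then obtain d c where "d \<in> ?L" "c \<in> F.Span ?L [\<one>\<^bsub>F\<^esub>]" "u = d \<otimes>\<^bsub>F\<^esub> w \<oplus>\<^bsub>F\<^esub> c"
    unfolding F.line_extension_mem_iff by blast
  moreover from this have "c \<in> carrier F"
    using F.Span_in_carrier[OF sub, of "[\<one>\<^bsub>F\<^esub>]"] by auto
  ultimately show ?thesis
    using span1 sub w F.a_comm by (metis F.m_closed subset_iff)
qed

text \<open>The generator \<sigma> sends \<open>w\<close> to its negative: the square of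
  \<open>w\<close> is fixed, so \<sigma> w is \<open>w\<close> or its negative, and fixing
  \<open>w\<close> would make \<sigma> the identity on all of F. Hence the trace kills the
  \<open>w\<close> part and doubles \<open>\<iota> a\<close>.\<close>

lemma half_trace_decomposed:
  assumes F: "field F" and K: "field K" and char: "\<one>\<^bsub>K\<^esub> \<oplus>\<^bsub>K\<^esub> \<one>\<^bsub>K\<^esub> \<noteq> \<zero>\<^bsub>K\<^esub>"
    and q: "quadratic_embedding K F \<iota> \<sigma>"
    and w: "w \<in> carrier F" "w \<notin> \<iota> ` carrier K" "w \<otimes>\<^bsub>F\<^esub> w \<in> \<iota> ` carrier K"
    and ab: "a \<in> carrier K" "b \<in> carrier K"
  shows "half_trace K F \<iota> \<sigma> (\<iota> a \<oplus>\<^bsub>F\<^esub> \<iota> b \<otimes>\<^bsub>F\<^esub> w) = a"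
proof -
  interpret F: field F by fact
  interpret K: field K by fact
  have hom: "\<iota> \<in> ring_hom K F" using q by (auto simp: quadratic_embedding_def)
  interpret h: ring_hom_ring K F \<iota> using hom by unfold_locales
  have inj: "inj_on \<iota> (carrier K)"
    using non_trivial_field_hom_is_inj[OF hom K F] .
  have "\<sigma> \<in> galois_group F (\<iota> ` carrier K)" and nontrivial: "\<sigma> \<noteq> restrict id (carrier F)"
    using q by (auto simp: quadratic_embedding_def)
  then have \<sigma>: "\<sigma> \<in> ring_hom F F" "\<sigma> \<in> extensional (carrier F)" and fixes_L: "\<And>x. x \<in> \<iota> ` carrier K \<Longrightarrow> \<sigma> x = x"
    by (auto simp: galois_group_def ring_iso_def)
  have \<sigma>w: "\<sigma> w \<in> carrier F" using \<sigma>(1) w(1) by (rule ring_hom_closed)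
  have "\<sigma> w \<otimes>\<^bsub>F\<^esub> \<sigma> w = w \<otimes>\<^bsub>F\<^esub> w"
    using ring_hom_mult[OF \<sigma>(1) w(1) w(1)] fixes_L[OF w(3)] by simp
  then have "(\<sigma> w \<ominus>\<^bsub>F\<^esub> w) \<otimes>\<^bsub>F\<^esub> (\<sigma> w \<oplus>\<^bsub>F\<^esub> w) = \<zero>\<^bsub>F\<^esub>"
    using \<sigma>w w(1) by algebra
  then have "\<sigma> w \<ominus>\<^bsub>F\<^esub> w = \<zero>\<^bsub>F\<^esub> \<or> \<sigma> w \<oplus>\<^bsub>F\<^esub> w = \<zero>\<^bsub>F\<^esub>"
    using \<sigma>w w(1) by (simp add: F.integral_iff)
  moreover have "\<sigma> w \<ominus>\<^bsub>F\<^esub> w \<noteq> \<zero>\<^bsub>F\<^esub>"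
  proof
    assume "\<sigma> w \<ominus>\<^bsub>F\<^esub> w = \<zero>\<^bsub>F\<^esub>"
    then have eq: "\<sigma> w = w" using \<sigma>w w(1) by simp
    have "\<sigma> u = u" if u: "u \<in> carrier F" for u
    proof -
      obtain c d where cd: "c \<in> \<iota> ` carrier K" "d \<in> \<iota> ` carrier K" "u = c \<oplus>\<^bsub>F\<^esub> d \<otimes>\<^bsub>F\<^esub> w"
        using quadratic_embedding_decompose[OF F K q w(1,2) u] by blast
      then have "c \<in> carrier F" "d \<in> carrier F" by auto
      then show ?thesis
        using cd w(1) fixes_L[OF cd(1)] fixes_L[OF cd(2)] eq ring_hom_add[OF \<sigma>(1)] ring_hom_mult[OF \<sigma>(1)] by simp
    qed
    then have "\<sigma> = restrict id (carrier F)"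
      using \<sigma>(2) by (auto simp: extensional_def)
    then show False using nontrivial by simp
  qed
  ultimately have neg: "\<sigma> w \<oplus>\<^bsub>F\<^esub> w = \<zero>\<^bsub>F\<^esub>" by simp
  have A: "\<iota> a \<in> carrier F" "\<iota> b \<in> carrier F" using ab by auto
  \<comment> \<open>Two stays nonzero in F because \<iota> is injective; this is where the
    characteristic enters.\<close>
  define two where "two = \<one>\<^bsub>F\<^esub> \<oplus>\<^bsub>F\<^esub> \<one>\<^bsub>F\<^esub>"
  have "two = \<iota> (\<one>\<^bsub>K\<^esub> \<oplus>\<^bsub>K\<^esub> \<one>\<^bsub>K\<^esub>)"
    by (simp add: two_def)
  then have two: "two \<noteq> \<zero>\<^bsub>F\<^esub>" "two \<in> carrier F"
    using inj char inj_onD[OF inj, of "\<one>\<^bsub>K\<^esub> \<oplus>\<^bsub>K\<^esub> \<one>\<^bsub>K\<^esub>" "\<zero>\<^bsub>K\<^esub>"] by auto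
  have "\<sigma> (\<iota> a \<oplus>\<^bsub>F\<^esub> \<iota> b \<otimes>\<^bsub>F\<^esub> w) = \<iota> a \<oplus>\<^bsub>F\<^esub> \<iota> b \<otimes>\<^bsub>F\<^esub> \<sigma> w"
    using A w(1) fixes_L ab ring_hom_add[OF \<sigma>(1)] ring_hom_mult[OF \<sigma>(1)] by simp
  then have "(\<iota> a \<oplus>\<^bsub>F\<^esub> \<iota> b \<otimes>\<^bsub>F\<^esub> w) \<oplus>\<^bsub>F\<^esub> \<sigma> (\<iota> a \<oplus>\<^bsub>F\<^esub> \<iota> b \<otimes>\<^bsub>F\<^esub> w)
      = two \<otimes>\<^bsub>F\<^esub> \<iota> a \<oplus>\<^bsub>F\<^esub> \<iota> b \<otimes>\<^bsub>F\<^esub> (\<sigma> w \<oplus>\<^bsub>F\<^esub> w)"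
    using A w(1) \<sigma>w unfolding two_def by algebra
  also have "\<dots> = two \<otimes>\<^bsub>F\<^esub> \<iota> a" using neg A two by simp
  finally have "inv\<^bsub>F\<^esub> two \<otimes>\<^bsub>F\<^esub> ((\<iota> a \<oplus>\<^bsub>F\<^esub> \<iota> b \<otimes>\<^bsub>F\<^esub> w) \<oplus>\<^bsub>F\<^esub> \<sigma> (\<iota> a \<oplus>\<^bsub>F\<^esub> \<iota> b \<otimes>\<^bsub>F\<^esub> w)) = \<iota> a"
    using two A F.Units_l_inv[of two] F.Units_inv_closed[of two] by (simp add: F.field_Units F.m_assoc[symmetric])
  then show ?thesis
    unfolding half_trace_def two_def[symmetric] using inv_into_f_f[OF inj ab(1)] by simp
qed

section \<open>Tensors over a quadratic extension\<close>

text \<open>Congruence modulo a subgroup \<open>N\<close>, set up for chains of congruences between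
  representatives. It is instantiated with \<open>rel_frags i j\<close>.\<close>

locale additive_relation =
  fixes N :: "'b::ab_group_add set"
  assumes N_zero: "0 \<in> N" and N_diff: "x \<in> N \<Longrightarrow> y \<in> N \<Longrightarrow> x - y \<in> N"
begin

definition eqv :: "'b \<Rightarrow> 'b \<Rightarrow> bool" (infix \<open>\<asymp>\<close> 50) where
  "x \<asymp> y \<longleftrightarrow> x - y \<in> N"

lemma N_uminus: "x \<in> N \<Longrightarrow> - x \<in> N"
  using N_diff[OF N_zero] by simp

lemma N_add: "x \<in> N \<Longrightarrow> y \<in> N \<Longrightarrow> x + y \<in> N"
  using N_diff[OF _ N_uminus] by fastforce

lemma eqv_refl [simp]: "x \<asymp> x"
  by (simp add: eqv_def N_zero)

lemma eqv_sym: "x \<asymp> y \<Longrightarrow> y \<asymp> x"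
  using N_uminus[of "x - y"] by (simp add: eqv_def)

lemma eqv_trans [trans]: "x \<asymp> y \<Longrightarrow> y \<asymp> z \<Longrightarrow> x \<asymp> z"
  using N_add[of "x - y" "y - z"] by (simp add: eqv_def)

lemma eqv_add: "x \<asymp> y \<Longrightarrow> x' \<asymp> y' \<Longrightarrow> x + x' \<asymp> y + y'"
  using N_add[of "x - y" "x' - y'"] by (simp add: eqv_def algebra_simps)

end

text \<open>An axiomatic stand-in for F \<otimes> F over the subfield \<open>A\<close>:
  \<open>S s t\<close> represents s \<otimes> t up to the congruence, so that no tensor product has
  to be formed. The last axiom says that one and \<alpha> span F over \<open>A\<close>.\<close>

locale quadratic_pairs = field F + additive_relation N
  for F (structure) and N :: "'b::ab_group_add set" +
  fixes S :: "'a \<Rightarrow> 'a \<Rightarrow> 'b" and A :: "'a set" and \<alpha> :: 'a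
  assumes A_carrier: "A \<subseteq> carrier F" and \<alpha>: "\<alpha> \<in> carrier F" "\<alpha> \<otimes> \<alpha> \<in> A"
    and add_left: "\<lbrakk>s \<in> carrier F; s' \<in> carrier F; t \<in> carrier F\<rbrakk> \<Longrightarrow> S (s \<oplus> s') t \<asymp> S s t + S s' t"
    and add_right: "\<lbrakk>s \<in> carrier F; t \<in> carrier F; t' \<in> carrier F\<rbrakk> \<Longrightarrow> S s (t \<oplus> t') \<asymp> S s t + S s t'"
    and balanced: "\<lbrakk>s \<in> carrier F; a \<in> A; t \<in> carrier F\<rbrakk> \<Longrightarrow> S (s \<otimes> a) t \<asymp> S s (a \<otimes> t)"
    and decompose: "u \<in> carrier F \<Longrightarrow> \<exists>c\<in>A. \<exists>d\<in>A. u = c \<oplus> d \<otimes> \<alpha>"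
begin

text \<open>\<open>\<alpha> \<otimes> 1 + 1 \<otimes> \<alpha>\<close> is annihilated by \<open>\<alpha> \<otimes> 1 - 1 \<otimes> \<alpha>\<close>, hence commutes with \<open>F\<close>.\<close>

lemma trace_tensor_central:
  assumes t: "t \<in> carrier F" and u: "u \<in> carrier F"
  shows "S (t \<otimes> \<alpha>) u + S t (\<alpha> \<otimes> u) \<asymp> S (t \<otimes> u \<otimes> \<alpha>) \<one> + S (t \<otimes> u) \<alpha>"
proof -
  obtain c d where cd: "c \<in> A" "d \<in> A" and u_eq: "u = c \<oplus> d \<otimes> \<alpha>" using decompose[OF u] by blast
  have cl: "c \<in> carrier F" "d \<in> carrier F" using cd A_carrier by auto
  have "S (t \<otimes> \<alpha>) u \<asymp> S (t \<otimes> \<alpha>) (c \<otimes> \<one>) + S (t \<otimes> \<alpha>) (d \<otimes> \<alpha>)"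
    using add_right[of "t \<otimes> \<alpha>" c "d \<otimes> \<alpha>"] t cl \<alpha> by (simp add: u_eq)
  also have "\<dots> \<asymp> S (t \<otimes> \<alpha> \<otimes> c) \<one> + S (t \<otimes> \<alpha> \<otimes> d) \<alpha>"
    using t cl cd \<alpha> by (intro eqv_add eqv_sym[OF balanced]) auto
  finally have 1: "S (t \<otimes> \<alpha>) u \<asymp> S (t \<otimes> \<alpha> \<otimes> c) \<one> + S (t \<otimes> \<alpha> \<otimes> d) \<alpha>" .
  \<comment> \<open>The square of \<alpha> lies in \<open>A\<close> and crosses the tensor sign, as
    do \<open>c\<close> and \<open>d\<close>.\<close>
  have "\<alpha> \<otimes> u = c \<otimes> \<alpha> \<oplus> (\<alpha> \<otimes> \<alpha>) \<otimes> (d \<otimes> \<one>)"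
    unfolding u_eq using cl \<alpha> by algebra
  then have "S t (\<alpha> \<otimes> u) \<asymp> S t (c \<otimes> \<alpha>) + S t ((\<alpha> \<otimes> \<alpha>) \<otimes> (d \<otimes> \<one>))"
    using add_right[of t "c \<otimes> \<alpha>" "(\<alpha> \<otimes> \<alpha>) \<otimes> (d \<otimes> \<one>)"] t cl \<alpha> by simp
  also have "\<dots> \<asymp> S (t \<otimes> c) \<alpha> + S (t \<otimes> (\<alpha> \<otimes> \<alpha>)) (d \<otimes> \<one>)"
    using t cl cd \<alpha> by (intro eqv_add eqv_sym[OF balanced]) auto
  also have "\<dots> \<asymp> S (t \<otimes> c) \<alpha> + S (t \<otimes> (\<alpha> \<otimes> \<alpha>) \<otimes> d) \<one>"
    using t cl cd \<alpha> by (intro eqv_add eqv_sym[OF balanced]) auto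
  finally have 2: "S t (\<alpha> \<otimes> u) \<asymp> S (t \<otimes> c) \<alpha> + S (t \<otimes> (\<alpha> \<otimes> \<alpha>) \<otimes> d) \<one>" .
  have "t \<otimes> u \<otimes> \<alpha> = t \<otimes> \<alpha> \<otimes> c \<oplus> t \<otimes> (\<alpha> \<otimes> \<alpha>) \<otimes> d" "t \<otimes> u = t \<otimes> c \<oplus> t \<otimes> \<alpha> \<otimes> d"
    unfolding u_eq using cl \<alpha> t by algebra+
  then have 3: "S (t \<otimes> u \<otimes> \<alpha>) \<one> + S (t \<otimes> u) \<alpha> \<asymp>
      (S (t \<otimes> \<alpha> \<otimes> c) \<one> + S (t \<otimes> (\<alpha> \<otimes> \<alpha>) \<otimes> d) \<one>) + (S (t \<otimes> c) \<alpha> + S (t \<otimes> \<alpha> \<otimes> d) \<alpha>)"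
    using cl \<alpha> t by (auto intro!: eqv_add add_left)
  show ?thesis
    using eqv_trans[OF eqv_add[OF 1 2]] eqv_sym[OF 3] by (simp add: ac_simps)
qed

end

text \<open>The analogue for F \<otimes> F \<otimes> F over \<open>A\<close> and then
  \<open>B\<close>. Since \<open>a\<^sub>0\<close> and \<open>b\<^sub>0\<close> invert the squares,
  \<open>\<alpha> \<otimes> a\<^sub>0\<close> is the inverse of \<alpha>, and \<open>euler1\<close>,
  \<open>euler2\<close> say that q_i u and s q_(i+1) vanish. The four decompositions reflect that
  each root lies outside both subfields.\<close>

locale quadratic_triples = field F + additive_relation N
  for F (structure) and N :: "'b::ab_group_add set" +
  fixes T :: "'a \<Rightarrow> 'a \<Rightarrow> 'a \<Rightarrow> 'b" and A B :: "'a set" and \<alpha> \<beta> a\<^sub>0 b\<^sub>0 :: 'a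
  assumes AB_carrier: "A \<subseteq> carrier F" "B \<subseteq> carrier F"
    and roots: "\<alpha> \<in> carrier F" "\<beta> \<in> carrier F" "\<alpha> \<otimes> \<alpha> \<in> A" "\<beta> \<otimes> \<beta> \<in> B"
    and inverses: "a\<^sub>0 \<in> A" "b\<^sub>0 \<in> B" "\<alpha> \<otimes> \<alpha> \<otimes> a\<^sub>0 = \<one>" "\<beta> \<otimes> \<beta> \<otimes> b\<^sub>0 = \<one>"
    and add1: "\<lbrakk>s \<in> carrier F; s' \<in> carrier F; t \<in> carrier F; u \<in> carrier F\<rbrakk> \<Longrightarrow>
      T (s \<oplus> s') t u \<asymp> T s t u + T s' t u"
    and add2: "\<lbrakk>s \<in> carrier F; t \<in> carrier F; t' \<in> carrier F; u \<in> carrier F\<rbrakk> \<Longrightarrow>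
      T s (t \<oplus> t') u \<asymp> T s t u + T s t' u"
    and add3: "\<lbrakk>s \<in> carrier F; t \<in> carrier F; u \<in> carrier F; u' \<in> carrier F\<rbrakk> \<Longrightarrow>
      T s t (u \<oplus> u') \<asymp> T s t u + T s t u'"
    and balanced1: "\<lbrakk>s \<in> carrier F; a \<in> A; t \<in> carrier F; u \<in> carrier F\<rbrakk> \<Longrightarrow>
      T (s \<otimes> a) t u \<asymp> T s (a \<otimes> t) u"
    and balanced2: "\<lbrakk>s \<in> carrier F; b \<in> B; t \<in> carrier F; u \<in> carrier F\<rbrakk> \<Longrightarrow>
      T s (t \<otimes> b) u \<asymp> T s t (b \<otimes> u)"
    and decompose: "u \<in> carrier F \<Longrightarrow> \<exists>c\<in>A. \<exists>d\<in>A. u = c \<oplus> d \<otimes> \<alpha>"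
      "u \<in> carrier F \<Longrightarrow> \<exists>c\<in>A. \<exists>d\<in>A. u = c \<oplus> d \<otimes> \<beta>"
      "u \<in> carrier F \<Longrightarrow> \<exists>c\<in>B. \<exists>d\<in>B. u = c \<oplus> d \<otimes> \<alpha>"
      "u \<in> carrier F \<Longrightarrow> \<exists>c\<in>B. \<exists>d\<in>B. u = c \<oplus> d \<otimes> \<beta>"
    and euler1: "u \<in> carrier F \<Longrightarrow> T \<one> \<one> u + T \<alpha> (\<alpha> \<otimes> a\<^sub>0) u \<asymp> 0"
    and euler2: "s \<in> carrier F \<Longrightarrow> T s \<one> \<one> + T s \<beta> (\<beta> \<otimes> b\<^sub>0) \<asymp> 0"
begin

lemma inverses_closed: "a\<^sub>0 \<in> carrier F" "b\<^sub>0 \<in> carrier F"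
  using inverses AB_carrier by auto

text \<open>The identity \<alpha> \<otimes> 1 - 1 \<otimes> \<alpha>' = b g of the overview,
  inserted between \<open>t\<close> and \<open>u\<close>, with g the trace tensor of \<beta>. The
  element \<open>v\<close> is \<alpha>' u; its equation is stated without subtraction so that
  \<open>add3\<close> applies.\<close>

lemma root_split:
  assumes "s \<in> carrier F" "t \<in> carrier F" "u \<in> carrier F" "a \<in> B" "b \<in> B" "\<alpha> = a \<oplus> b \<otimes> \<beta>"
    and v: "v \<in> carrier F" "a \<otimes> u = v \<oplus> \<beta> \<otimes> (b \<otimes> u)"
  shows "T s (t \<otimes> \<alpha>) u \<asymp>
    T s t v + (T s (t \<otimes> \<beta>) (b \<otimes> u) + T s t (\<beta> \<otimes> (b \<otimes> u)))"
proof -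
  have cl: "a \<in> carrier F" "b \<in> carrier F" using assms AB_carrier by auto
  have "t \<otimes> \<alpha> = t \<otimes> a \<oplus> t \<otimes> \<beta> \<otimes> b"
    unfolding assms(6) using cl assms(2) roots by algebra
  then have "T s (t \<otimes> \<alpha>) u \<asymp> T s (t \<otimes> a) u + T s (t \<otimes> \<beta> \<otimes> b) u"
    using assms cl roots add2[of s "t \<otimes> a" "t \<otimes> \<beta> \<otimes> b" u] by simp
  also have "\<dots> \<asymp> T s t (a \<otimes> u) + T s (t \<otimes> \<beta>) (b \<otimes> u)"
    using assms cl roots by (intro eqv_add balanced2) auto
  also have "\<dots> \<asymp> (T s t v + T s t (\<beta> \<otimes> (b \<otimes> u))) + T s (t \<otimes> \<beta>) (b \<otimes> u)"
    unfolding v(2) using assms cl roots by (intro eqv_add add3 eqv_refl) auto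
  finally show ?thesis by (simp add: ac_simps)
qed

text \<open>A middle factor \<open>t\<close> in front of the trace tensor of \<beta> can be moved
  out to the left, at the cost of a multiple of the second Euler relation.\<close>

lemma trace_tensor_absorb:
  assumes s: "s \<in> carrier F" and t: "t \<in> carrier F"
  shows "\<exists>r\<in>carrier F. T s (t \<otimes> \<beta>) \<one> + T s t \<beta> \<asymp> T r \<beta> \<one> + T r \<one> \<beta>"
proof -
  \<comment> \<open>Dividing by \<beta> gives t = d \<beta>^-1 + c. So s \<otimes> t g equals s d (1
    \<otimes> 1 + \<beta>^-1 \<otimes> \<beta>) + s c g, where the first summand becomes the
    relation \<open>euler2\<close> once \<open>b\<^sub>0\<close> has crossed.\<close>
  obtain c d where cd: "d \<in> A" "c \<in> A" "t \<otimes> \<beta> = d \<oplus> c \<otimes> \<beta>"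
    using decompose(2)[of "t \<otimes> \<beta>"] t roots by auto
  then have cl: "c \<in> carrier F" "d \<in> carrier F" using AB_carrier by auto
  note b = inverses_closed(2)
  have "t = (t \<otimes> \<beta>) \<otimes> \<beta> \<otimes> b\<^sub>0" using inverses t roots b by (simp add: m_assoc)
  also have "\<dots> = d \<otimes> (\<beta> \<otimes> b\<^sub>0) \<oplus> c \<otimes> (\<beta> \<otimes> \<beta> \<otimes> b\<^sub>0)"
    unfolding cd(3) using cl roots b by algebra
  finally have t_eq: "t = d \<otimes> (\<beta> \<otimes> b\<^sub>0) \<oplus> c \<otimes> \<one>" using inverses by simp
  have "T s (t \<otimes> \<beta>) \<one> \<asymp> T s (d \<otimes> \<one>) \<one> + T s (c \<otimes> \<beta>) \<one>"
    unfolding cd(3) using s cl roots add2[of s d "c \<otimes> \<beta>" \<one>] by simp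
  also have "\<dots> \<asymp> T (s \<otimes> d) \<one> \<one> + T (s \<otimes> c) \<beta> \<one>"
    using s cl cd roots by (intro eqv_add eqv_sym[OF balanced1]) auto
  finally have 1: "T s (t \<otimes> \<beta>) \<one> \<asymp> T (s \<otimes> d) \<one> \<one> + T (s \<otimes> c) \<beta> \<one>" .
  have "T s t \<beta> \<asymp> T s (d \<otimes> (\<beta> \<otimes> b\<^sub>0)) \<beta> + T s (c \<otimes> \<one>) \<beta>"
    by (subst (1) t_eq, rule add2) (use s cl roots b in auto)
  also have "\<dots> \<asymp> T (s \<otimes> d) (\<beta> \<otimes> b\<^sub>0) \<beta> + T (s \<otimes> c) \<one> \<beta>"
    using s cl cd roots b by (intro eqv_add eqv_sym[OF balanced1]) auto
  also have "\<dots> \<asymp> T (s \<otimes> d) \<beta> (b\<^sub>0 \<otimes> \<beta>) + T (s \<otimes> c) \<one> \<beta>"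
    using s cl cd roots inverses by (intro eqv_add balanced2 eqv_refl) auto
  finally have 2: "T s t \<beta> \<asymp> T (s \<otimes> d) \<beta> (\<beta> \<otimes> b\<^sub>0) + T (s \<otimes> c) \<one> \<beta>"
    using m_comm[OF b roots(2)] by simp
  have "T s (t \<otimes> \<beta>) \<one> + T s t \<beta> \<asymp>
      (T (s \<otimes> d) \<one> \<one> + T (s \<otimes> d) \<beta> (\<beta> \<otimes> b\<^sub>0)) + (T (s \<otimes> c) \<beta> \<one> + T (s \<otimes> c) \<one> \<beta>)"
    using eqv_add[OF 1 2] by (simp add: ac_simps)
  also have "\<dots> \<asymp> 0 + (T (s \<otimes> c) \<beta> \<one> + T (s \<otimes> c) \<one> \<beta>)"
    using s cl by (intro eqv_add euler2 eqv_refl) auto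
  finally show ?thesis using s cl by auto
qed

text \<open>Splitting \<alpha> over \<open>B\<close> in both summands gives q_i v, a relation, plus
  two terms that contain the trace tensor of \<beta>. In these, \<open>trace_tensor_central\<close>
  carries \<open>x\<close> through the trace tensor, and \<open>trace_tensor_absorb\<close> moves
  the middle factor to the left.\<close>

lemma trace_tensor_commute:
  assumes u: "u \<in> carrier F"
  shows "\<exists>s\<in>carrier F. T \<alpha> \<one> u + T \<one> \<alpha> u \<asymp> T s \<beta> \<one> + T s \<one> \<beta>"
proof -
  obtain a b where ab: "a \<in> B" "b \<in> B" and \<alpha>_eq: "\<alpha> = a \<oplus> b \<otimes> \<beta>"
    using decompose(4)[OF roots(1)] by blast
  have cl: "a \<in> carrier F" "b \<in> carrier F" using ab AB_carrier by auto
  define x where "x = b \<otimes> u"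
  define v where "v = a \<otimes> u \<ominus> \<beta> \<otimes> x"
  have x: "x \<in> carrier F" and v: "v \<in> carrier F" using cl u roots by (auto simp: x_def v_def)
  have v_eq: "a \<otimes> u = v \<oplus> \<beta> \<otimes> (b \<otimes> u)"
    unfolding v_def x_def using cl u roots by algebra
  let ?H = "\<lambda>s t. T s (t \<otimes> \<beta>) x + T s t (\<beta> \<otimes> x)"
  have split: "T s (t \<otimes> \<alpha>) u \<asymp> T s t v + ?H s t" if "s \<in> carrier F" "t \<in> carrier F" for s t
    using root_split[OF that u ab \<alpha>_eq v v_eq] by (simp add: x_def)
  have H: "\<exists>r\<in>carrier F. ?H s t \<asymp> T r \<beta> \<one> + T r \<one> \<beta>" if s: "s \<in> carrier F" and t: "t \<in> carrier F" for s t
  proof -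
    interpret quadratic_pairs F N "T s" B \<beta>
      using s roots AB_carrier add2 add3 balanced2 decompose(4) by unfold_locales auto
    obtain r where "r \<in> carrier F" "T s (t \<otimes> x \<otimes> \<beta>) \<one> + T s (t \<otimes> x) \<beta> \<asymp> T r \<beta> \<one> + T r \<one> \<beta>"
      using trace_tensor_absorb[OF s, of "t \<otimes> x"] t x by auto
    then show ?thesis using trace_tensor_central[OF t x] eqv_trans by blast
  qed
  \<comment> \<open>The middle entry one of the first summand is written as \<alpha>^-1 \<alpha>, so
    that \<open>split\<close> applies to it with t = \<alpha>^-1. The two terms with
    \<open>v\<close> then form q_i v.\<close>
  have a0: "\<alpha> \<otimes> a\<^sub>0 \<in> carrier F" "\<alpha> \<otimes> a\<^sub>0 \<otimes> \<alpha> = \<one>"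
    using inverses roots inverses_closed(1) by (auto simp: m_ac)
  obtain r where r: "r \<in> carrier F" "?H \<one> \<one> \<asymp> T r \<beta> \<one> + T r \<one> \<beta>" using H[of \<one> \<one>] by auto
  obtain r' where r': "r' \<in> carrier F" "?H \<alpha> (\<alpha> \<otimes> a\<^sub>0) \<asymp> T r' \<beta> \<one> + T r' \<one> \<beta>"
    using H[OF roots(1) a0(1)] by auto
  have "T \<one> \<alpha> u \<asymp> T \<one> \<one> v + ?H \<one> \<one>" using split[of \<one> \<one>] roots by simp
  moreover have "T \<alpha> \<one> u \<asymp> T \<alpha> (\<alpha> \<otimes> a\<^sub>0) v + ?H \<alpha> (\<alpha> \<otimes> a\<^sub>0)"
    using split[OF roots(1) a0(1)] by (simp add: a0(2))
  ultimately have "T \<alpha> \<one> u + T \<one> \<alpha> u \<asymp>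
      (T \<alpha> (\<alpha> \<otimes> a\<^sub>0) v + ?H \<alpha> (\<alpha> \<otimes> a\<^sub>0)) + (T \<one> \<one> v + ?H \<one> \<one>)"
    by (rule eqv_add[rotated])
  also have "\<dots> = (T \<one> \<one> v + T \<alpha> (\<alpha> \<otimes> a\<^sub>0) v) + (?H \<one> \<one> + ?H \<alpha> (\<alpha> \<otimes> a\<^sub>0))"
    by (simp add: ac_simps)
  also have "\<dots> \<asymp> 0 + ((T r \<beta> \<one> + T r \<one> \<beta>) + (T r' \<beta> \<one> + T r' \<one> \<beta>))"
    by (intro eqv_add euler1 r r' v)
  also have "\<dots> = (T r \<beta> \<one> + T r' \<beta> \<one>) + (T r \<one> \<beta> + T r' \<one> \<beta>)"
    by (simp add: ac_simps)
  also have "\<dots> \<asymp> T (r \<oplus> r') \<beta> \<one> + T (r \<oplus> r') \<one> \<beta>"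
    using r r' roots by (intro eqv_add eqv_sym[OF add1]) auto
  finally show ?thesis using r r' by auto
qed

text \<open>Reversing the order of the factors and exchanging the two subfields and roots preserves
  the axioms, which yields the other inclusion. In the Euler relations the scalars
  \<open>a\<^sub>0\<close> and \<open>b\<^sub>0\<close> have to cross to the other factor.\<close>

lemma mirror: "quadratic_triples F N (\<lambda>s t u. T u t s) B A \<beta> \<alpha> b\<^sub>0 a\<^sub>0"
proof -
  note cl = inverses_closed
  have m: "\<alpha> \<otimes> a\<^sub>0 = a\<^sub>0 \<otimes> \<alpha>" "\<beta> \<otimes> b\<^sub>0 = b\<^sub>0 \<otimes> \<beta>" using cl roots m_comm by auto
  have 1: "T u \<one> \<one> + T u (\<beta> \<otimes> b\<^sub>0) \<beta> \<asymp> 0" if u: "u \<in> carrier F" for u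
  proof -
    have "T u \<one> \<one> + T u (\<beta> \<otimes> b\<^sub>0) \<beta> \<asymp> T u \<one> \<one> + T u \<beta> (b\<^sub>0 \<otimes> \<beta>)"
      using u roots inverses by (intro eqv_add balanced2 eqv_refl) auto
    also have "\<dots> \<asymp> 0" using euler2[OF u] m by simp
    finally show ?thesis .
  qed
  have 2: "T \<one> \<one> s + T (\<alpha> \<otimes> a\<^sub>0) \<alpha> s \<asymp> 0" if s: "s \<in> carrier F" for s
  proof -
    have "T \<one> \<one> s + T (\<alpha> \<otimes> a\<^sub>0) \<alpha> s \<asymp> T \<one> \<one> s + T \<alpha> (a\<^sub>0 \<otimes> \<alpha>) s"
      using s roots inverses by (intro eqv_add balanced1 eqv_refl) auto
    also have "\<dots> \<asymp> 0" using euler1[OF s] m by simp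
    finally show ?thesis .
  qed
  have b1: "T u t (s \<otimes> a) \<asymp> T u (a \<otimes> t) s" if "s \<in> carrier F" "a \<in> B" "t \<in> carrier F" "u \<in> carrier F" for s t u a
    using eqv_sym[OF balanced2[OF that(4,2,3,1)]] that AB_carrier m_comm by (metis subset_iff)
  have b2: "T u (t \<otimes> b) s \<asymp> T (b \<otimes> u) t s" if "s \<in> carrier F" "b \<in> A" "t \<in> carrier F" "u \<in> carrier F" for s t u b
    using eqv_sym[OF balanced1[OF that(4,2,3,1)]] that AB_carrier m_comm by (metis subset_iff)
  show ?thesis
    by (unfold_locales; (fact AB_carrier roots inverses decompose 1 2 b1 b2)?)
      (use add1 add2 add3 in auto)
qed

end

section \<open>Simple bimodules\<close>

lemma bimod_isoD:
  assumes "f \<in> bimod_iso K L M N"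
  shows "bij_betw f (carrier M) (carrier N)"
    "\<lbrakk>u \<in> carrier M; v \<in> carrier M\<rbrakk> \<Longrightarrow> f (u \<oplus>\<^bsub>M\<^esub> v) = f u \<oplus>\<^bsub>N\<^esub> f v"
    "\<lbrakk>a \<in> carrier K; v \<in> carrier M\<rbrakk> \<Longrightarrow> f (a \<odot>\<^bsub>M\<^esub> v) = a \<odot>\<^bsub>N\<^esub> f v"
    "\<lbrakk>b \<in> carrier L; v \<in> carrier M\<rbrakk> \<Longrightarrow> f (rsmult M v b) = rsmult N (f v) b"
  using assms by (auto simp: bimod_iso_def)

context sym_algebra begin

lemma additive_relation_rel_frags: "i \<noteq> j \<Longrightarrow> additive_relation (rel_frags i j)"
  using rel_frags_closed(3) rel_frags_null[OF _ null_zero] by unfold_locales auto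

text \<open>The hypothesis \<open>dual\<close> says that the endomorphism of v \<otimes> \<psi> + v'
  \<otimes> \<psi>' is the identity, which is left multiplication by one. Dual bases thus enter
  through their expansion formula.\<close>

lemma euler_pair:
  assumes "v \<in> carrier (W i)" "v' \<in> carrier (W i)" "\<psi> \<in> carrier (W (i + 1))" "\<psi>' \<in> carrier (W (i + 1))"
    and distinct: "[v, \<psi>] \<noteq> [v', \<psi>']"
    and ev_closed: "\<And>u. u \<in> carrier (W i) \<Longrightarrow> ev i u \<psi> \<in> carrier (K (i + 1))"
      "\<And>u. u \<in> carrier (W i) \<Longrightarrow> ev i u \<psi>' \<in> carrier (K (i + 1))"
    and dual: "\<And>u. u \<in> carrier (W i) \<Longrightarrow>
      rsmult (W i) v (ev i u \<psi>) \<oplus>\<^bsub>W i\<^esub> rsmult (W i) v' (ev i u \<psi>') = u"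
  shows "frag_of [v, \<psi>] + frag_of [v', \<psi>'] \<in> rel_frags i (i + 2)"
proof -
  interpret Wi: abelian_group "W i" by (rule abelian_W)
  let ?c = "frag_of [v, \<psi>] + frag_of [v', \<psi>']"
  \<comment> \<open>As the two words differ, the sum in \<open>tensor_endo\<close> runs over two
    keys with coefficient one.\<close>
  have keys: "Poly_Mapping.keys ?c = {[v, \<psi>], [v', \<psi>']}"
    using distinct by (auto simp: set_eq_iff in_keys_iff lookup_add lookup_single when_def)
  have lookup: "Poly_Mapping.lookup ?c [v, \<psi>] = 1" "Poly_Mapping.lookup ?c [v', \<psi>'] = 1"
    using distinct by (auto simp: lookup_add lookup_single when_def)
  have c: "?c \<in> frags i (i + 2)"
    using assms by (intro frags_closed) (auto simp: words_Cons words_Nil)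
  have "tensor_endo W ev i ?c u = \<one>\<^bsub>K i\<^esub> \<odot>\<^bsub>W i\<^esub> u" if u: "u \<in> carrier (W i)" for u
  proof -
    have r: "rsmult (W i) v (ev i u \<psi>) \<in> carrier (W i)" "rsmult (W i) v' (ev i u \<psi>') \<in> carrier (W i)"
      using rsm(1) ev_closed[OF u] assms by auto
    then have "tensor_endo W ev i ?c u
      = rsmult (W i) v (ev i u \<psi>) \<oplus>\<^bsub>W i\<^esub> rsmult (W i) v' (ev i u \<psi>')"
      unfolding tensor_endo_def keys using distinct lookup
      by (simp add: Wi.add.int_pow_1)
    then show ?thesis using dual[OF u] lsm(5)[OF u] by simp
  qed
  then have "tens i (i + 2) ?c \<in> euler_tensors K W ev i"
    unfolding euler_tensors_def using c cring.cring_simprules(6)[OF cring_K[of i]] by auto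
  then show ?thesis using euler_R c by (auto simp: rel_frags_def)
qed

end

text \<open>\<open>w i\<close> squares into the field of index \<open>i + 1\<close>, over which
  \<open>W i\<close> and \<open>W (i + 1)\<close> are tensored. So it stands for
  \<open>w\<^sub>1\<close> at even \<open>i\<close> and for \<open>w\<^sub>0\<close> at odd
  \<open>i\<close>.\<close>

locale simple_sym_algebra = sym_algebra K W ev + F: field F
  for K :: "int \<Rightarrow> 'a ring" and W :: "int \<Rightarrow> ('a, 'v) bimod" and ev and F :: "'f ring" +
  fixes \<iota> :: "int \<Rightarrow> 'a \<Rightarrow> 'f" and \<sigma> :: "int \<Rightarrow> 'f \<Rightarrow> 'f" and f :: "int \<Rightarrow> 'v \<Rightarrow> 'f" and w :: "int \<Rightarrow> 'f"
  assumes periodic: "K (i + 2) = K i" "\<iota> (i + 2) = \<iota> i"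
    and field_K: "field (K i)" and char_K: "\<one>\<^bsub>K i\<^esub> \<oplus>\<^bsub>K i\<^esub> \<one>\<^bsub>K i\<^esub> \<noteq> \<zero>\<^bsub>K i\<^esub>"
    and quadratic: "quadratic_embedding (K i) F (\<iota> i) (\<sigma> i)"
    and f: "f i \<in> bimod_iso (K i) (K (i + 1)) (W i) (field_bimod F (\<iota> i) (\<iota> (i + 1)))"
    and ev: "\<lbrakk>v \<in> carrier (W i); \<psi> \<in> carrier (W (i + 1))\<rbrakk> \<Longrightarrow>
      ev i v \<psi> = half_trace (K (i + 1)) F (\<iota> (i + 1)) (\<sigma> (i + 1)) (f i v \<otimes>\<^bsub>F\<^esub> f (i + 1) \<psi>)"
    and w: "w i \<in> carrier F" "w i \<otimes>\<^bsub>F\<^esub> w i \<in> \<iota> (i + 1) ` carrier (K (i + 1))"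
      "w i \<notin> \<iota> i ` carrier (K i)" "w i \<notin> \<iota> (i + 1) ` carrier (K (i + 1))"
begin

abbreviation "L i \<equiv> \<iota> i ` carrier (K i)"

definition p :: "int \<Rightarrow> 'f \<Rightarrow> 'v" where
  "p i = inv_into (carrier (W i)) (f i)"

lemma hom_\<iota>: "\<iota> i \<in> ring_hom (K i) F"
  using quadratic[of i] by (simp add: quadratic_embedding_def)

lemma \<iota>_closed: "a \<in> carrier (K i) \<Longrightarrow> \<iota> i a \<in> carrier F"
  using hom_\<iota> by (rule ring_hom_closed)

lemma bij_f: "bij_betw (f i) (carrier (W i)) (carrier F)"
  using bimod_isoD(1)[OF f[of i]] by (simp add: field_bimod_def)

lemma f_closed: "v \<in> carrier (W i) \<Longrightarrow> f i v \<in> carrier F"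
  using bij_betw_apply[OF bij_f] by blast

lemma p_closed: "s \<in> carrier F \<Longrightarrow> p i s \<in> carrier (W i)"
  unfolding p_def using bij_betw_apply[OF bij_betw_inv_into[OF bij_f]] by blast

lemma f_p: "s \<in> carrier F \<Longrightarrow> f i (p i s) = s"
  unfolding p_def using bij_betw_inv_into_right[OF bij_f] by blast

lemma p_f: "v \<in> carrier (W i) \<Longrightarrow> p i (f i v) = v"
  unfolding p_def using bij_betw_inv_into_left[OF bij_f] by blast

lemma p_add: "s \<in> carrier F \<Longrightarrow> t \<in> carrier F \<Longrightarrow> p i (s \<oplus>\<^bsub>F\<^esub> t) = p i s \<oplus>\<^bsub>W i\<^esub> p i t"
  using bimod_isoD(2)[OF f[of i] p_closed p_closed, of s t] p_f[OF add_closed_W[OF p_closed[of s i] p_closed[of t i]]]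
  by (simp add: field_bimod_def f_p)

lemma p_lsmult: "a \<in> carrier (K i) \<Longrightarrow> s \<in> carrier F \<Longrightarrow> p i (\<iota> i a \<otimes>\<^bsub>F\<^esub> s) = a \<odot>\<^bsub>W i\<^esub> p i s"
  using bimod_isoD(3)[OF f[of i] _ p_closed, of a s] p_f[OF lsm(1)[OF _ p_closed[of s i]], of a]
  by (simp add: field_bimod_def f_p)

lemma p_rsmult: "b \<in> carrier (K (i + 1)) \<Longrightarrow> s \<in> carrier F \<Longrightarrow>
    p i (s \<otimes>\<^bsub>F\<^esub> \<iota> (i + 1) b) = rsmult (W i) (p i s) b"
  using bimod_isoD(4)[OF f[of i] _ p_closed, of b s] p_f[OF rsm(1)[OF _ p_closed[of s i]], of b]
  by (simp add: field_bimod_def f_p)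

lemma L_carrier: "L i \<subseteq> carrier F"
  using \<iota>_closed by auto

lemma one_L: "\<one>\<^bsub>F\<^esub> \<in> L i"
  using ring_hom_one[OF hom_\<iota>[of i]] cring.cring_simprules(6)[OF cring_K[of i]] by (metis imageI)

lemma decompose_L:
  "x \<in> carrier F \<Longrightarrow> x \<notin> L i \<Longrightarrow> u \<in> carrier F \<Longrightarrow> \<exists>c\<in>L i. \<exists>d\<in>L i. u = c \<oplus>\<^bsub>F\<^esub> d \<otimes>\<^bsub>F\<^esub> x"
  using quadratic_embedding_decompose[OF F.field_axioms field_K quadratic] by blast

lemma square_inverse:
  obtains a where "a \<in> L (i + 1)" "w i \<otimes>\<^bsub>F\<^esub> w i \<otimes>\<^bsub>F\<^esub> a = \<one>\<^bsub>F\<^esub>"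
proof -
  interpret Ki: field "K (i + 1)" by (rule field_K)
  interpret h: ring_hom_ring "K (i + 1)" F "\<iota> (i + 1)"
    using hom_\<iota> by unfold_locales
  obtain c where c: "c \<in> carrier (K (i + 1))" "w i \<otimes>\<^bsub>F\<^esub> w i = \<iota> (i + 1) c"
    using w(2)[of i] by blast
  have "w i \<noteq> \<zero>\<^bsub>F\<^esub>" using w(4)[of i] imageI[of "\<zero>\<^bsub>K (i + 1)\<^esub>" _ "\<iota> (i + 1)"] by force
  then have "w i \<otimes>\<^bsub>F\<^esub> w i \<noteq> \<zero>\<^bsub>F\<^esub>" using w(1) F.integral_iff by simp
  then have "c \<noteq> \<zero>\<^bsub>K (i + 1)\<^esub>" using c by auto
  then have u: "c \<in> Units (K (i + 1))" using c Ki.field_Units by simp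
  then have "\<iota> (i + 1) c \<otimes>\<^bsub>F\<^esub> \<iota> (i + 1) (inv\<^bsub>K (i + 1)\<^esub> c) = \<one>\<^bsub>F\<^esub>"
    using h.hom_mult[of c "inv\<^bsub>K (i + 1)\<^esub> c"] c Ki.Units_inv_closed[OF u] by simp
  then show ?thesis using that[of "\<iota> (i + 1) (inv\<^bsub>K (i + 1)\<^esub> c)"] c(2) Ki.Units_inv_closed[OF u] by simp
qed

text \<open>For the pairing tr(ba) the right basis 1, w_i has the dual basis 1, w_i^-1, because the
  traces of w_i and of its inverse vanish. The inverse appears as w_i a.\<close>

lemma rel_euler:
  assumes a: "a \<in> L (i + 1)" and inv: "w i \<otimes>\<^bsub>F\<^esub> w i \<otimes>\<^bsub>F\<^esub> a = \<one>\<^bsub>F\<^esub>"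
  shows "frag_of [p i \<one>\<^bsub>F\<^esub>, p (i + 1) \<one>\<^bsub>F\<^esub>] + frag_of [p i (w i), p (i + 1) (w i \<otimes>\<^bsub>F\<^esub> a)]
    \<in> rel_frags i (i + 2)"
proof (rule euler_pair)
  have acl: "a \<in> carrier F" using a L_carrier by blast
  then have wa: "w i \<otimes>\<^bsub>F\<^esub> a \<in> carrier F" using w(1) by simp
  show "p i \<one>\<^bsub>F\<^esub> \<in> carrier (W i)" "p i (w i) \<in> carrier (W i)" "p (i + 1) \<one>\<^bsub>F\<^esub> \<in> carrier (W (i + 1))"
    "p (i + 1) (w i \<otimes>\<^bsub>F\<^esub> a) \<in> carrier (W (i + 1))"
    using p_closed w(1) wa by auto
  have "\<one>\<^bsub>F\<^esub> \<noteq> w i" using one_L w(3)[of i] by metis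
  then have "p i \<one>\<^bsub>F\<^esub> \<noteq> p i (w i)" using f_p[of "\<one>\<^bsub>F\<^esub>" i] f_p[of "w i" i] w(1) by auto
  then show "[p i \<one>\<^bsub>F\<^esub>, p (i + 1) \<one>\<^bsub>F\<^esub>] \<noteq> [p i (w i), p (i + 1) (w i \<otimes>\<^bsub>F\<^esub> a)]" by simp
  have *: "\<exists>c\<in>carrier (K (i + 1)). \<exists>d\<in>carrier (K (i + 1)). ev i u (p (i + 1) \<one>\<^bsub>F\<^esub>) = c \<and>
      ev i u (p (i + 1) (w i \<otimes>\<^bsub>F\<^esub> a)) = d \<and> f i u = \<iota> (i + 1) c \<oplus>\<^bsub>F\<^esub> w i \<otimes>\<^bsub>F\<^esub> \<iota> (i + 1) d"
    if u: "u \<in> carrier (W i)" for u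
  proof -
    interpret h: ring_hom_ring "K (i + 1)" F "\<iota> (i + 1)"
      using hom_\<iota> cring_K[of "i + 1"] by (intro ring_hom_ringI2) (auto simp: cring_def F.ring_axioms)
    obtain c d where cd: "c \<in> carrier (K (i + 1))" "d \<in> carrier (K (i + 1))"
      "f i u = \<iota> (i + 1) c \<oplus>\<^bsub>F\<^esub> \<iota> (i + 1) d \<otimes>\<^bsub>F\<^esub> w i"
      using decompose_L[OF w(1) w(4) f_closed[OF u]] by blast
    obtain a' where a': "a' \<in> carrier (K (i + 1))" "a = \<iota> (i + 1) a'" using a by blast
    note tr = half_trace_decomposed[OF F.field_axioms field_K char_K quadratic w(1,4,2)]
    \<comment> \<open>With f u = c + d w, the product with w a is d + c a w, and its half trace
      reads off the coordinate \<open>d\<close>.\<close>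
    have "f i u \<otimes>\<^bsub>F\<^esub> (w i \<otimes>\<^bsub>F\<^esub> a) = \<iota> (i + 1) c \<otimes>\<^bsub>F\<^esub> a \<otimes>\<^bsub>F\<^esub> w i \<oplus>\<^bsub>F\<^esub> \<iota> (i + 1) d \<otimes>\<^bsub>F\<^esub> (w i \<otimes>\<^bsub>F\<^esub> w i \<otimes>\<^bsub>F\<^esub> a)"
      unfolding cd(3) using acl w(1)[of i] \<iota>_closed[OF cd(1)] \<iota>_closed[OF cd(2)] by algebra
    also have "\<dots> = \<iota> (i + 1) d \<oplus>\<^bsub>F\<^esub> \<iota> (i + 1) (c \<otimes>\<^bsub>K (i + 1)\<^esub> a') \<otimes>\<^bsub>F\<^esub> w i"
      using acl w(1)[of i] \<iota>_closed[OF cd(1)] \<iota>_closed[OF cd(2)] h.hom_mult[OF cd(1) a'(1)] a' inv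
      by (simp add: F.a_comm)
    finally have "ev i u (p (i + 1) (w i \<otimes>\<^bsub>F\<^esub> a)) = d"
      using ev[OF u p_closed[OF wa]] tr[OF cd(2)] h.R.m_closed[OF cd(1) a'(1)] wa by (simp add: f_p)
    moreover have "ev i u (p (i + 1) \<one>\<^bsub>F\<^esub>) = c"
      using ev[OF u p_closed[of "\<one>\<^bsub>F\<^esub>"]] tr[OF cd(1,2)] f_closed[OF u] cd(3) by (simp add: f_p)
    moreover have "\<iota> (i + 1) d \<otimes>\<^bsub>F\<^esub> w i = w i \<otimes>\<^bsub>F\<^esub> \<iota> (i + 1) d"
      using w(1) \<iota>_closed[OF cd(2)] F.m_comm by simp
    ultimately show ?thesis using cd by metis
  qed
  fix u assume u: "u \<in> carrier (W i)"
  show "ev i u (p (i + 1) \<one>\<^bsub>F\<^esub>) \<in> carrier (K (i + 1))" "ev i u (p (i + 1) (w i \<otimes>\<^bsub>F\<^esub> a)) \<in> carrier (K (i + 1))"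
    using *[OF u] by auto
  obtain c d where cd: "c \<in> carrier (K (i + 1))" "d \<in> carrier (K (i + 1))" "ev i u (p (i + 1) \<one>\<^bsub>F\<^esub>) = c"
    "ev i u (p (i + 1) (w i \<otimes>\<^bsub>F\<^esub> a)) = d" "f i u = \<iota> (i + 1) c \<oplus>\<^bsub>F\<^esub> w i \<otimes>\<^bsub>F\<^esub> \<iota> (i + 1) d"
    using *[OF u] by blast
  have "u = p i (\<one>\<^bsub>F\<^esub> \<otimes>\<^bsub>F\<^esub> \<iota> (i + 1) c \<oplus>\<^bsub>F\<^esub> w i \<otimes>\<^bsub>F\<^esub> \<iota> (i + 1) d)"
    using p_f[OF u] cd(5) \<iota>_closed[OF cd(1)] by simp
  also have "\<dots> = rsmult (W i) (p i \<one>\<^bsub>F\<^esub>) c \<oplus>\<^bsub>W i\<^esub> rsmult (W i) (p i (w i)) d"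
    using p_rsmult[OF cd(1) F.one_closed] p_rsmult[OF cd(2) w(1)] w(1)[of i] \<iota>_closed[OF cd(1)] \<iota>_closed[OF cd(2)]
    by (simp add: p_add)
  finally show "rsmult (W i) (p i \<one>\<^bsub>F\<^esub>) (ev i u (p (i + 1) \<one>\<^bsub>F\<^esub>)) \<oplus>\<^bsub>W i\<^esub>
      rsmult (W i) (p i (w i)) (ev i u (p (i + 1) (w i \<otimes>\<^bsub>F\<^esub> a))) = u"
    using cd(3,4) by simp
qed

definition \<gamma> :: "int \<Rightarrow> 'v list \<Rightarrow>\<^sub>0 int" where
  "\<gamma> i = frag_of [p i (w i), p (i + 1) \<one>\<^bsub>F\<^esub>] + frag_of [p i \<one>\<^bsub>F\<^esub>, p (i + 1) (w i)]"

lemma \<gamma>_frags: "\<gamma> i \<in> frags i (i + 2)"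
  unfolding \<gamma>_def using w(1) p_closed by (intro frags_closed) (auto simp: words_Cons words_Nil)

lemma words_p:
  "s \<in> carrier F \<Longrightarrow> [p i s] \<in> words i (i + 1)"
  using p_closed by (simp add: words_Cons words_Nil)

lemma pairs: "quadratic_pairs F (rel_frags i (i + 2)) (\<lambda>s t. frag_of [p i s, p (i + 1) t]) (L (i + 1)) (w i)"
proof -
  interpret additive_relation "rel_frags i (i + 2)" by (rule additive_relation_rel_frags) simp
  have null: "x \<in> null i (i + 2) \<Longrightarrow> x \<in> rel_frags i (i + 2)" for x by (rule rel_frags_null) simp
  have ix: "i + 1 + 1 = i + 2" by simp
  show ?thesis
  proof (unfold_locales, goal_cases)
    case 1 show ?case using L_carrier .
  next
    case 2 show ?case by (rule w(1))
  next
    case 3 show ?case by (rule w(2))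
  next
    case (4 s s' t)
    then show ?case
      using null_additive[of "[]" i i "p i s" "p i s'" "[p (i + 1) t]" "i + 2"] words_p[of t "i + 1"]
      by (auto simp: eqv_def ix p_add p_closed words_Nil diff_diff_eq intro!: null)
  next
    case (5 s t t')
    then show ?case
      using null_additive[of "[p i s]" i "i + 1" "p (i + 1) t" "p (i + 1) t'" "[]" "i + 2"] words_p[of s i]
      by (auto simp: eqv_def ix p_add p_closed words_Nil diff_diff_eq intro!: null)
  next
    case (6 s a t)
    then obtain b where "b \<in> carrier (K (i + 1))" "a = \<iota> (i + 1) b" by blast
    then show ?case
      using 6 null_balanced[of "[]" i i "p i s" "p (i + 1) t" "[]" "i + 2" b]
      by (auto simp: eqv_def ix p_rsmult p_lsmult p_closed words_Nil intro!: null)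
  next
    case (7 u)
    then show ?case using decompose_L[OF w(1,4)] by blast
  qed
qed

lemma triples:
  assumes a: "a \<in> L (i + 1)" "w i \<otimes>\<^bsub>F\<^esub> w i \<otimes>\<^bsub>F\<^esub> a = \<one>\<^bsub>F\<^esub>"
    and b: "b \<in> L (i + 2)" "w (i + 1) \<otimes>\<^bsub>F\<^esub> w (i + 1) \<otimes>\<^bsub>F\<^esub> b = \<one>\<^bsub>F\<^esub>"
  shows "quadratic_triples F (rel_frags i (i + 3))
    (\<lambda>s t u. frag_of [p i s, p (i + 1) t, p (i + 2) u]) (L (i + 1)) (L (i + 2)) (w i) (w (i + 1)) a b"
proof -
  interpret additive_relation "rel_frags i (i + 3)" by (rule additive_relation_rel_frags) simp
  have null: "x \<in> null i (i + 3) \<Longrightarrow> x \<in> rel_frags i (i + 3)" for x by (rule rel_frags_null) simp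
  have ix: "i + 1 + 1 = i + 2" "i + 2 + 1 = i + 3" "i + 1 + 2 = i + 3" by simp_all
  have wd: "[p i s, p (i + 1) t] \<in> words i (i + 2)" "[p (i + 1) s, p (i + 2) t] \<in> words (i + 1) (i + 3)"
    "[p i s] \<in> words i (i + 1)" "[p (i + 2) t] \<in> words (i + 2) (i + 3)"
    if "s \<in> carrier F" "t \<in> carrier F" for s t
    using that p_closed by (auto simp: words_Cons words_Nil ix)
  show ?thesis
  proof (unfold_locales, goal_cases)
    case 1 show ?case using L_carrier .
  next
    case 2 show ?case using L_carrier .
  next
    case 3 show ?case by (rule w(1))
  next
    case 4 show ?case by (rule w(1))
  next
    case 5 show ?case by (rule w(2))
  next
    case 6 show ?case using w(2)[of "i + 1"] by (simp only: ix)
  next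
    case 7 show ?case by (rule a)
  next
    case 8 show ?case by (rule b)
  next
    case 9 show ?case by (rule a)
  next
    case 10 show ?case by (rule b)
  next
    case (11 s s' t u)
    then show ?case
      using null_additive[of "[]" i i "p i s" "p i s'" "[p (i + 1) t, p (i + 2) u]" "i + 3"] wd(2)[of t u]
      by (auto simp: eqv_def ix p_add p_closed words_Nil diff_diff_eq intro!: null)
  next
    case (12 s t t' u)
    then show ?case
      using null_additive[of "[p i s]" i "i + 1" "p (i + 1) t" "p (i + 1) t'" "[p (i + 2) u]" "i + 3"] wd(3,4)[of s u]
      by (auto simp: eqv_def ix p_add p_closed words_Nil diff_diff_eq intro!: null)
  next
    case (13 s t u u')
    then show ?case
      using null_additive[of "[p i s, p (i + 1) t]" i "i + 2" "p (i + 2) u" "p (i + 2) u'" "[]" "i + 3"] wd(1)[of s t]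
      by (auto simp: eqv_def ix p_add p_closed words_Nil diff_diff_eq intro!: null)
  next
    case (14 s x t u)
    then obtain c where "c \<in> carrier (K (i + 1))" "x = \<iota> (i + 1) c" by blast
    then show ?case
      using 14 null_balanced[of "[]" i i "p i s" "p (i + 1) t" "[p (i + 2) u]" "i + 3" c] wd(4)[of s u]
      by (auto simp: eqv_def ix p_rsmult p_lsmult p_closed words_Nil intro!: null)
  next
    case (15 s x t u)
    then obtain c where "c \<in> carrier (K (i + 2))" "x = \<iota> (i + 2) c" by blast
    then show ?case
      using 15 null_balanced[of "[p i s]" i "i + 1" "p (i + 1) t" "p (i + 2) u" "[]" "i + 3" c] wd(3)[of s u]
        p_rsmult[of c "i + 1" t] p_lsmult[of c "i + 2" u]
      by (auto simp: eqv_def ix p_closed words_Nil intro!: null)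
  next
    case (16 u)
    then show ?case using decompose_L[OF w(1,4)] by blast
  next
    case (17 u)
    then show ?case using decompose_L[OF w(1,3)] by blast
  next
    case (18 u)
    \<comment> \<open>By periodicity this is the subfield \<open>L i\<close>.\<close>
    have "w i \<notin> L (i + 2)" using w(3) periodic by simp
    from decompose_L[OF w(1) this] 18 show ?case by blast
  next
    case (19 u)
    have "w (i + 1) \<notin> L (i + 2)" using w(4)[of "i + 1"] by (simp only: ix not_False_eq_True)
    from decompose_L[OF w(1) this] 19 show ?case by blast
  next
    case (20 u)
    \<comment> \<open>The Euler relation in the first two places, followed by a letter; the next
      case has it in the last two places.\<close>
    then have "(frag_of [p i \<one>\<^bsub>F\<^esub>, p (i + 1) \<one>\<^bsub>F\<^esub>] + frag_of [p i (w i), p (i + 1) (w i \<otimes>\<^bsub>F\<^esub> a)]) \<frown> frag_of [p (i + 2) u]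
      \<in> rel_frags i (i + 3)"
      using rel_euler[OF a] wd(4)[of u u] by (intro rel_frags_append_left[where j = "i + 2"]) auto
    then show ?case by (simp add: eqv_def frag_append_left)
  next
    case (21 s)
    then have "frag_of [p i s] \<frown> (frag_of [p (i + 1) \<one>\<^bsub>F\<^esub>, p (i + 2) \<one>\<^bsub>F\<^esub>] +
        frag_of [p (i + 1) (w (i + 1)), p (i + 2) (w (i + 1) \<otimes>\<^bsub>F\<^esub> b)]) \<in> rel_frags i (i + 3)"
      using rel_euler[of b "i + 1", unfolded ix, OF b] wd(3)[of s s]
      by (intro rel_frags_append_right[where j = "i + 1"]) auto
    then show ?case by (simp add: eqv_def frag_append_right)
  qed
qed

theorem normal_simple: "normal_family (nc_sym_alg K W ev) 2 (\<lambda>i. sym_class K W ev i (i + 2) (\<gamma> i))"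
proof (rule normal_familyI)
  fix i
  interpret P: quadratic_pairs F "rel_frags i (i + 2)" "\<lambda>s t. frag_of [p i s, p (i + 1) t]" "L (i + 1)" "w i"
    by (rule pairs)
  obtain a where a: "a \<in> L (i + 1)" "w i \<otimes>\<^bsub>F\<^esub> w i \<otimes>\<^bsub>F\<^esub> a = \<one>\<^bsub>F\<^esub>" by (rule square_inverse)
  have ix: "i + 1 + 1 = i + 2" "i + 2 + 1 = i + 3" "i + 1 + 2 = i + 3" "i + 2 - 1 = i + 1" by simp_all
  obtain b where b: "b \<in> L (i + 2)" "w (i + 1) \<otimes>\<^bsub>F\<^esub> w (i + 1) \<otimes>\<^bsub>F\<^esub> b = \<one>\<^bsub>F\<^esub>"
    using square_inverse[of "i + 1"] unfolding ix by blast
  interpret T: quadratic_triples F "rel_frags i (i + 3)" "\<lambda>s t u. frag_of [p i s, p (i + 1) t, p (i + 2) u]"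
    "L (i + 1)" "L (i + 2)" "w i" "w (i + 1)" a b
    by (rule triples[OF a b])
  \<comment> \<open>The mirrored instance serves the inclusion in which a vector of
    \<open>W i\<close> is given and one of \<open>W (i + 2)\<close> is sought.\<close>
  interpret M: quadratic_triples F "rel_frags i (i + 3)" "\<lambda>s t u. frag_of [p i u, p (i + 1) t, p (i + 2) s]"
    "L (i + 2)" "L (i + 1)" "w (i + 1)" "w i" b a
    by (rule T.mirror)
  \<comment> \<open>The same scalar works on both sides: \<open>K (i + 2)\<close> is
    \<open>K i\<close>, acting through the same embedding, and the trace tensor commutes with
    F.\<close>
  have scalar: "frag_rsmult (W (i + 2 - 1)) c (\<gamma> i) - frag_lsmult (W i) c (\<gamma> i) \<in> rel_frags i (i + 2)"
    if c: "c \<in> carrier (K i)" for c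
  proof -
    have c': "c \<in> carrier (K (i + 1 + 1))" "\<iota> (i + 1 + 1) c = \<iota> i c" using c periodic by (simp_all add: ix)
    have u: "\<iota> i c \<in> carrier F" using \<iota>_closed[OF c] .
    have r: "rsmult (W (i + 1)) (p (i + 1) s) c = p (i + 1) (s \<otimes>\<^bsub>F\<^esub> \<iota> i c)" if "s \<in> carrier F" for s
      using p_rsmult[OF c'(1) that] c'(2) by simp
    show ?thesis unfolding ix
      using P.trace_tensor_central[OF F.one_closed u] u w(1)[of i]
      by (simp add: P.eqv_def \<gamma>_def r p_lsmult[OF c, symmetric])
  qed
  show "\<exists>d\<in>carrier (K i). frag_rsmult (W (i + 2 - 1)) c (\<gamma> i) - frag_lsmult (W i) d (\<gamma> i) \<in> rel_frags i (i + 2)"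
    if "c \<in> carrier (K (i + 2))" for c
    using scalar that periodic by auto
  show "\<exists>c\<in>carrier (K (i + 2)). frag_rsmult (W (i + 2 - 1)) c (\<gamma> i) - frag_lsmult (W i) d (\<gamma> i) \<in> rel_frags i (i + 2)"
    if "d \<in> carrier (K i)" for d
    using scalar that periodic by auto
  have append: "\<gamma> i \<frown> frag_of [p (i + 2) u] = frag_of [p i (w i), p (i + 1) \<one>\<^bsub>F\<^esub>, p (i + 2) u] +
      frag_of [p i \<one>\<^bsub>F\<^esub>, p (i + 1) (w i), p (i + 2) u]"
    "frag_of [p i s] \<frown> \<gamma> (i + 1) = frag_of [p i s, p (i + 1) (w (i + 1)), p (i + 2) \<one>\<^bsub>F\<^esub>] +
      frag_of [p i s, p (i + 1) \<one>\<^bsub>F\<^esub>, p (i + 2) (w (i + 1))]" for s u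
    by (simp_all add: \<gamma>_def frag_append_left frag_append_right ix)
  show "\<exists>s\<in>carrier (W i). \<gamma> i \<frown> frag_of [v] - frag_of [s] \<frown> \<gamma> (i + 1) \<in> rel_frags i (i + 1 + 2)"
    if v: "v \<in> carrier (W (i + 2))" for v
  proof -
    obtain s where "s \<in> carrier F" "\<gamma> i \<frown> frag_of [p (i + 2) (f (i + 2) v)] - frag_of [p i s] \<frown> \<gamma> (i + 1)
        \<in> rel_frags i (i + 3)"
      using T.trace_tensor_commute[OF f_closed[OF v]] unfolding T.eqv_def append by blast
    then show ?thesis using p_f[OF v] p_closed unfolding ix by auto
  qed
  show "\<exists>v\<in>carrier (W (i + 2)). \<gamma> i \<frown> frag_of [v] - frag_of [s] \<frown> \<gamma> (i + 1) \<in> rel_frags i (i + 1 + 2)"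
    if s: "s \<in> carrier (W i)" for s
  proof -
    obtain u where u: "u \<in> carrier F"
      "frag_of [p i (f i s), p (i + 1) \<one>\<^bsub>F\<^esub>, p (i + 2) (w (i + 1))] +
        frag_of [p i (f i s), p (i + 1) (w (i + 1)), p (i + 2) \<one>\<^bsub>F\<^esub>] -
        (frag_of [p i \<one>\<^bsub>F\<^esub>, p (i + 1) (w i), p (i + 2) u] + frag_of [p i (w i), p (i + 1) \<one>\<^bsub>F\<^esub>, p (i + 2) u])
        \<in> rel_frags i (i + 3)"
      using M.trace_tensor_commute[OF f_closed[OF s]] unfolding T.eqv_def by blast
    \<comment> \<open>The mirrored congruence comes with the opposite sign.\<close>
    then have "\<gamma> i \<frown> frag_of [p (i + 2) u] - frag_of [p i (f i s)] \<frown> \<gamma> (i + 1) \<in> rel_frags i (i + 3)"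
      using T.N_uminus[OF u(2)] unfolding append by (simp add: algebra_simps)
    then show ?thesis using p_f[OF s] p_closed[OF u(1)] unfolding ix by auto
  qed
qed (use \<gamma>_frags in auto)

end

section \<open>Non-simple bimodules\<close>

lemma right_basisD:
  assumes "field L" "bimodule K L M" "is_right_basis L M x y"
  shows "x \<in> carrier M" "y \<in> carrier M" "x \<noteq> y"
    "v \<in> carrier M \<Longrightarrow> \<exists>b\<in>carrier L. \<exists>c\<in>carrier L. v = rsmult M x b \<oplus>\<^bsub>M\<^esub> rsmult M y c"
proof -
  interpret V: vectorspace L "right_module M"
    using assms(1) bimodule_right[OF assms(2)] by (simp add: vectorspace_def)
  interpret M: abelian_group M by (rule bimodule_abelian_group[OF assms(2)])
  have basis: "V.basis {x, y}" and neq: "x \<noteq> y" using assms(3) by (auto simp: is_right_basis_def)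
  then show xy: "x \<in> carrier M" "y \<in> carrier M" and "x \<noteq> y" by (auto simp: V.basis_def)
  assume "v \<in> carrier M"
  then have "v \<in> V.span {x, y}" using basis by (simp add: V.basis_def)
  then obtain a where a: "a \<in> {x, y} \<rightarrow> carrier L" "v = V.lincomb a {x, y}"
    using V.finite_span[of "{x, y}"] xy by auto
  then have "v = a x \<odot>\<^bsub>right_module M\<^esub> x \<oplus>\<^bsub>right_module M\<^esub> a y \<odot>\<^bsub>right_module M\<^esub> y"
    using xy neq bimodule_rsmult(1)[OF assms(2)] unfolding V.lincomb_def by (simp add: M.r_zero)
  then show "\<exists>b\<in>carrier L. \<exists>c\<in>carrier L. v = rsmult M x b \<oplus>\<^bsub>M\<^esub> rsmult M y c"
    using a(1) by auto
qed

text \<open>The pairing laws hold at all indices, on either side of 0. Perfectness is recorded only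
  where \<open>W (i + 1)\<close> is the right dual of \<open>W i\<close>, that is for
  \<open>i \<ge> 0\<close>: there functionals are determined by their values.\<close>

locale dual_sequence = sym_algebra K W ev
  for K :: "int \<Rightarrow> 'a ring" and W :: "int \<Rightarrow> ('a, 'v) bimod" and ev +
  assumes periodic: "K (i + 2) = K i"
    and ev_closed: "\<lbrakk>v \<in> carrier (W i); \<psi> \<in> carrier (W (i + 1))\<rbrakk> \<Longrightarrow> ev i v \<psi> \<in> carrier (K (i + 1))"
    and ev_add_left: "\<lbrakk>v \<in> carrier (W i); v' \<in> carrier (W i); \<psi> \<in> carrier (W (i + 1))\<rbrakk> \<Longrightarrow>
      ev i (v \<oplus>\<^bsub>W i\<^esub> v') \<psi> = ev i v \<psi> \<oplus>\<^bsub>K (i + 1)\<^esub> ev i v' \<psi>"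
    and ev_add_right: "\<lbrakk>v \<in> carrier (W i); \<psi> \<in> carrier (W (i + 1)); \<psi>' \<in> carrier (W (i + 1))\<rbrakk> \<Longrightarrow>
      ev i v (\<psi> \<oplus>\<^bsub>W (i + 1)\<^esub> \<psi>') = ev i v \<psi> \<oplus>\<^bsub>K (i + 1)\<^esub> ev i v \<psi>'"
    and ev_rsmult: "\<lbrakk>v \<in> carrier (W i); \<psi> \<in> carrier (W (i + 1)); a \<in> carrier (K (i + 1))\<rbrakk> \<Longrightarrow>
      ev i (rsmult (W i) v a) \<psi> = ev i v \<psi> \<otimes>\<^bsub>K (i + 1)\<^esub> a"
    and ev_lsmult: "\<lbrakk>v \<in> carrier (W i); \<psi> \<in> carrier (W (i + 1)); a \<in> carrier (K (i + 1))\<rbrakk> \<Longrightarrow>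
      ev i v (a \<odot>\<^bsub>W (i + 1)\<^esub> \<psi>) = a \<otimes>\<^bsub>K (i + 1)\<^esub> ev i v \<psi>"
    and ev_middle: "\<lbrakk>v \<in> carrier (W i); \<psi> \<in> carrier (W (i + 1)); b \<in> carrier (K i)\<rbrakk> \<Longrightarrow>
      ev i (b \<odot>\<^bsub>W i\<^esub> v) \<psi> = ev i v (rsmult (W (i + 1)) \<psi> b)"
    and ev_separates: "\<lbrakk>0 \<le> i; \<psi> \<in> carrier (W (i + 1)); \<psi>' \<in> carrier (W (i + 1));
      \<And>v. v \<in> carrier (W i) \<Longrightarrow> ev i v \<psi> = ev i v \<psi>'\<rbrakk> \<Longrightarrow> \<psi> = \<psi>'"

lemma right_dualD:
  assumes "\<psi> \<in> carrier (right_dual K L W)"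
  shows "u \<in> carrier W \<Longrightarrow> v \<in> carrier W \<Longrightarrow> \<psi> (u \<oplus>\<^bsub>W\<^esub> v) = \<psi> u \<oplus>\<^bsub>L\<^esub> \<psi> v"
    "v \<in> carrier W \<Longrightarrow> a \<in> carrier L \<Longrightarrow> \<psi> (rsmult W v a) = \<psi> v \<otimes>\<^bsub>L\<^esub> a"
    "v \<in> carrier W \<Longrightarrow> \<psi> v \<in> carrier L"
  using assms by (auto simp: right_dual_def PiE_def Pi_def)

lemma left_dualD:
  assumes "\<phi> \<in> carrier (left_dual K L W)"
  shows "u \<in> carrier W \<Longrightarrow> v \<in> carrier W \<Longrightarrow> \<phi> (u \<oplus>\<^bsub>W\<^esub> v) = \<phi> u \<oplus>\<^bsub>K\<^esub> \<phi> v"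
    "v \<in> carrier W \<Longrightarrow> a \<in> carrier K \<Longrightarrow> \<phi> (a \<odot>\<^bsub>W\<^esub> v) = a \<otimes>\<^bsub>K\<^esub> \<phi> v"
    "v \<in> carrier W \<Longrightarrow> \<phi> v \<in> carrier K"
  using assms by (auto simp: left_dual_def PiE_def Pi_def)

text \<open>For \<open>i \<ge> 0\<close> the laws in the vector are linearity of functionals, and
  the laws in the functional come from the isomorphism with the right dual. For \<open>i < 0\<close>
  the roles are exchanged, \<open>W i\<close> being the left dual.\<close>

lemma dual_sequenceI:
  fixes K\<^sub>0 K\<^sub>1 :: "'a ring" and V :: "('a, 'v) bimod"
  assumes "iterated_duals K\<^sub>0 K\<^sub>1 V W ev"
  shows "dual_sequence (alt K\<^sub>0 K\<^sub>1) W ev"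
proof -
  define K where "K = alt K\<^sub>0 K\<^sub>1"
  have periodic: "K (i + 2) = K i" for i by (simp add: K_def alt_def)
  have bim: "bimodule (K i) (K (i + 1)) (W i)" for i
    using assms by (simp add: iterated_duals_def Let_def K_def)
  interpret bimodule_sequence K W by unfold_locales (rule bim)
  have ix: "i + 1 + 1 = i + 2" for i :: int by simp
  have right: "(\<lambda>\<psi>. \<lambda>v\<in>carrier (W i). ev i v \<psi>) \<in>
      bimod_iso (K (i + 1)) (K i) (W (i + 1)) (right_dual (K i) (K (i + 1)) (W i))" if "0 \<le> i" for i
    using assms that by (simp add: iterated_duals_def Let_def K_def)
  have left: "(\<lambda>v. \<lambda>\<psi>\<in>carrier (W (i + 1)). ev i v \<psi>) \<in>
      bimod_iso (K i) (K (i + 1)) (W i) (left_dual (K (i + 1)) (K i) (W (i + 1)))" if "\<not> 0 \<le> i" for i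
    using assms that by (simp add: iterated_duals_def Let_def K_def)
  have right_mem: "(\<lambda>v\<in>carrier (W i). ev i v \<psi>) \<in> carrier (right_dual (K i) (K (i + 1)) (W i))"
    if "0 \<le> i" "\<psi> \<in> carrier (W (i + 1))" for i \<psi>
    using bij_betw_apply[OF bimod_isoD(1)[OF right[OF that(1)]] that(2)] .
  have left_mem: "(\<lambda>\<psi>\<in>carrier (W (i + 1)). ev i v \<psi>) \<in> carrier (left_dual (K (i + 1)) (K i) (W (i + 1)))"
    if "\<not> 0 \<le> i" "v \<in> carrier (W i)" for i v
    using bij_betw_apply[OF bimod_isoD(1)[OF left[OF that(1)]] that(2)] .
  have lsmult_closed: "a \<odot>\<^bsub>W (i + 1)\<^esub> \<psi> \<in> carrier (W (i + 1))" if "a \<in> carrier (K (i + 1))" "\<psi> \<in> carrier (W (i + 1))" for a i \<psi>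
    using lsm(1) that .
  have rsmult_closed: "rsmult (W (i + 1)) \<psi> b \<in> carrier (W (i + 1))" if "b \<in> carrier (K i)" "\<psi> \<in> carrier (W (i + 1))" for b i \<psi>
    using rsm(1)[of b "i + 1" \<psi>] that periodic by (simp add: ix)
  have "dual_sequence K W ev"
  proof (unfold_locales, goal_cases)
    case (1 i) show ?case by (rule periodic)
  next
    case (2 v i \<psi>)
    then show ?case
      using right_dualD(3)[OF right_mem[of i \<psi>], of v] left_dualD(3)[OF left_mem[of i v], of \<psi>]
      by (cases "0 \<le> i") auto
  next
    case (3 v i v' \<psi>)
    show ?case
    proof (cases "0 \<le> i")
      case True
      then show ?thesis using right_dualD(1)[OF right_mem[OF True 3(3)] 3(1,2)] 3 add_closed_W[OF 3(1,2)] by simp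
    next
      case False
      from bimod_isoD(2)[OF left[OF False] 3(1,2)] show ?thesis
        using 3 by (auto simp: left_dual_def dest!: fun_cong[of _ _ \<psi>])
    qed
  next
    case (4 v i \<psi> \<psi>')
    show ?case
    proof (cases "0 \<le> i")
      case True
      from bimod_isoD(2)[OF right[OF True] 4(2,3)] show ?thesis
        using 4 by (auto simp: right_dual_def dest!: fun_cong[of _ _ v])
    next
      case False
      then show ?thesis using left_dualD(1)[OF left_mem[OF False 4(1)] 4(2,3)] 4 add_closed_W[OF 4(2,3)] by simp
    qed
  next
    case (5 v i \<psi> a)
    show ?case
    proof (cases "0 \<le> i")
      case True
      then show ?thesis using right_dualD(2)[OF right_mem[OF True 5(2)] 5(1,3)] 5 rsm(1)[OF 5(3,1)] by simp
    next
      case False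
      have cl: "ev i v \<psi> \<in> carrier (K (i + 1))"
        using left_dualD(3)[OF left_mem[OF False 5(1)] 5(2)] 5 by simp
      \<comment> \<open>The right action on the left dual multiplies values from the left;
        commutativity of the ring turns the product around.\<close>
      from bimod_isoD(4)[OF left[OF False] 5(3,1)] show ?thesis
        using 5 cring.cring_simprules(14)[OF cring_K cl 5(3)] by (auto simp: left_dual_def dest!: fun_cong[of _ _ \<psi>])
    qed
  next
    case (6 v i \<psi> a)
    show ?case
    proof (cases "0 \<le> i")
      case True
      from bimod_isoD(3)[OF right[OF True] 6(3,2)] show ?thesis
        using 6 by (auto simp: right_dual_def dest!: fun_cong[of _ _ v])
    next
      case False
      then show ?thesis using left_dualD(2)[OF left_mem[OF False 6(1)] 6(2,3)] 6 lsmult_closed[OF 6(3,2)] by simp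
    qed
  next
    case (7 v i \<psi> b)
    show ?case
    proof (cases "0 \<le> i")
      case True
      from bimod_isoD(4)[OF right[OF True] 7(3,2)] show ?thesis
        using 7 lsm(1)[OF 7(3,1)] by (auto simp: right_dual_def dest!: fun_cong[of _ _ v])
    next
      case False
      from bimod_isoD(3)[OF left[OF False] 7(3,1)] show ?thesis
        using 7 rsmult_closed[OF 7(3,2)] by (auto simp: left_dual_def dest!: fun_cong[of _ _ \<psi>])
    qed
  next
    case (8 i \<psi> \<psi>')
    then have "(\<lambda>v\<in>carrier (W i). ev i v \<psi>) = (\<lambda>v\<in>carrier (W i). ev i v \<psi>')" by auto
    then show ?case
      using bij_betw_imp_inj_on[OF bimod_isoD(1)[OF right[OF 8(1)]]] 8(2,3) by (auto dest: inj_onD)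
  qed
  then show ?thesis by (simp add: K_def)
qed

text \<open>In the application \<open>(h\<^sub>i, g\<^sub>i)\<close> is \<open>(x\<^sub>i, y\<^sub>i)\<close> for \<open>i\<close> even and \<open>(y\<^sub>i, x\<^sub>i)\<close> for \<open>i\<close> odd, which
  makes \<open>g\<^sub>i\<close> and \<open>g\<^sub>i\<^sub>+\<^sub>1\<close> orthogonal.\<close>

locale alternating_bases = dual_sequence K W ev
  for K :: "int \<Rightarrow> 'a ring" and W :: "int \<Rightarrow> ('a, 'v) bimod" and ev +
  fixes h g :: "int \<Rightarrow> 'v"
  assumes hg_carrier: "h i \<in> carrier (W i)" "g i \<in> carrier (W i)" and h_neq_g: "h i \<noteq> g i"
    and right_span: "v \<in> carrier (W i) \<Longrightarrow>
      \<exists>b\<in>carrier (K (i + 1)). \<exists>c\<in>carrier (K (i + 1)). v = rsmult (W i) (h i) b \<oplus>\<^bsub>W i\<^esub> rsmult (W i) (g i) c"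
    and pairing: "ev i (h i) (g (i + 1)) = \<one>\<^bsub>K (i + 1)\<^esub>" "ev i (g i) (h (i + 1)) = \<one>\<^bsub>K (i + 1)\<^esub>"
      "ev i (g i) (g (i + 1)) = \<zero>\<^bsub>K (i + 1)\<^esub>" "ev i (h i) (h (i + 1)) = \<zero>\<^bsub>K (i + 1)\<^esub>"
begin

text \<open>The first two clauses say that the left and right lines of g_i coincide, so it spans a
  sub-bimodule. The third gives a left expansion of every vector; at indices up to 0
  \<open>ev_separates\<close> does not supply it, and it is carried along in the induction.\<close>

definition normal_at :: "int \<Rightarrow> bool" where
  "normal_at i \<longleftrightarrow>
    (\<forall>a\<in>carrier (K i). \<exists>b\<in>carrier (K (i + 1)). a \<odot>\<^bsub>W i\<^esub> g i = rsmult (W i) (g i) b) \<and>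
    (\<forall>b\<in>carrier (K (i + 1)). \<exists>a\<in>carrier (K i). a \<odot>\<^bsub>W i\<^esub> g i = rsmult (W i) (g i) b) \<and>
    (\<forall>v\<in>carrier (W i). \<exists>a\<in>carrier (K i). \<exists>c\<in>carrier (K i). v = a \<odot>\<^bsub>W i\<^esub> h i \<oplus>\<^bsub>W i\<^esub> c \<odot>\<^bsub>W i\<^esub> g i)"

lemma normal_atD:
  assumes "normal_at i"
  shows "a \<in> carrier (K i) \<Longrightarrow> \<exists>b\<in>carrier (K (i + 1)). a \<odot>\<^bsub>W i\<^esub> g i = rsmult (W i) (g i) b"
    "b \<in> carrier (K (i + 1)) \<Longrightarrow> \<exists>a\<in>carrier (K i). a \<odot>\<^bsub>W i\<^esub> g i = rsmult (W i) (g i) b"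
    "v \<in> carrier (W i) \<Longrightarrow> \<exists>a\<in>carrier (K i). \<exists>c\<in>carrier (K i). v = a \<odot>\<^bsub>W i\<^esub> h i \<oplus>\<^bsub>W i\<^esub> c \<odot>\<^bsub>W i\<^esub> g i"
  using assms by (auto simp: normal_at_def)

lemma rsmult_closed: "\<psi> \<in> carrier (W (i + 1)) \<Longrightarrow> b \<in> carrier (K i) \<Longrightarrow> rsmult (W (i + 1)) \<psi> b \<in> carrier (W (i + 1))"
  using rsm(1)[of b "i + 1" \<psi>] periodic[of i] by (simp add: add.assoc)

lemma ev_comb_left:
  assumes "b \<in> carrier (K (i + 1))" "c \<in> carrier (K (i + 1))" "\<psi> \<in> carrier (W (i + 1))"
  shows "ev i (rsmult (W i) (h i) b \<oplus>\<^bsub>W i\<^esub> rsmult (W i) (g i) c) \<psi>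
    = ev i (h i) \<psi> \<otimes>\<^bsub>K (i + 1)\<^esub> b \<oplus>\<^bsub>K (i + 1)\<^esub> ev i (g i) \<psi> \<otimes>\<^bsub>K (i + 1)\<^esub> c"
  using assms hg_carrier by (simp add: ev_add_left ev_rsmult rsm(1))

lemma ev_comb_right:
  assumes "b \<in> carrier (K (i + 1))" "c \<in> carrier (K (i + 1))" "v \<in> carrier (W i)"
  shows "ev i v (b \<odot>\<^bsub>W (i + 1)\<^esub> h (i + 1) \<oplus>\<^bsub>W (i + 1)\<^esub> c \<odot>\<^bsub>W (i + 1)\<^esub> g (i + 1))
    = b \<otimes>\<^bsub>K (i + 1)\<^esub> ev i v (h (i + 1)) \<oplus>\<^bsub>K (i + 1)\<^esub> c \<otimes>\<^bsub>K (i + 1)\<^esub> ev i v (g (i + 1))"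
  using assms hg_carrier by (simp add: ev_add_right ev_lsmult lsm(1))

lemma expand_left:
  assumes "v \<in> carrier (W i)"
  shows "v = rsmult (W i) (h i) (ev i v (g (i + 1))) \<oplus>\<^bsub>W i\<^esub> rsmult (W i) (g i) (ev i v (h (i + 1)))"
proof -
  interpret k: cring "K (i + 1)" by (rule cring_K)
  obtain b c where bc: "b \<in> carrier (K (i + 1))" "c \<in> carrier (K (i + 1))"
    "v = rsmult (W i) (h i) b \<oplus>\<^bsub>W i\<^esub> rsmult (W i) (g i) c"
    using right_span[OF assms] by blast
  have "ev i v (g (i + 1)) = b" "ev i v (h (i + 1)) = c"
    unfolding bc(3) using bc(1,2) hg_carrier by (simp_all add: ev_comb_left pairing)
  then show ?thesis using bc by simp
qed

text \<open>For \<open>i \<ge> 0\<close> both sides take the same values on all vectors. Otherwise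
  the left expansion of \<open>normal_at\<close> is available, and pairing with g_i and h_i reads
  off its coefficients.\<close>

lemma expand_right:
  assumes "0 \<le> i \<or> normal_at (i + 1)" and n: "n \<in> carrier (W (i + 1))"
  shows "n = ev i (g i) n \<odot>\<^bsub>W (i + 1)\<^esub> h (i + 1) \<oplus>\<^bsub>W (i + 1)\<^esub> ev i (h i) n \<odot>\<^bsub>W (i + 1)\<^esub> g (i + 1)"
    (is "n = ?r")
proof -
  interpret k: cring "K (i + 1)" by (rule cring_K)
  have cl: "ev i (g i) n \<in> carrier (K (i + 1))" "ev i (h i) n \<in> carrier (K (i + 1))"
    using ev_closed hg_carrier n by auto
  show ?thesis
    using assms(1)
  proof
    assume "0 \<le> i"
    then show ?thesis
    proof (rule ev_separates[OF _ n])
      show "?r \<in> carrier (W (i + 1))" using cl hg_carrier by (intro add_closed_W lsm(1)) auto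
      fix v assume v: "v \<in> carrier (W i)"
      let ?b = "ev i v (g (i + 1))" and ?c = "ev i v (h (i + 1))"
      have bc: "?b \<in> carrier (K (i + 1))" "?c \<in> carrier (K (i + 1))"
        using ev_closed hg_carrier v by auto
      have "ev i v n = ev i (h i) n \<otimes>\<^bsub>K (i + 1)\<^esub> ?b \<oplus>\<^bsub>K (i + 1)\<^esub> ev i (g i) n \<otimes>\<^bsub>K (i + 1)\<^esub> ?c"
        by (subst expand_left[OF v]) (rule ev_comb_left[OF bc n])
      also have "\<dots> = ev i v ?r"
        using ev_comb_right[OF cl v] cl bc by (simp add: k.a_comm)
      finally show "ev i v n = ev i v ?r" .
    qed
  next
    assume "normal_at (i + 1)"
    then obtain a c where ac: "a \<in> carrier (K (i + 1))" "c \<in> carrier (K (i + 1))"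
      "n = a \<odot>\<^bsub>W (i + 1)\<^esub> h (i + 1) \<oplus>\<^bsub>W (i + 1)\<^esub> c \<odot>\<^bsub>W (i + 1)\<^esub> g (i + 1)"
      using normal_atD(3) n by blast
    have "ev i (g i) n = a" "ev i (h i) n = c"
      unfolding ac(3) using ac(1,2) hg_carrier by (simp_all add: ev_comb_right pairing)
    then show ?thesis using ac by simp
  qed
qed

text \<open>By \<open>expand_right\<close> the left line of g_(i+1) is the annihilator of g_i. Right
  multiplication preserves this annihilator because left multiplication keeps g_i on its
  line.\<close>

lemma normal_at_up:
  assumes "0 \<le> i" and n: "normal_at i"
  shows "normal_at (i + 1)"
proof -
  interpret k: cring "K (i + 1)" by (rule cring_K)
  interpret w: abelian_group "W (i + 1)" by (rule abelian_W)
  have ix: "i + 1 + 1 = i + 2" by simp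
  let ?g = "g (i + 1)" and ?h = "h (i + 1)"
  have e: "rsmult (W (i + 1)) ?g b = ev i (b \<odot>\<^bsub>W i\<^esub> h i) ?g \<odot>\<^bsub>W (i + 1)\<^esub> ?g" if b: "b \<in> carrier (K i)" for b
  proof -
    obtain b' where b': "b' \<in> carrier (K (i + 1))" "b \<odot>\<^bsub>W i\<^esub> g i = rsmult (W i) (g i) b'"
      using normal_atD(1)[OF n b] by blast
    have r: "rsmult (W (i + 1)) ?g b \<in> carrier (W (i + 1))" using rsmult_closed[OF _ b] hg_carrier by simp
    have "ev i (g i) (rsmult (W (i + 1)) ?g b) = ev i (b \<odot>\<^bsub>W i\<^esub> g i) ?g"
      using ev_middle hg_carrier b by simp
    also have "\<dots> = \<zero>\<^bsub>K (i + 1)\<^esub>"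
      using b' hg_carrier by (simp add: ev_rsmult pairing)
    finally have z: "ev i (g i) (rsmult (W (i + 1)) ?g b) = \<zero>\<^bsub>K (i + 1)\<^esub>" .
    have "\<zero>\<^bsub>K (i + 1)\<^esub> \<odot>\<^bsub>W (i + 1)\<^esub> ?h = \<zero>\<^bsub>W (i + 1)\<^esub>"
      using module.smult_l_null[OF bimodule_left[OF bimodule]] hg_carrier by blast
    moreover have "ev i (b \<odot>\<^bsub>W i\<^esub> h i) ?g \<odot>\<^bsub>W (i + 1)\<^esub> ?g \<in> carrier (W (i + 1))"
      using b hg_carrier by (intro lsm(1) ev_closed) auto
    ultimately show ?thesis
      using expand_right[OF disjI1[OF assms(1)] r] ev_middle[of "h i" i ?g b] b hg_carrier z by simp
  qed
  \<comment> \<open>Expand h_i a from the left as b h_i + c g_i. Pairing with g_(i+1) kills the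
    second term, since c g_i is a right multiple of g_i, and leaves the value
    \<open>a\<close>.\<close>
  have surj: "\<exists>b\<in>carrier (K i). ev i (b \<odot>\<^bsub>W i\<^esub> h i) ?g = a" if a: "a \<in> carrier (K (i + 1))" for a
  proof -
    obtain b c where bc: "b \<in> carrier (K i)" "c \<in> carrier (K i)"
      "rsmult (W i) (h i) a = b \<odot>\<^bsub>W i\<^esub> h i \<oplus>\<^bsub>W i\<^esub> c \<odot>\<^bsub>W i\<^esub> g i"
      using normal_atD(3)[OF n rsm(1)[OF a]] hg_carrier by blast
    obtain c' where c': "c' \<in> carrier (K (i + 1))" "c \<odot>\<^bsub>W i\<^esub> g i = rsmult (W i) (g i) c'"
      using normal_atD(1)[OF n bc(2)] by blast
    have "a = ev i (rsmult (W i) (h i) a) ?g"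
      using a hg_carrier by (simp add: ev_rsmult pairing)
    also have "\<dots> = ev i (b \<odot>\<^bsub>W i\<^esub> h i) ?g \<oplus>\<^bsub>K (i + 1)\<^esub> ev i (rsmult (W i) (g i) c') ?g"
      unfolding bc(3) c'(2) using bc c' hg_carrier by (intro ev_add_left lsm(1) rsm(1)) auto
    also have "\<dots> = ev i (b \<odot>\<^bsub>W i\<^esub> h i) ?g"
      using c' bc hg_carrier ev_closed[of "b \<odot>\<^bsub>W i\<^esub> h i" i ?g] by (simp add: ev_rsmult pairing lsm(1))
    finally show ?thesis using bc by metis
  qed
  have cl: "ev i (b \<odot>\<^bsub>W i\<^esub> h i) ?g \<in> carrier (K (i + 1))" if "b \<in> carrier (K i)" for b
    using that hg_carrier by (intro ev_closed lsm(1)) auto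
  show ?thesis
    unfolding normal_at_def ix periodic
  proof (intro conjI ballI)
    fix a assume "a \<in> carrier (K (i + 1))"
    then show "\<exists>b\<in>carrier (K i). a \<odot>\<^bsub>W (i + 1)\<^esub> ?g = rsmult (W (i + 1)) ?g b"
      using surj e by metis
  next
    fix b assume "b \<in> carrier (K i)"
    then show "\<exists>a\<in>carrier (K (i + 1)). a \<odot>\<^bsub>W (i + 1)\<^esub> ?g = rsmult (W (i + 1)) ?g b"
      using e cl by metis
  next
    fix v assume v: "v \<in> carrier (W (i + 1))"
    show "\<exists>a\<in>carrier (K (i + 1)). \<exists>c\<in>carrier (K (i + 1)). v = a \<odot>\<^bsub>W (i + 1)\<^esub> ?h \<oplus>\<^bsub>W (i + 1)\<^esub> c \<odot>\<^bsub>W (i + 1)\<^esub> ?g"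
      using expand_right[OF disjI1[OF assms(1)] v] ev_closed[OF hg_carrier(1) v] ev_closed[OF hg_carrier(2) v] by blast
  qed
qed

text \<open>The same argument with sides exchanged: by \<open>expand_left\<close> the vectors
  annihilated by g_(i+1) are the right multiples of g_i. In addition the left expansion has to be
  produced.\<close>

lemma normal_at_down:
  assumes n: "normal_at (i + 1)"
  shows "normal_at i"
proof -
  interpret k: cring "K (i + 1)" by (rule cring_K)
  interpret w: abelian_group "W i" by (rule abelian_W)
  have ix: "i + 1 + 1 = i + 2" by simp
  let ?g = "g (i + 1)" and ?h = "h (i + 1)"
  note n1 = normal_atD(1,2)[OF n, unfolded ix periodic]
  have orth: "ev i (g i) (e \<odot>\<^bsub>W (i + 1)\<^esub> ?g) = \<zero>\<^bsub>K (i + 1)\<^esub>" if "e \<in> carrier (K (i + 1))" for e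
    using that hg_carrier by (simp add: ev_lsmult pairing)
  have e: "a \<odot>\<^bsub>W i\<^esub> g i = rsmult (W i) (g i) (ev i (a \<odot>\<^bsub>W i\<^esub> g i) ?h)" if a: "a \<in> carrier (K i)" for a
  proof -
    have l: "a \<odot>\<^bsub>W i\<^esub> g i \<in> carrier (W i)" using lsm(1)[OF a] hg_carrier by simp
    obtain e where "e \<in> carrier (K (i + 1))" "e \<odot>\<^bsub>W (i + 1)\<^esub> ?g = rsmult (W (i + 1)) ?g a"
      using n1(2)[OF a] by blast
    then have z: "ev i (a \<odot>\<^bsub>W i\<^esub> g i) ?g = \<zero>\<^bsub>K (i + 1)\<^esub>"
      using ev_middle[of "g i" i ?g a] orth hg_carrier a by metis
    have "rsmult (W i) (h i) \<zero>\<^bsub>K (i + 1)\<^esub> = \<zero>\<^bsub>W i\<^esub>"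
      using module.smult_l_null[OF bimodule_right[OF bimodule], of "h i"] hg_carrier by simp
    moreover have "rsmult (W i) (g i) (ev i (a \<odot>\<^bsub>W i\<^esub> g i) ?h) \<in> carrier (W i)"
      using l hg_carrier by (intro rsm(1) ev_closed) auto
    ultimately show ?thesis
      using expand_left[OF l] z by simp
  qed
  have cl: "ev i (a \<odot>\<^bsub>W i\<^esub> g i) ?h \<in> carrier (K (i + 1))" if "a \<in> carrier (K i)" for a
    using that hg_carrier by (intro ev_closed lsm(1)) auto
  \<comment> \<open>Here b h_(i+1) is expanded from the right as h_(i+1) a + g_(i+1) c, and pairing
    with g_i keeps only the first term.\<close>
  have surj: "\<exists>a\<in>carrier (K i). ev i (a \<odot>\<^bsub>W i\<^esub> g i) ?h = b" if b: "b \<in> carrier (K (i + 1))" for b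
  proof -
    obtain a c where ac: "a \<in> carrier (K i)" "c \<in> carrier (K i)"
      "b \<odot>\<^bsub>W (i + 1)\<^esub> ?h = rsmult (W (i + 1)) ?h a \<oplus>\<^bsub>W (i + 1)\<^esub> rsmult (W (i + 1)) ?g c"
      using right_span[OF lsm(1)[OF b hg_carrier(1)], unfolded ix periodic] by blast
    obtain e where e: "e \<in> carrier (K (i + 1))" "e \<odot>\<^bsub>W (i + 1)\<^esub> ?g = rsmult (W (i + 1)) ?g c"
      using n1(2)[OF ac(2)] by blast
    have "b = ev i (g i) (b \<odot>\<^bsub>W (i + 1)\<^esub> ?h)"
      using b hg_carrier by (simp add: ev_lsmult pairing)
    also have "\<dots> = ev i (g i) (rsmult (W (i + 1)) ?h a) \<oplus>\<^bsub>K (i + 1)\<^esub> ev i (g i) (rsmult (W (i + 1)) ?g c)"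
      unfolding ac(3) using ac hg_carrier by (intro ev_add_right rsmult_closed) auto
    also have "\<dots> = ev i (a \<odot>\<^bsub>W i\<^esub> g i) ?h"
      using ev_middle[of "g i" i ?h a] orth[OF e(1)] e(2) ac(1) hg_carrier cl[OF ac(1)] by simp
    finally show ?thesis using ac by metis
  qed
  show ?thesis
    unfolding normal_at_def
  proof (intro conjI ballI)
    fix a assume "a \<in> carrier (K i)"
    then show "\<exists>b\<in>carrier (K (i + 1)). a \<odot>\<^bsub>W i\<^esub> g i = rsmult (W i) (g i) b"
      using e cl by metis
  next
    fix b assume "b \<in> carrier (K (i + 1))"
    then show "\<exists>a\<in>carrier (K i). a \<odot>\<^bsub>W i\<^esub> g i = rsmult (W i) (g i) b"
      using e surj by metis
  next
    fix v assume "v \<in> carrier (W i)"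
    then obtain b c where bc: "b \<in> carrier (K (i + 1))" "c \<in> carrier (K (i + 1))"
      "v = rsmult (W i) (h i) b \<oplus>\<^bsub>W i\<^esub> rsmult (W i) (g i) c"
      using right_span by blast
    \<comment> \<open>With b g_(i+1) = g_(i+1) a, the vector a h_i has the same h_i-coordinate
      \<open>b\<close> as \<open>v\<close>. Their difference is a right multiple of g_i, hence also
      a left one, c' g_i.\<close>
    obtain a where a: "a \<in> carrier (K i)" "b \<odot>\<^bsub>W (i + 1)\<^esub> ?g = rsmult (W (i + 1)) ?g a"
      using n1(1)[OF bc(1)] by blast
    define d where "d = ev i (a \<odot>\<^bsub>W i\<^esub> h i) ?h"
    have ah: "a \<odot>\<^bsub>W i\<^esub> h i \<in> carrier (W i)" using lsm(1)[OF a(1)] hg_carrier by simp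
    have d: "d \<in> carrier (K (i + 1))" unfolding d_def using ah hg_carrier by (intro ev_closed) auto
    have "ev i (a \<odot>\<^bsub>W i\<^esub> h i) ?g = b"
      using ev_middle[of "h i" i ?g a] a(1) hg_carrier bc(1) unfolding a(2)[symmetric]
      by (simp add: ev_lsmult pairing)
    then have ah_eq: "a \<odot>\<^bsub>W i\<^esub> h i = rsmult (W i) (h i) b \<oplus>\<^bsub>W i\<^esub> rsmult (W i) (g i) d"
      using expand_left[OF ah] by (simp add: d_def)
    obtain c' where c': "c' \<in> carrier (K i)" "c' \<odot>\<^bsub>W i\<^esub> g i = rsmult (W i) (g i) (c \<ominus>\<^bsub>K (i + 1)\<^esub> d)"
    proof -
      obtain a where "a \<in> carrier (K i)" "ev i (a \<odot>\<^bsub>W i\<^esub> g i) ?h = c \<ominus>\<^bsub>K (i + 1)\<^esub> d"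
        using surj[of "c \<ominus>\<^bsub>K (i + 1)\<^esub> d"] bc d by auto
      then show ?thesis using that e by metis
    qed
    have "c = d \<oplus>\<^bsub>K (i + 1)\<^esub> (c \<ominus>\<^bsub>K (i + 1)\<^esub> d)" using bc d by algebra
    then have "rsmult (W i) (g i) c = rsmult (W i) (g i) d \<oplus>\<^bsub>W i\<^esub> c' \<odot>\<^bsub>W i\<^esub> g i"
      using rsm(3)[of d i "c \<ominus>\<^bsub>K (i + 1)\<^esub> d" "g i"] bc d hg_carrier c' by simp
    then have "v = a \<odot>\<^bsub>W i\<^esub> h i \<oplus>\<^bsub>W i\<^esub> c' \<odot>\<^bsub>W i\<^esub> g i"
      unfolding bc(3) ah_eq using bc d hg_carrier c' by (simp add: w.a_assoc rsm(1) lsm(1))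
    then show "\<exists>a\<in>carrier (K i). \<exists>c\<in>carrier (K i). v = a \<odot>\<^bsub>W i\<^esub> h i \<oplus>\<^bsub>W i\<^esub> c \<odot>\<^bsub>W i\<^esub> g i"
      using a c' by blast
  qed
qed

lemma normal_at_all:
  assumes "normal_at 0"
  shows "normal_at i"
proof (induction i rule: int_induct[where k = 0])
  case base
  show ?case by (rule assms)
next
  case (step1 i)
  then show ?case using normal_at_up by simp
next
  case (step2 i)
  then show ?case using normal_at_down[of "i - 1"] by simp
qed

text \<open>The basis dual to h_i, g_i is g_(i+1), h_(i+1), and \<open>expand_left\<close> is its
  expansion formula. In the application the sum is x_i x_(i+1) + y_i y_(i+1) in either
  order.\<close>

lemma rel_hg: "frag_of [h i, g (i + 1)] + frag_of [g i, h (i + 1)] \<in> rel_frags i (i + 2)"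
  by (rule euler_pair) (use hg_carrier h_neq_g ev_closed expand_left in auto)

theorem normal_nonsimple:
  assumes "normal_at 0"
  shows "normal_family (nc_sym_alg K W ev) 1 (\<lambda>i. sym_class K W ev i (i + 1) (frag_of [g i]))"
proof (rule normal_familyI)
  fix i :: int
  note n = normal_at_all[OF assms]
  have ix: "i + 1 + 1 = i + 2" "i + 1 - 1 = i" by simp_all
  let ?g = "g (i + 1)" and ?h = "h (i + 1)"
  interpret additive_relation "rel_frags i (i + 2)" by (rule additive_relation_rel_frags) simp
  interpret w: abelian_group "W i" by (rule abelian_W)
  interpret w': abelian_group "W (i + 1)" by (rule abelian_W)
  have null: "x \<in> null i (i + 2) \<Longrightarrow> x \<in> rel_frags i (i + 2)" for x by (rule rel_frags_null) simp
  have add_left: "eqv (frag_of [u \<oplus>\<^bsub>W i\<^esub> u', v]) (frag_of [u, v] + frag_of [u', v])"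
    if "u \<in> carrier (W i)" "u' \<in> carrier (W i)" "v \<in> carrier (W (i + 1))" for u u' v
    using null[OF null_additive[of "[]" i i u u' "[v]" "i + 2"]] that
    by (simp add: eqv_def words_Nil words_Cons ix diff_diff_eq)
  have add_right: "eqv (frag_of [u, v \<oplus>\<^bsub>W (i + 1)\<^esub> v']) (frag_of [u, v] + frag_of [u, v'])"
    if "u \<in> carrier (W i)" "v \<in> carrier (W (i + 1))" "v' \<in> carrier (W (i + 1))" for u v v'
    using null[OF null_additive[of "[u]" i "i + 1" v v' "[]" "i + 2"]] that
    by (simp add: eqv_def words_Nil words_Cons ix diff_diff_eq)
  have balanced: "eqv (frag_of [rsmult (W i) u a, v]) (frag_of [u, a \<odot>\<^bsub>W (i + 1)\<^esub> v])"
    if "u \<in> carrier (W i)" "v \<in> carrier (W (i + 1))" "a \<in> carrier (K (i + 1))" for u v a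
    using null[OF null_balanced[of "[]" i i u v "[]" "i + 2" a]] that
    by (simp add: eqv_def words_Nil)
  have euler: "eqv (frag_of [a \<odot>\<^bsub>W i\<^esub> h i, ?g] + frag_of [a \<odot>\<^bsub>W i\<^esub> g i, ?h]) 0" if "a \<in> carrier (K i)" for a
    using rel_frags_lsmult[OF _ that rel_hg] by (simp add: eqv_def)
  have zero: "0 \<in> rel_frags i (i + 1)" using rel_frags_null[OF _ null_zero, of i "i + 1"] by simp
  show "frag_of [g i] \<in> frags i (i + 1)" using hg_carrier by (simp add: words_Cons words_Nil)
  show "\<exists>b\<in>carrier (K i). frag_rsmult (W (i + 1 - 1)) a (frag_of [g i]) - frag_lsmult (W i) b (frag_of [g i])
      \<in> rel_frags i (i + 1)" if a: "a \<in> carrier (K (i + 1))" for a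
  proof -
    obtain b where "b \<in> carrier (K i)" "b \<odot>\<^bsub>W i\<^esub> g i = rsmult (W i) (g i) a"
      using normal_atD(2)[OF n a] by blast
    then show ?thesis using zero by (intro bexI[of _ b]) (simp_all add: ix)
  qed
  show "\<exists>a\<in>carrier (K (i + 1)). frag_rsmult (W (i + 1 - 1)) a (frag_of [g i]) - frag_lsmult (W i) b (frag_of [g i])
      \<in> rel_frags i (i + 1)" if b: "b \<in> carrier (K i)" for b
  proof -
    obtain a where "a \<in> carrier (K (i + 1))" "b \<odot>\<^bsub>W i\<^esub> g i = rsmult (W i) (g i) a"
      using normal_atD(1)[OF n b] by blast
    then show ?thesis using zero by (intro bexI[of _ a]) (simp_all add: ix)
  qed
  show "\<exists>u\<in>carrier (W i). frag_of [g i] \<frown> frag_of [v] - frag_of [u] \<frown> frag_of [?g] \<in> rel_frags i (i + 1 + 1)"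
    if v: "v \<in> carrier (W (i + 1))" for v
  proof -
    obtain a c where ac: "a \<in> carrier (K (i + 1))" "c \<in> carrier (K (i + 1))"
      "v = a \<odot>\<^bsub>W (i + 1)\<^esub> ?h \<oplus>\<^bsub>W (i + 1)\<^esub> c \<odot>\<^bsub>W (i + 1)\<^esub> ?g"
      using normal_atD(3)[OF n v] by blast
    obtain a' where a': "a' \<in> carrier (K i)" "a' \<odot>\<^bsub>W i\<^esub> g i = rsmult (W i) (g i) a"
      using normal_atD(2)[OF n ac(1)] by blast
    have cl: "rsmult (W i) (g i) c \<in> carrier (W i)" "a' \<odot>\<^bsub>W i\<^esub> h i \<in> carrier (W i)"
      using rsm(1)[OF ac(2)] lsm(1)[OF a'(1)] hg_carrier by auto
    \<comment> \<open>g_i v has the terms g_i a h and g_i c g, with h and g at index i + 1. The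
      first is a' g_i h, which the relation a' (h_i g + g_i h) = 0 turns into - a' h_i g; this
      dictates \<open>u\<close>. Its equation is used as a sum, so that additivity of words
      suffices.\<close>
    define u where "u = rsmult (W i) (g i) c \<ominus>\<^bsub>W i\<^esub> a' \<odot>\<^bsub>W i\<^esub> h i"
    have u: "u \<in> carrier (W i)" "rsmult (W i) (g i) c = u \<oplus>\<^bsub>W i\<^esub> a' \<odot>\<^bsub>W i\<^esub> h i"
      unfolding u_def using cl by (auto simp: w.minus_eq w.a_assoc w.l_neg)
    have "eqv (frag_of [g i, v]) (frag_of [g i, a \<odot>\<^bsub>W (i + 1)\<^esub> ?h] + frag_of [g i, c \<odot>\<^bsub>W (i + 1)\<^esub> ?g])"
      unfolding ac(3) using ac hg_carrier by (intro add_right lsm(1)) auto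
    also have "eqv \<dots> (frag_of [a' \<odot>\<^bsub>W i\<^esub> g i, ?h] + frag_of [rsmult (W i) (g i) c, ?g])"
      unfolding a'(2) using ac hg_carrier by (intro eqv_add eqv_sym[OF balanced]) auto
    also have "eqv \<dots> (frag_of [a' \<odot>\<^bsub>W i\<^esub> g i, ?h] + (frag_of [u, ?g] + frag_of [a' \<odot>\<^bsub>W i\<^esub> h i, ?g]))"
      unfolding u(2) using u cl hg_carrier by (intro eqv_add add_left eqv_refl) auto
    also have "\<dots> = frag_of [u, ?g] + (frag_of [a' \<odot>\<^bsub>W i\<^esub> h i, ?g] + frag_of [a' \<odot>\<^bsub>W i\<^esub> g i, ?h])"
      by (simp add: ac_simps)
    also have "eqv \<dots> (frag_of [u, ?g] + 0)"
      by (intro eqv_add euler a' eqv_refl)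
    finally show ?thesis using u(1) by (auto simp: eqv_def ix)
  qed
  show "\<exists>v\<in>carrier (W (i + 1)). frag_of [g i] \<frown> frag_of [v] - frag_of [u] \<frown> frag_of [?g] \<in> rel_frags i (i + 1 + 1)"
    if u: "u \<in> carrier (W i)" for u
  proof -
    obtain a c where ac: "a \<in> carrier (K i)" "c \<in> carrier (K i)" "u = a \<odot>\<^bsub>W i\<^esub> h i \<oplus>\<^bsub>W i\<^esub> c \<odot>\<^bsub>W i\<^esub> g i"
      using normal_atD(3)[OF n u] by blast
    obtain b where b: "b \<in> carrier (K (i + 1))" "a \<odot>\<^bsub>W i\<^esub> g i = rsmult (W i) (g i) b"
      using normal_atD(1)[OF n ac(1)] by blast
    obtain d where d: "d \<in> carrier (K (i + 1))" "c \<odot>\<^bsub>W i\<^esub> g i = rsmult (W i) (g i) d"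
      using normal_atD(1)[OF n ac(2)] by blast
    have cl: "d \<odot>\<^bsub>W (i + 1)\<^esub> ?g \<in> carrier (W (i + 1))" "b \<odot>\<^bsub>W (i + 1)\<^esub> ?h \<in> carrier (W (i + 1))"
      using b d lsm(1) hg_carrier by auto
    \<comment> \<open>From u = a h_i + c g_i: the first term times g_(i+1) becomes - a g_i h_(i+1) =
      - g_i b h_(i+1), and the second is g_i d g_(i+1).\<close>
    define v where "v = d \<odot>\<^bsub>W (i + 1)\<^esub> ?g \<ominus>\<^bsub>W (i + 1)\<^esub> b \<odot>\<^bsub>W (i + 1)\<^esub> ?h"
    have v: "v \<in> carrier (W (i + 1))" "d \<odot>\<^bsub>W (i + 1)\<^esub> ?g = v \<oplus>\<^bsub>W (i + 1)\<^esub> b \<odot>\<^bsub>W (i + 1)\<^esub> ?h"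
      unfolding v_def using cl by (auto simp: w'.minus_eq w'.a_assoc w'.l_neg)
    have "eqv (frag_of [u, ?g]) (frag_of [a \<odot>\<^bsub>W i\<^esub> h i, ?g] + frag_of [c \<odot>\<^bsub>W i\<^esub> g i, ?g])"
      unfolding ac(3) using ac hg_carrier by (intro add_left lsm(1)) auto
    also have "eqv \<dots> (frag_of [a \<odot>\<^bsub>W i\<^esub> h i, ?g] + frag_of [g i, d \<odot>\<^bsub>W (i + 1)\<^esub> ?g])"
      unfolding d(2) using d hg_carrier by (intro eqv_add eqv_refl balanced) auto
    also have "eqv \<dots> (frag_of [a \<odot>\<^bsub>W i\<^esub> h i, ?g] + (frag_of [g i, v] + frag_of [g i, b \<odot>\<^bsub>W (i + 1)\<^esub> ?h]))"
      unfolding v(2) using v cl hg_carrier by (intro eqv_add add_right eqv_refl) auto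
    also have "eqv \<dots> (frag_of [a \<odot>\<^bsub>W i\<^esub> h i, ?g] + (frag_of [g i, v] + frag_of [a \<odot>\<^bsub>W i\<^esub> g i, ?h]))"
      unfolding b(2) using b hg_carrier by (intro eqv_add eqv_refl eqv_sym[OF balanced]) auto
    also have "\<dots> = frag_of [g i, v] + (frag_of [a \<odot>\<^bsub>W i\<^esub> h i, ?g] + frag_of [a \<odot>\<^bsub>W i\<^esub> g i, ?h])"
      by (simp add: ac_simps)
    also have "eqv \<dots> (frag_of [g i, v] + 0)"
      by (intro eqv_add euler ac eqv_refl)
    finally have "eqv (frag_of [g i, v]) (frag_of [u, ?g])" by (simp add: eqv_sym)
    then show ?thesis using v(1) by (auto simp: eqv_def ix)
  qed
qed simp

end

text \<open>In both normal forms the lower left entry vanishes, so the second unit row vector spans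
  a right-stable line. The action on it is through \<tau> in the diagonal form and through \<sigma>
  in the triangular one.\<close>

lemma nonsimple_form_row:
  assumes "field K" "nonsimple_form K \<phi>"
  obtains \<tau> where "\<tau> \<in> ring_iso K K"
    "\<And>a. a \<in> carrier K \<Longrightarrow> row_times_matrix K (\<zero>\<^bsub>K\<^esub>, \<one>\<^bsub>K\<^esub>) (\<phi> a) = (\<zero>\<^bsub>K\<^esub>, \<tau> a)"
proof -
  interpret field K by fact
  show ?thesis
    using assms(2) unfolding nonsimple_form_def
  proof (elim disjE bexE exE conjE)
    fix \<sigma> \<tau>
    assume "\<sigma> \<in> ring_iso K K" "\<tau> \<in> ring_iso K K"
      "\<forall>a\<in>carrier K. \<phi> a = (\<sigma> a, \<zero>\<^bsub>K\<^esub>, \<zero>\<^bsub>K\<^esub>, \<tau> a)"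
    then show ?thesis
      by (intro that[of \<tau>]) (auto simp: row_times_matrix_def ring_iso_memE(1))
  next
    fix \<sigma> \<eta>
    assume "\<sigma> \<in> ring_iso K K" "twisted_derivation K \<sigma> \<eta>"
      "\<forall>a\<in>carrier K. \<phi> a = (\<sigma> a, \<eta> a, \<zero>\<^bsub>K\<^esub>, \<sigma> a)"
    then show ?thesis
      by (intro that[of \<sigma>]) (auto simp: row_times_matrix_def ring_iso_memE(1) twisted_derivation_def Pi_def)
  qed
qed

text \<open>Base of the induction. In coordinates the left and right lines of g_0 are both the
  second axis, because \<open>\<theta>\<^sub>0\<close>, \<open>\<theta>\<^sub>1\<close> and \<tau>
  are surjective; the left expansion is the usual one of row vectors.\<close>

lemma (in alternating_bases) normal_at_zero:
  assumes F: "field F" and \<theta>: "\<theta>\<^sub>0 \<in> ring_iso (K 0) F" "\<theta>\<^sub>1 \<in> ring_iso (K 1) F"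
    and \<phi>: "nonsimple_form F \<phi>"
    and f: "f \<in> bimod_iso (K 0) (K 1) (W 0) (matrix_bimod F \<theta>\<^sub>0 \<theta>\<^sub>1 \<phi>)"
    and hg: "f (h 0) = (\<one>\<^bsub>F\<^esub>, \<zero>\<^bsub>F\<^esub>)" "f (g 0) = (\<zero>\<^bsub>F\<^esub>, \<one>\<^bsub>F\<^esub>)"
  shows "normal_at 0"
proof -
  interpret F: field F by fact
  obtain \<tau> where \<tau>: "\<tau> \<in> ring_iso F F"
    "\<And>a. a \<in> carrier F \<Longrightarrow> row_times_matrix F (\<zero>\<^bsub>F\<^esub>, \<one>\<^bsub>F\<^esub>) (\<phi> a) = (\<zero>\<^bsub>F\<^esub>, \<tau> a)"
    using nonsimple_form_row[OF F \<phi>] by blast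
  have bij: "\<theta>\<^sub>0 ` carrier (K 0) = carrier F" "\<theta>\<^sub>1 ` carrier (K 1) = carrier F" "\<tau> ` carrier F = carrier F"
    using ring_iso_memE(5)[OF \<theta>(1)] ring_iso_memE(5)[OF \<theta>(2)] ring_iso_memE(5)[OF \<tau>(1)]
    by (auto simp: bij_betw_def)
  have cl: "\<And>a. a \<in> carrier (K 0) \<Longrightarrow> \<theta>\<^sub>0 a \<in> carrier F" "\<And>b. b \<in> carrier (K 1) \<Longrightarrow> \<theta>\<^sub>1 b \<in> carrier F"
    "\<And>c. c \<in> carrier F \<Longrightarrow> \<tau> c \<in> carrier F"
    using bij by auto
  have inj: "u = v" if "u \<in> carrier (W 0)" "v \<in> carrier (W 0)" "f u = f v" for u v
    using bij_betw_imp_inj_on[OF bimod_isoD(1)[OF f]] that by (auto dest: inj_onD)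
  have l: "f (a \<odot>\<^bsub>W 0\<^esub> h 0) = (\<theta>\<^sub>0 a, \<zero>\<^bsub>F\<^esub>)" "f (a \<odot>\<^bsub>W 0\<^esub> g 0) = (\<zero>\<^bsub>F\<^esub>, \<theta>\<^sub>0 a)"
    if "a \<in> carrier (K 0)" for a
    using bimod_isoD(3)[OF f that] hg_carrier cl(1)[OF that] by (simp_all add: hg matrix_bimod_def)
  have r: "f (rsmult (W 0) (g 0) b) = (\<zero>\<^bsub>F\<^esub>, \<tau> (\<theta>\<^sub>1 b))" if "b \<in> carrier (K 1)" for b
    using bimod_isoD(4)[OF f that] hg_carrier \<tau>(2)[OF cl(2)[OF that]] by (simp add: hg matrix_bimod_def)
  have lc: "a \<odot>\<^bsub>W 0\<^esub> g 0 \<in> carrier (W 0)" "a \<odot>\<^bsub>W 0\<^esub> h 0 \<in> carrier (W 0)" if "a \<in> carrier (K 0)" for a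
    using lsm(1)[OF that] hg_carrier by auto
  have rc: "rsmult (W 0) (g 0) b \<in> carrier (W 0)" if "b \<in> carrier (K 1)" for b
    using rsm(1)[of b 0 "g 0"] that hg_carrier by simp
  have eq: "a \<odot>\<^bsub>W 0\<^esub> g 0 = rsmult (W 0) (g 0) b" if "a \<in> carrier (K 0)" "b \<in> carrier (K 1)" "\<theta>\<^sub>0 a = \<tau> (\<theta>\<^sub>1 b)" for a b
    using that by (intro inj lc rc) (simp_all add: l r)
  show ?thesis
    unfolding normal_at_def add_0
  proof (intro conjI ballI)
    fix a assume a: "a \<in> carrier (K 0)"
    have "\<theta>\<^sub>0 a \<in> \<tau> ` \<theta>\<^sub>1 ` carrier (K 1)" using cl(1)[OF a] bij by simp
    then show "\<exists>b\<in>carrier (K 1). a \<odot>\<^bsub>W 0\<^esub> g 0 = rsmult (W 0) (g 0) b"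
      using eq[OF a] by auto
  next
    fix b assume b: "b \<in> carrier (K 1)"
    have "\<tau> (\<theta>\<^sub>1 b) \<in> \<theta>\<^sub>0 ` carrier (K 0)" using cl b bij by simp
    then obtain a where "a \<in> carrier (K 0)" "\<theta>\<^sub>0 a = \<tau> (\<theta>\<^sub>1 b)" by (metis imageE)
    then show "\<exists>a\<in>carrier (K 0). a \<odot>\<^bsub>W 0\<^esub> g 0 = rsmult (W 0) (g 0) b"
      using eq[OF _ b] by blast
  next
    fix v assume v: "v \<in> carrier (W 0)"
    have "f v \<in> carrier F \<times> carrier F"
      using bij_betw_apply[OF bimod_isoD(1)[OF f] v] by (simp add: matrix_bimod_def)
    then have "f v \<in> (\<theta>\<^sub>0 ` carrier (K 0)) \<times> (\<theta>\<^sub>0 ` carrier (K 0))" by (simp add: bij)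
    then obtain a c where ac: "a \<in> carrier (K 0)" "c \<in> carrier (K 0)" "f v = (\<theta>\<^sub>0 a, \<theta>\<^sub>0 c)" by auto
    have "v = a \<odot>\<^bsub>W 0\<^esub> h 0 \<oplus>\<^bsub>W 0\<^esub> c \<odot>\<^bsub>W 0\<^esub> g 0"
    proof (rule inj[OF v])
      show "a \<odot>\<^bsub>W 0\<^esub> h 0 \<oplus>\<^bsub>W 0\<^esub> c \<odot>\<^bsub>W 0\<^esub> g 0 \<in> carrier (W 0)"
        using lc ac by (intro add_closed_W) auto
      show "f v = f (a \<odot>\<^bsub>W 0\<^esub> h 0 \<oplus>\<^bsub>W 0\<^esub> c \<odot>\<^bsub>W 0\<^esub> g 0)"
        using bimod_isoD(2)[OF f lc(2)[OF ac(1)] lc(1)[OF ac(2)]] l ac cl(1) by (simp add: matrix_bimod_def)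
    qed
    then show "\<exists>a\<in>carrier (K 0). \<exists>c\<in>carrier (K 0). v = a \<odot>\<^bsub>W 0\<^esub> h 0 \<oplus>\<^bsub>W 0\<^esub> c \<odot>\<^bsub>W 0\<^esub> g 0"
      using ac by blast
  qed
qed

section \<open>Both presentations as instances of the abstract settings\<close>

theorem proposition4p4:
  fixes K\<^sub>0 K\<^sub>1 :: "'a ring"
    and V :: "('a, 'v) bimod"
    and W :: "int \<Rightarrow> ('a, 'v) bimod"
    and ev :: "int \<Rightarrow> 'v \<Rightarrow> 'v \<Rightarrow> 'a"
  assumes "field K\<^sub>0" and "field K\<^sub>1"
    and "\<one>\<^bsub>K\<^sub>0\<^esub> \<oplus>\<^bsub>K\<^sub>0\<^esub> \<one>\<^bsub>K\<^sub>0\<^esub> \<noteq> \<zero>\<^bsub>K\<^sub>0\<^esub>"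
    and "\<one>\<^bsub>K\<^sub>1\<^esub> \<oplus>\<^bsub>K\<^sub>1\<^esub> \<one>\<^bsub>K\<^sub>1\<^esub> \<noteq> \<zero>\<^bsub>K\<^sub>1\<^esub>"
    and "rank_two_bimodule K\<^sub>0 K\<^sub>1 V"
    and "iterated_duals K\<^sub>0 K\<^sub>1 V W ev"
  shows
    "(simple_bimodule K\<^sub>0 K\<^sub>1 V \<longrightarrow>
       (\<forall>(F :: 'f ring) \<iota>\<^sub>0 \<iota>\<^sub>1 \<sigma>\<^sub>0 \<sigma>\<^sub>1 f w\<^sub>0 w\<^sub>1.
          simple_presentation K\<^sub>0 K\<^sub>1 W ev F \<iota>\<^sub>0 \<iota>\<^sub>1 \<sigma>\<^sub>0 \<sigma>\<^sub>1 f \<and>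
          admissible_root K\<^sub>0 K\<^sub>1 F \<iota>\<^sub>0 \<iota>\<^sub>1 0 w\<^sub>0 \<and> admissible_root K\<^sub>0 K\<^sub>1 F \<iota>\<^sub>0 \<iota>\<^sub>1 1 w\<^sub>1 \<longrightarrow>
          normal_family (nc_sym_alg (alt K\<^sub>0 K\<^sub>1) W ev) 2
            (simple_family K\<^sub>0 K\<^sub>1 W ev F f w\<^sub>0 w\<^sub>1))) \<and>
     (\<not> simple_bimodule K\<^sub>0 K\<^sub>1 V \<longrightarrow>
       (\<forall>(K :: 'k ring) \<theta>\<^sub>0 \<theta>\<^sub>1 \<phi> h x y.
          nonsimple_presentation K\<^sub>0 K\<^sub>1 W ev K \<theta>\<^sub>0 \<theta>\<^sub>1 \<phi> h x y \<longrightarrow>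
          normal_family (nc_sym_alg (alt K\<^sub>0 K\<^sub>1) W ev) 1
            (nonsimple_family K\<^sub>0 K\<^sub>1 W ev x y)))"
proof (intro conjI impI allI; (elim conjE)?)
  interpret dual_sequence "alt K\<^sub>0 K\<^sub>1" W ev
    by (rule dual_sequenceI[OF assms(6)])
  fix F :: "'f ring" and \<iota>\<^sub>0 \<iota>\<^sub>1 \<sigma>\<^sub>0 \<sigma>\<^sub>1 f w\<^sub>0 w\<^sub>1
  assume pres: "simple_presentation K\<^sub>0 K\<^sub>1 W ev F \<iota>\<^sub>0 \<iota>\<^sub>1 \<sigma>\<^sub>0 \<sigma>\<^sub>1 f"
    and roots: "admissible_root K\<^sub>0 K\<^sub>1 F \<iota>\<^sub>0 \<iota>\<^sub>1 0 w\<^sub>0" "admissible_root K\<^sub>0 K\<^sub>1 F \<iota>\<^sub>0 \<iota>\<^sub>1 1 w\<^sub>1"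
  then interpret F: field F by (simp add: simple_presentation_def Let_def)
  \<comment> \<open>The roots are taken in the order \<open>w\<^sub>1\<close>,
    \<open>w\<^sub>0\<close>, since their squares have to lie in the field of index
    \<open>i + 1\<close>.\<close>
  interpret S: simple_sym_algebra "alt K\<^sub>0 K\<^sub>1" W ev F "alt \<iota>\<^sub>0 \<iota>\<^sub>1" "alt \<sigma>\<^sub>0 \<sigma>\<^sub>1" f "alt w\<^sub>1 w\<^sub>0"
  proof (intro simple_sym_algebra.intro simple_sym_algebra_axioms.intro, goal_cases)
    case 1 show ?case by unfold_locales
  next
    case 2 show ?case by (rule F.field_axioms)
  next
    case (3 i) show ?case by (simp add: alt_def)
  next
    case (4 i) show ?case by (simp add: alt_def)
  next
    case (5 i) show ?case using assms(1,2) by (simp add: alt_def)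
  next
    case (6 i) show ?case using assms(3,4) by (simp add: alt_def)
  next
    case (7 i) show ?case using pres by (simp add: simple_presentation_def Let_def alt_def)
  next
    case (8 i) show ?case using pres by (simp add: simple_presentation_def Let_def)
  next
    case (9 v i \<psi>) then show ?case using pres by (simp add: simple_presentation_def Let_def)
  next
    case (10 i) show ?case using roots by (simp add: admissible_root_def alt_def)
  next
    case (11 i) show ?case using roots by (simp add: admissible_root_def alt_def)
  next
    case (12 i) show ?case using roots by (simp add: admissible_root_def alt_def)
  next
    case (13 i) show ?case using roots by (simp add: admissible_root_def alt_def)
  qed
  have "simple_family K\<^sub>0 K\<^sub>1 W ev F f w\<^sub>0 w\<^sub>1 = (\<lambda>i. sym_class (alt K\<^sub>0 K\<^sub>1) W ev i (i + 2) (S.\<gamma> i))"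
    by (simp add: fun_eq_iff simple_family_def Let_def S.\<gamma>_def S.p_def)
  then show "normal_family (nc_sym_alg (alt K\<^sub>0 K\<^sub>1) W ev) 2 (simple_family K\<^sub>0 K\<^sub>1 W ev F f w\<^sub>0 w\<^sub>1)"
    using S.normal_simple by simp
next
  interpret dual_sequence "alt K\<^sub>0 K\<^sub>1" W ev
    by (rule dual_sequenceI[OF assms(6)])
  fix K :: "'k ring" and \<theta>\<^sub>0 \<theta>\<^sub>1 \<phi> h x y
  assume pres: "nonsimple_presentation K\<^sub>0 K\<^sub>1 W ev K \<theta>\<^sub>0 \<theta>\<^sub>1 \<phi> h x y"
  have field: "field (alt K\<^sub>0 K\<^sub>1 i)" for i using assms(1,2) by (simp add: alt_def)
  have "is_right_basis (alt K\<^sub>0 K\<^sub>1 (i + 1)) (W i) (x i) (y i)" for i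
    using pres by (simp add: nonsimple_presentation_def)
  note basis = right_basisD[OF field bimodule this]
  \<comment> \<open>At odd indices h_i is \<open>y i\<close>, so the right expansion is needed in
    the other order as well.\<close>
  have swap: "\<exists>b\<in>carrier (alt K\<^sub>0 K\<^sub>1 (i + 1)). \<exists>c\<in>carrier (alt K\<^sub>0 K\<^sub>1 (i + 1)).
      v = rsmult (W i) (y i) b \<oplus>\<^bsub>W i\<^esub> rsmult (W i) (x i) c" if v: "v \<in> carrier (W i)" for v i
  proof -
    interpret w: abelian_group "W i" by (rule abelian_W)
    obtain b c where "b \<in> carrier (alt K\<^sub>0 K\<^sub>1 (i + 1))" "c \<in> carrier (alt K\<^sub>0 K\<^sub>1 (i + 1))"
      "v = rsmult (W i) (x i) b \<oplus>\<^bsub>W i\<^esub> rsmult (W i) (y i) c"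
      using basis(4)[OF v] by blast
    then show ?thesis using w.a_comm rsm(1) basis(1,2) by metis
  qed
  have pairing: "ev i (x i) (x (i + 1)) = \<one>\<^bsub>alt K\<^sub>0 K\<^sub>1 (i + 1)\<^esub>" "ev i (y i) (x (i + 1)) = \<zero>\<^bsub>alt K\<^sub>0 K\<^sub>1 (i + 1)\<^esub>"
    "ev i (x i) (y (i + 1)) = \<zero>\<^bsub>alt K\<^sub>0 K\<^sub>1 (i + 1)\<^esub>" "ev i (y i) (y (i + 1)) = \<one>\<^bsub>alt K\<^sub>0 K\<^sub>1 (i + 1)\<^esub>" for i
    using pres by (simp_all add: nonsimple_presentation_def Let_def)
  let ?h = "\<lambda>i. if even i then x i else y i" and ?g = "\<lambda>i. if even i then y i else x i"
  interpret B: alternating_bases "alt K\<^sub>0 K\<^sub>1" W ev ?h ?g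
  proof (unfold_locales, goal_cases)
    case (4 v i) then show ?case using basis(4)[of v i] swap[of v i] by simp
  qed (use basis(1,2,3) pairing in \<open>auto simp: eq_commute\<close>)
  \<comment> \<open>At the even index 0 the basis is \<open>x 0\<close>, \<open>y 0\<close>, which
    the coordinate map \<open>h\<close> of the presentation sends to the unit vectors.\<close>
  have "B.normal_at 0"
    by (rule B.normal_at_zero[of K \<theta>\<^sub>0 \<theta>\<^sub>1 \<phi> h])
      (use pres in \<open>simp_all add: nonsimple_presentation_def alt_def\<close>)
  then have "normal_family (nc_sym_alg (alt K\<^sub>0 K\<^sub>1) W ev) 1
      (\<lambda>i. sym_class (alt K\<^sub>0 K\<^sub>1) W ev i (i + 1) (frag_of [?g i]))"
    by (rule B.normal_nonsimple)
  then show "normal_family (nc_sym_alg (alt K\<^sub>0 K\<^sub>1) W ev) 1 (nonsimple_family K\<^sub>0 K\<^sub>1 W ev x y)"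
    by (simp add: nonsimple_family_def[abs_def])
qed

end
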